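(* Let $N\ge2$. Let $\{\cdot,\cdot\}_1$ and $\{\cdot,\cdot\}_2$ be the brackets on the space of $q$-local functionals of $t_1(z),\dots,t_N(z)$ determined by $$\{t_i(z),t_j(w)\}_1=\begin{cases}\delta\Big(\dfrac{wq^{N-j}}{z}\Big)t_N(z)t_{i+j-N}(w)-\delta\Big(\dfrac{w}{zq^{N-i}}\Big)t_{i+j-N}(z)t_N(w), & i,j\ne N,\ i+j\ge N,\\ 0,&\text{otherwise,}\end{cases}$$ and, for $i\le j$, $$\{t_i(z),t_j(w)\}_2=\sum_{m\in\mathbb Z}\Big(\frac wz\Big)^m\frac{(1-q^{im})(1-q^{m(N-j)})}{1-q^{mN}}t_i(z)t_j(w)+\sum_{r=1}^{\min(i,N-j)}\delta\Big(\frac{wq^r}{z}\Big)t_{i-r}(w)t_{j+r}(z)-\sum_{r=1}^{\min(i,N-j)}\delta\Big(\frac{w}{zq^{j-i+r}}\Big)t_{i-r}(z)t_{j+r}(w).$$ These Poisson structures are compatible: any linear combination $a\{\cdot,\cdot\}_1+b\{\cdot,\cdot\}_2$ ($a,b\in\mathbb C$) is also a Poisson structure.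
   Context: $q\in\mathbb C^\times$ is generic (in particular not a root of unity). $t_i(z)=\sum_{m\in\mathbb Z}t_i[m]z^{-m}$, $i=1,\dots,N$, are formal Laurent series with independent coefficients $t_i[m]$ (the coordinates on the space of $q$-difference operators $D^N-t_1(z)D^{N-1}+\dots+(-1)^Nt_N(z)$, where $[D\cdot f](z)=f(zq)$), and $t_0(z)\equiv1$. $\delta(x)=\sum_{m\in\mathbb Z}x^m$. The $m=0$ coefficient in the first sum of the second bracket is its limiting value $0$. A $q$-local functional is a linear combination of (infinite) series $\sum_{m_1+\dots+m_k=M}c(m_1,\dots,m_k)\,t_{i_1}[m_1]\cdots t_{i_k}[m_k]$, where $c$ is a rational function of $q^{m_1},\dots,q^{m_k}$ with no poles at integral $m_i$. A formula for $\{t_i(z),t_j(w)\}$ is read as giving $\{t_i[m],t_j[n]\}$ for all $m,n$ by taking Fourier coefficients; for $i>j$ the second bracket is defined by antisymmetry; brackets are extended to all functionals by bilinearity and the Leibniz rule. A Poisson structure means a bracket that is antisymmetric and satisfies the Leibniz rule and the Jacobi identity. *)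

theory Defs
  imports Complex_Main "HOL-Library.Multiset" "HOL-Library.Groups_Big_Fun"
begin

section \<open>Formal series in the coefficients of \<open>t\<^sub>1(z), \<dots>, t\<^sub>N(z)\<close>\<close>

text \<open>
  The pair \<open>(i, m)\<close> stands for the independent variable \<open>t\<^sub>i[m]\<close>, a multiset of such pairs for a
  commutative monomial, and a functional is a possibly infinite formal combination of monomials,
  given by its coefficients. \<^const>\<open>Sum_any\<close> is the sum over the support; wherever it is used
  below, the support is finite for the functionals considered.
\<close>

type_synonym tvar = "nat \<times> int"
type_synonym functional = "tvar multiset \<Rightarrow> complex"

definition fadd :: "functional \<Rightarrow> functional \<Rightarrow> functional" where
  "fadd F G = (\<lambda>X. F X + G X)"

definition fscale :: "complex \<Rightarrow> functional \<Rightarrow> functional" where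
  "fscale a F = (\<lambda>X. a * F X)"

definition fzero :: functional where
  "fzero = (\<lambda>X. 0)"

definition fone :: functional where
  "fone = (\<lambda>X. if X = {#} then 1 else 0)"

definition fmul :: "functional \<Rightarrow> functional \<Rightarrow> functional" where
  "fmul F G = (\<lambda>X. \<Sum>(A, B) | A + B = X. F A * G B)"

text \<open>The formal partial derivative with respect to the variable \<open>u\<close>.\<close>

definition fderiv :: "tvar \<Rightarrow> functional \<Rightarrow> functional" where
  "fderiv u F = (\<lambda>X. of_nat (count X u + 1) * F (add_mset u X))"

text \<open>The coefficient \<open>t\<^sub>i[m]\<close> of \<open>z\<^bsup>-m\<^esup>\<close> in \<open>t\<^sub>i(z)\<close>, where \<open>t\<^sub>0(z) = 1\<close>.\<close>

definition tcoeff :: "nat \<Rightarrow> int \<Rightarrow> functional" where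
  "tcoeff i m = (if i = 0 then (if m = 0 then fone else fzero)
            else (\<lambda>X. if X = {#(i, m)#} then 1 else 0))"


section \<open>q-local functionals\<close>

text \<open>Polynomial functions in \<open>k\<close> complex variables, taken as a list of length \<open>k\<close>.\<close>

inductive_set poly_funs :: "nat \<Rightarrow> (complex list \<Rightarrow> complex) set" for k :: nat where
  const: "(\<lambda>x. a) \<in> poly_funs k"
| coord: "l < k \<Longrightarrow> (\<lambda>x. x ! l) \<in> poly_funs k"
| add: "P \<in> poly_funs k \<Longrightarrow> Q \<in> poly_funs k \<Longrightarrow> (\<lambda>x. P x + Q x) \<in> poly_funs k"
| mult: "P \<in> poly_funs k \<Longrightarrow> Q \<in> poly_funs k \<Longrightarrow> (\<lambda>x. P x * Q x) \<in> poly_funs k"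

text \<open>
  Rational functions of \<open>q\<^bsup>m\<^sub>1\<^esup>, \<dots>, q\<^bsup>m\<^sub>k\<^esup>\<close> without poles at integral \<open>m\<^sub>1, \<dots>, m\<^sub>k\<close>.
  Having no pole is asked of the rational function, not of a given fraction: in lowest terms
  \<open>P / Q\<close> the denominator must not vanish at any of these points.
\<close>

definition regular_rational :: "complex \<Rightarrow> nat \<Rightarrow> (int list \<Rightarrow> complex) \<Rightarrow> bool" where
  "regular_rational q k c \<longleftrightarrow>
     (\<exists>P \<in> poly_funs k. \<exists>Q \<in> poly_funs k. \<forall>ms. length ms = k \<longrightarrow>
        Q (map (\<lambda>m. q powi m) ms) \<noteq> 0 \<and>
        c ms = P (map (\<lambda>m. q powi m) ms) / Q (map (\<lambda>m. q powi m) ms))"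

text \<open>
  The series \<open>\<Sum> c(m\<^sub>1,\<dots>,m\<^sub>k) t\<^bsub>i\<^sub>1\<^esub>[m\<^sub>1] \<cdots> t\<^bsub>i\<^sub>k\<^esub>[m\<^sub>k]\<close> over \<open>m\<^sub>1 + \<dots> + m\<^sub>k = M\<close>, with
  \<open>is = [i\<^sub>1, \<dots>, i\<^sub>k]\<close>. The coefficient of a monomial collects the finitely many orderings of it.
\<close>

definition local_series :: "nat list \<Rightarrow> int \<Rightarrow> (int list \<Rightarrow> complex) \<Rightarrow> functional" where
  "local_series is M c =
     (\<lambda>X. \<Sum>ms | length ms = length is \<and> sum_list ms = M \<and> mset (zip is ms) = X. c ms)"

inductive_set q_local :: "complex \<Rightarrow> nat \<Rightarrow> functional set" for q :: complex and N :: nat where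
  series: "set is \<subseteq> {1..N} \<Longrightarrow> regular_rational q (length is) c \<Longrightarrow> local_series is M c \<in> q_local q N"
| zero: "fzero \<in> q_local q N"
| add: "F \<in> q_local q N \<Longrightarrow> G \<in> q_local q N \<Longrightarrow> fadd F G \<in> q_local q N"
| scale: "F \<in> q_local q N \<Longrightarrow> fscale a F \<in> q_local q N"


section \<open>Poisson structures\<close>

text \<open>
  A product of two q-local functionals is a sum over two independent constraints
  \<open>m\<^sub>1 + \<dots> + m\<^sub>k = M\<close> and \<open>n\<^sub>1 + \<dots> + n\<^sub>l = M'\<close>, hence in general not q-local. The Leibniz rule
  therefore lives on the algebra generated by the q-local functionals.
\<close>

inductive_set generated_algebra :: "functional set \<Rightarrow> functional set" for V :: "functional set" where
  base: "F \<in> V \<Longrightarrow> F \<in> generated_algebra V"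
| one: "fone \<in> generated_algebra V"
| add: "F \<in> generated_algebra V \<Longrightarrow> G \<in> generated_algebra V \<Longrightarrow> fadd F G \<in> generated_algebra V"
| scale: "F \<in> generated_algebra V \<Longrightarrow> fscale a F \<in> generated_algebra V"
| mult: "F \<in> generated_algebra V \<Longrightarrow> G \<in> generated_algebra V \<Longrightarrow> fmul F G \<in> generated_algebra V"

definition bilinear_on ::
    "functional set \<Rightarrow> (functional \<Rightarrow> functional \<Rightarrow> functional) \<Rightarrow> bool" where
  "bilinear_on A br \<longleftrightarrow>
     (\<forall>F\<in>A. \<forall>G\<in>A. \<forall>H\<in>A. br (fadd F G) H = fadd (br F H) (br G H) \<and>
                         br H (fadd F G) = fadd (br H F) (br H G)) \<and>
     (\<forall>F\<in>A. \<forall>G\<in>A. \<forall>a. br (fscale a F) G = fscale a (br F G) \<and>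
                      br F (fscale a G) = fscale a (br F G))"

definition antisymmetric_on ::
    "functional set \<Rightarrow> (functional \<Rightarrow> functional \<Rightarrow> functional) \<Rightarrow> bool" where
  "antisymmetric_on A br \<longleftrightarrow> (\<forall>F\<in>A. \<forall>G\<in>A. br F G = fscale (-1) (br G F))"

definition leibniz_on ::
    "functional set \<Rightarrow> (functional \<Rightarrow> functional \<Rightarrow> functional) \<Rightarrow> bool" where
  "leibniz_on A br \<longleftrightarrow>
     (\<forall>F\<in>A. \<forall>G\<in>A. \<forall>H\<in>A. br F (fmul G H) = fadd (fmul (br F G) H) (fmul G (br F H)) \<and>
                         br (fmul G H) F = fadd (fmul (br G F) H) (fmul G (br H F)))"

definition jacobi_on ::
    "functional set \<Rightarrow> (functional \<Rightarrow> functional \<Rightarrow> functional) \<Rightarrow> bool" where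
  "jacobi_on A br \<longleftrightarrow>
     (\<forall>F\<in>A. \<forall>G\<in>A. \<forall>H\<in>A.
        fadd (br F (br G H)) (fadd (br G (br H F)) (br H (br F G))) = fzero)"

definition poisson_structure ::
    "functional set \<Rightarrow> (functional \<Rightarrow> functional \<Rightarrow> functional) \<Rightarrow> bool" where
  "poisson_structure V br \<longleftrightarrow>
     (\<forall>F\<in>V. \<forall>G\<in>V. br F G \<in> V) \<and>
     (\<forall>F\<in>generated_algebra V. \<forall>G\<in>generated_algebra V. br F G \<in> generated_algebra V) \<and>
     bilinear_on (generated_algebra V) br \<and>
     antisymmetric_on (generated_algebra V) br \<and>
     leibniz_on (generated_algebra V) br \<and>
     jacobi_on (generated_algebra V) br"

text \<open>
  The extension of a bracket given on the variables by \<open>\<beta> i m j n = {t\<^sub>i[m], t\<^sub>j[n]}\<close> to all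
  functionals by (infinite) bilinearity and the Leibniz rule:
  \<open>{F, G} = \<Sum> \<partial>F/\<partial>t\<^sub>i[m] \<cdot> \<partial>G/\<partial>t\<^sub>j[n] \<cdot> {t\<^sub>i[m], t\<^sub>j[n]}\<close>. For functionals in \<open>t\<^sub>1, \<dots>, t\<^sub>N\<close> only
  the indices \<open>1 \<le> i, j \<le> N\<close> contribute.
\<close>

definition extend_bracket ::
    "(nat \<Rightarrow> int \<Rightarrow> nat \<Rightarrow> int \<Rightarrow> functional) \<Rightarrow> functional \<Rightarrow> functional \<Rightarrow> functional" where
  "extend_bracket \<beta> F G =
     (\<lambda>X. Sum_any (\<lambda>((i, m), (j, n)).
        fmul (fmul (fderiv (i, m) F) (fderiv (j, n) G)) (\<beta> i m j n) X))"


section \<open>The two brackets\<close>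

text \<open>
  The coefficient of \<open>z\<^bsup>-m\<^esup> w\<^bsup>-n\<^esup>\<close> in \<open>(\<Sum>p. K(p) (w/z)\<^bsup>p\<^esup>) f(z) g(w)\<close>, where
  \<open>f(z) = \<Sum>m. f[m] z\<^bsup>-m\<^esup>\<close> and \<open>g(w) = \<Sum>n. g[n] w\<^bsup>-n\<^esup>\<close>.
\<close>

definition fourier_coeff ::
    "(int \<Rightarrow> complex) \<Rightarrow> (int \<Rightarrow> functional) \<Rightarrow> (int \<Rightarrow> functional) \<Rightarrow> int \<Rightarrow> int \<Rightarrow> functional" where
  "fourier_coeff K f g m n = (\<lambda>X. Sum_any (\<lambda>p. K p * fmul (f (m - p)) (g (n + p)) X))"

text \<open>The coefficients of \<open>\<delta>(a w/z)\<close> in powers of \<open>w/z\<close>.\<close>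

definition delta :: "complex \<Rightarrow> int \<Rightarrow> complex" where
  "delta a p = a powi p"

definition bracket1_gen ::
    "complex \<Rightarrow> nat \<Rightarrow> nat \<Rightarrow> int \<Rightarrow> nat \<Rightarrow> int \<Rightarrow> functional" where
  "bracket1_gen q N i m j n = (\<lambda>X.
     if i \<noteq> N \<and> j \<noteq> N \<and> N \<le> i + j
     then fourier_coeff (delta (q ^ (N - j))) (tcoeff N) (tcoeff (i + j - N)) m n X
        - fourier_coeff (delta (1 / q ^ (N - i))) (tcoeff (i + j - N)) (tcoeff N) m n X
     else 0)"

definition bracket1 :: "complex \<Rightarrow> nat \<Rightarrow> functional \<Rightarrow> functional \<Rightarrow> functional" where
  "bracket1 q N = extend_bracket (bracket1_gen q N)"

definition bracket2_kernel :: "complex \<Rightarrow> nat \<Rightarrow> nat \<Rightarrow> nat \<Rightarrow> int \<Rightarrow> complex" where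
  "bracket2_kernel q N i j m =
     (if m = 0 then 0
      else (1 - q powi (int i * m)) * (1 - q powi (m * int (N - j))) / (1 - q powi (m * int N)))"

text \<open>The defining formula of the second bracket, meant for \<open>i \<le> j\<close>.\<close>

definition bracket2_upper ::
    "complex \<Rightarrow> nat \<Rightarrow> nat \<Rightarrow> int \<Rightarrow> nat \<Rightarrow> int \<Rightarrow> functional" where
  "bracket2_upper q N i m j n = (\<lambda>X.
       fourier_coeff (bracket2_kernel q N i j) (tcoeff i) (tcoeff j) m n X
     + (\<Sum>r = 1..min i (N - j).
          fourier_coeff (delta (q ^ r)) (tcoeff (j + r)) (tcoeff (i - r)) m n X)
     - (\<Sum>r = 1..min i (N - j).
          fourier_coeff (delta (1 / q ^ (j - i + r))) (tcoeff (i - r)) (tcoeff (j + r)) m n X))"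

definition bracket2_gen ::
    "complex \<Rightarrow> nat \<Rightarrow> nat \<Rightarrow> int \<Rightarrow> nat \<Rightarrow> int \<Rightarrow> functional" where
  "bracket2_gen q N i m j n =
     (if i \<le> j then bracket2_upper q N i m j n else fscale (-1) (bracket2_upper q N j n i m))"

definition bracket2 :: "complex \<Rightarrow> nat \<Rightarrow> functional \<Rightarrow> functional \<Rightarrow> functional" where
  "bracket2 q N = extend_bracket (bracket2_gen q N)"

end

theory Submission
  imports Defs
begin

text \<open>
  Writing \<open>t\<^sub>i(z) = \<ell>(a, b)\<close> for \<open>z = q\<^bsup>a\<^esup>\<close> and \<open>b = a - i\<close>, so that the \<open>t\<^sub>i(z)\<close> are the entries of the matrix of a
  \<open>q\<close>-difference operator, the second bracket becomes the Sklyanin bracket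
  \<open>{\<ell>(a, b), \<ell>(c, d)} = (sgn (a - c) + sgn (b - d)) / 2 \<ell>(a, d) \<ell>(c, b)\<close> plus a term
  \<open>\<Theta> \<ell>(a, b) \<ell>(c, d)\<close> with \<open>\<Theta>\<close> antisymmetric and bilinear in the row and column charges.
  The Sklyanin bracket preserves these charges, so all terms of the Jacobi identity containing
  \<open>\<Theta>\<close> cancel; the others cancel by
  \<open>sgn u sgn v + sgn v sgn w + sgn w sgn u = -1\<close>, valid for \<open>u + v + w = 0\<close> not all zero.

  As \<open>t\<^sub>N\<close> is a Casimir element of the second bracket, replacing \<open>t\<^sub>N\<close> by \<open>\<lambda> t\<^sub>N\<close> on the right-hand
  sides gives another Poisson bracket. It equals \<open>{,}\<^sub>2 + (\<lambda> - 1) {,}\<^sub>1\<close>, and as its Jacobi identity is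
  polynomial in \<open>\<lambda>\<close>, the cases \<open>\<lambda> = 0, 1, 2\<close> give compatibility.
\<close>


section \<open>Formal power series and their infinite sums\<close>

text \<open>The sign identity fails where all three differences vanish, and there the Jacobi sum for
  indices i, j, k keeps cubic terms with coefficient 1/4 or -1/4. Those with coinciding columns
  cancel between the two cyclic exchanges of columns. Those with coinciding rows leave two sums,
  each a quarter of the sum of all products of modes of \<open>T i\<close>, \<open>T j\<close>,
  \<open>T k\<close> with a given total weight; they are equal as sums, not term by term.

  The operator has coefficients of index 0 to N only, while the sign identity needs all integers as
  indices. So the series are extended by 0, and the bracket formula is shown to vanish when its
  second index is at most 0 or at least N. This justifies the truncation and the rescaling of
  \<open>t\<close> at N together.

  Convergence of the infinite sums means that each coefficient is a finite sum. It follows from the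
  weight: a monomial fixes the sum of its modes. Closure of the q-local functionals has its own
  reason: a bracket transfers an arbitrary mode between its two arguments, which merges their two
  weight constraints into one.\<close>

lemma finite_submultisets: "finite {A. A \<subseteq># (X :: 'a multiset)}"
proof (induction X)
  case (add x X)
  have "A \<in> {A. A \<subseteq># X} \<union> add_mset x ` {A. A \<subseteq># X}" if "A \<subseteq># add_mset x X" for A
  proof (cases "x \<in># A")
    case True
    then obtain B where "A = add_mset x B" by (meson multi_member_split)
    with that show ?thesis by auto
  next
    case False
    with that show ?thesis
      by (metis CollectI UnI1 diff_single_trivial subset_eq_diff_conv add_mset_add_single)
  qed
  then have "{A. A \<subseteq># add_mset x X} \<subseteq> {A. A \<subseteq># X} \<union> add_mset x ` {A. A \<subseteq># X}"
    by blast
  then show ?case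
    by (rule finite_subset) (use add in simp)
qed simp

lemma finite_splittings: "finite {(A, B). A + B = (X :: 'a multiset)}"
proof -
  have "{(A, B). A + B = X} \<subseteq> (\<lambda>A. (A, X - A)) ` {A. A \<subseteq># X}"
    by (auto simp: image_iff)
  moreover have "finite {A. A \<subseteq># X}"
    by (rule finite_submultisets)
  ultimately show ?thesis
    by (blast intro: finite_subset)
qed

text \<open>\<open>functional\<close> abbreviates a function type. A copy of it can carry
  \<open>comm_ring_1\<close>, which makes \<open>algebra_simps\<close> and finite sums available;
  \<open>Pseries\<close> and \<open>coeff\<close> translate back at the end.\<close>

typedef pseries = "UNIV :: functional set" morphisms coeff Pseries ..

lemma coeff_Pseries [simp]: "coeff (Pseries F) = F"
  by (simp add: Pseries_inverse)

lemma pseries_eqI: "(\<And>X. coeff F X = coeff G X) \<Longrightarrow> F = G"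
  by (metis coeff_inject ext)

lemma fmul_commute: "fmul F G = fmul G F"
proof
  fix X
  show "fmul F G X = fmul G F X"
    unfolding fmul_def
    by (rule sum.reindex_bij_witness[of _ prod.swap prod.swap]) (auto simp: add.commute)
qed

lemma fmul_assoc: "fmul (fmul F G) H = fmul F (fmul G H)"
proof
  fix X
  let ?S = "\<lambda>X :: tvar multiset. {(A, B). A + B = X}"
  have "fmul (fmul F G) H X = (\<Sum>(P, C)\<in>?S X. \<Sum>(A, B)\<in>?S P. F A * G B * H C)"
    unfolding fmul_def by (intro sum.cong) (auto simp: sum_distrib_right split_def)
  also have "\<dots> = (\<Sum>(P, Q)\<in>Sigma (?S X) (\<lambda>P. ?S (fst P)). F (fst Q) * G (snd Q) * H (snd P))"
    by (subst sum.Sigma[symmetric]) (use finite_splittings in \<open>auto simp: split_def\<close>)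
  also have "\<dots> = (\<Sum>(P, Q)\<in>Sigma (?S X) (\<lambda>P. ?S (snd P)). F (fst P) * G (fst Q) * H (snd Q))"
    by (rule sum.reindex_bij_witness[of _
          "\<lambda>((A, P), (B, C)). ((A + B, C), (A, B))" "\<lambda>((P, C), (A, B)). ((A, B + C), (B, C))"])
       (auto simp: add.assoc)
  also have "\<dots> = (\<Sum>(A, P)\<in>?S X. \<Sum>(B, C)\<in>?S P. F A * G B * H C)"
    by (subst sum.Sigma[symmetric]) (use finite_splittings in \<open>auto simp: split_def\<close>)
  also have "\<dots> = fmul F (fmul G H) X"
    unfolding fmul_def by (intro sum.cong) (auto simp: sum_distrib_left split_def mult.assoc)
  finally show "fmul (fmul F G) H X = fmul F (fmul G H) X" .
qed

lemma fmul_add_left: "fmul (\<lambda>X. F X + G X) H = (\<lambda>X. fmul F H X + fmul G H X)"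
  by (auto simp: fmul_def split_def distrib_right sum.distrib)

lemma fmul_const_left: "fmul (\<lambda>X. if X = {#} then a else 0) F = fscale a F"
proof
  fix X
  have "fmul (\<lambda>X. if X = {#} then a else 0) F X =
        (\<Sum>(A, B)\<in>{({#} :: tvar multiset, X)}. (if A = {#} then a else 0) * F B)"
    unfolding fmul_def
    by (rule sum.mono_neutral_right[OF finite_splittings]) (auto split: if_splits)
  then show "fmul (\<lambda>X. if X = {#} then a else 0) F X = fscale a F X"
    by (simp add: fscale_def)
qed

instantiation pseries :: comm_ring_1
begin

definition "0 = Pseries fzero"
definition "1 = Pseries fone"
definition "F + G = Pseries (fadd (coeff F) (coeff G))"
definition "- F = Pseries (\<lambda>X. - coeff F X)"
definition "F - G = Pseries (\<lambda>X. coeff F X - coeff G X)"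
definition "F * G = Pseries (fmul (coeff F) (coeff G))"

lemmas pseries_defs = zero_pseries_def one_pseries_def plus_pseries_def uminus_pseries_def
  minus_pseries_def times_pseries_def

instance
proof
  fix F G H :: pseries
  show "1 * F = F"
    using fmul_const_left[of 1 "coeff F"]
    by (simp add: pseries_defs fone_def fscale_def coeff_inverse)
  show "(0 :: pseries) \<noteq> 1"
    by (auto simp: pseries_defs Pseries_inject fone_def fzero_def fun_eq_iff)
  show "F * G = G * F"
    by (simp add: pseries_defs fmul_commute)
  show "F * G * H = F * (G * H)"
    by (simp add: pseries_defs fmul_assoc)
  show "(F + G) * H = F * H + G * H"
    by (simp add: pseries_defs fmul_add_left fadd_def)
qed (auto simp: pseries_defs fadd_def fzero_def coeff_inverse algebra_simps)

end

lemma coeff_zero [simp]: "coeff 0 X = 0"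
  and coeff_one: "coeff 1 X = (if X = {#} then 1 else 0)"
  and coeff_add [simp]: "coeff (F + G) X = coeff F X + coeff G X"
  and coeff_minus [simp]: "coeff (- F) X = - coeff F X"
  and coeff_diff [simp]: "coeff (F - G) X = coeff F X - coeff G X"
  and coeff_mult: "coeff (F * G) X = (\<Sum>(A, B) | A + B = X. coeff F A * coeff G B)"
  by (simp_all add: pseries_defs fzero_def fone_def fadd_def fmul_def)

lemma coeff_sum [simp]: "coeff (\<Sum>i\<in>I. f i) X = (\<Sum>i\<in>I. coeff (f i) X)"
  by (induction I rule: infinite_finite_induct) auto

lemma coeff_mult_nonzeroE:
  assumes "coeff (F * G) X \<noteq> 0"
  obtains A B where "A + B = X" "coeff F A \<noteq> 0" "coeff G B \<noteq> 0"
proof -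
  obtain P where "P \<in> {(A, B). A + B = X}" "(\<lambda>(A, B). coeff F A * coeff G B) P \<noteq> 0"
    using assms unfolding coeff_mult by (metis (no_types, lifting) sum.neutral)
  then show thesis using that by auto
qed

definition cst :: "complex \<Rightarrow> pseries" where
  "cst a = Pseries (\<lambda>X. if X = {#} then a else 0)"

lemma coeff_cst_mult [simp]: "coeff (cst a * F) X = a * coeff F X"
  using fmul_const_left[of a "coeff F"] by (simp add: cst_def times_pseries_def fscale_def)

lemma coeff_cst: "coeff (cst a) X = (if X = {#} then a else 0)"
  by (simp add: cst_def)

lemma cst_0 [simp]: "cst 0 = 0" and cst_1 [simp]: "cst 1 = 1"
  by (rule pseries_eqI, simp add: coeff_cst coeff_one)+

lemma cst_add: "cst (a + b) = cst a + cst b"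
  and cst_diff: "cst (a - b) = cst a - cst b"
  and cst_minus: "cst (- a) = - cst a"
  and cst_mult: "cst (a * b) = cst a * cst b"
  by (rule pseries_eqI, simp add: coeff_cst)+

lemma Pseries_fadd: "Pseries (fadd F G) = Pseries F + Pseries G"
  and Pseries_fscale: "Pseries (fscale a F) = cst a * Pseries F"
  and Pseries_fmul: "Pseries (fmul F G) = Pseries F * Pseries G"
  by (simp_all add: pseries_defs)
    (rule pseries_eqI, metis coeff_Pseries coeff_cst_mult fscale_def times_pseries_def)


section \<open>Partial derivatives\<close>

definition D :: "tvar \<Rightarrow> pseries \<Rightarrow> pseries" where
  "D u F = Pseries (fderiv u (coeff F))"

lemma coeff_D: "coeff (D u F) X = of_nat (count X u + 1) * coeff F (add_mset u X)"
  by (simp add: D_def fderiv_def)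

lemma D_0 [simp]: "D u 0 = 0"
  and D_add: "D u (F + G) = D u F + D u G"
  and D_cst_mult: "D u (cst a * F) = cst a * D u F"
  and D_cst [simp]: "D u (cst a) = 0"
  and D_one [simp]: "D u 1 = 0"
  by (rule pseries_eqI, simp add: coeff_D coeff_cst coeff_one ring_distribs; fail)+

lemma D_commute: "D u (D v F) = D v (D u F)"
  by (rule pseries_eqI) (auto simp: coeff_D add_mset_commute)

text \<open>The count of \<open>u\<close> in A removes the splittings without \<open>u\<close> in A,
  and each of the others arises from exactly one splitting of X by adding \<open>u\<close> to A.
  Dividing the count of \<open>u\<close> in \<open>add_mset u X\<close> between A and B then gives
  the Leibniz rule of \<open>D\<close>.\<close>

lemma sum_splittings_count:
  "(\<Sum>(A, B) | A + B = add_mset u X. of_nat (count A u) * (f A B :: complex)) =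
   (\<Sum>(A, B) | A + B = X. of_nat (count A u + 1) * f (add_mset u A) B)"
proof -
  have "(\<Sum>(A, B) | A + B = add_mset u X. of_nat (count A u) * f A B) =
        (\<Sum>(A, B) | A + B = add_mset u X \<and> u \<in># A. of_nat (count A u) * f A B)"
    by (rule sum.mono_neutral_right) (auto simp: finite_splittings not_in_iff)
  also have "\<dots> = (\<Sum>(A, B) | A + B = X. of_nat (count A u + 1) * f (add_mset u A) B)"
    by (rule sum.reindex_bij_witness[of _ "\<lambda>(A, B). (add_mset u A, B)" "\<lambda>(A, B). (A - {#u#}, B)"])
       (auto dest!: multi_member_split)
  finally show ?thesis .
qed

lemma D_mult: "D u (F * G) = D u F * G + F * D u G"
proof (rule pseries_eqI)
  fix X
  let ?S = "{(A, B). A + B = add_mset u X}"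
  have "coeff (D u (F * G)) X = (\<Sum>(A, B)\<in>?S. of_nat (count X u + 1) * (coeff F A * coeff G B))"
    unfolding coeff_D coeff_mult by (simp add: sum_distrib_left split_def)
  also have "\<dots> = (\<Sum>(A, B)\<in>?S. of_nat (count A u) * (coeff F A * coeff G B))
                + (\<Sum>(A, B)\<in>?S. of_nat (count B u) * (coeff F A * coeff G B))"
  proof -
    have "count X u + 1 = count A u + count B u" if "A + B = add_mset u X" for A B
      using arg_cong[OF that, of "\<lambda>Y. count Y u"] by simp
    then show ?thesis
      by (subst sum.distrib[symmetric], intro sum.cong)
         (auto simp flip: of_nat_add distrib_right simp del: of_nat_Suc)
  qed
  also have "(\<Sum>(A, B)\<in>?S. of_nat (count B u) * (coeff F A * coeff G B)) =
             (\<Sum>(A, B)\<in>?S. of_nat (count A u) * (coeff F B * coeff G A))"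
    by (rule sum.reindex_bij_witness[of _ prod.swap prod.swap]) (auto simp: add.commute)
  also have "\<dots> = (\<Sum>(A, B) | A + B = X. of_nat (count A u + 1) * (coeff F B * coeff G (add_mset u A)))"
    by (rule sum_splittings_count)
  also have "\<dots> = (\<Sum>(A, B) | A + B = X. of_nat (count B u + 1) * (coeff F A * coeff G (add_mset u B)))"
    by (rule sum.reindex_bij_witness[of _ prod.swap prod.swap]) (auto simp: add.commute)
  finally show "coeff (D u (F * G)) X = coeff (D u F * G + F * D u G) X"
    by (simp only: sum_splittings_count coeff_add coeff_mult coeff_D) (simp only: mult_ac)
qed

definition V :: "tvar \<Rightarrow> pseries" where
  "V u = Pseries (\<lambda>X. if X = {#u#} then 1 else 0)"

lemma coeff_V: "coeff (V u) X = (if X = {#u#} then 1 else 0)"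
  by (simp add: V_def)

lemma D_V: "D u (V v) = (if u = v then 1 else 0)"
  by (rule pseries_eqI) (auto simp: coeff_D coeff_V coeff_one)


section \<open>Coefficientwise convergent sums\<close>

definition psummable :: "('i \<Rightarrow> pseries) \<Rightarrow> 'i set \<Rightarrow> bool" where
  "psummable f A \<longleftrightarrow> (\<forall>X. finite {i\<in>A. coeff (f i) X \<noteq> 0})"

text \<open>Restricting to the support makes each coefficient of a summable family a genuine finite
  sum; an infinite support would give the default value 0.\<close>

definition psum :: "('i \<Rightarrow> pseries) \<Rightarrow> 'i set \<Rightarrow> pseries" where
  "psum f A = Pseries (\<lambda>X. \<Sum>i | i \<in> A \<and> coeff (f i) X \<noteq> 0. coeff (f i) X)"

lemma coeff_psum: "coeff (psum f A) X = (\<Sum>i | i \<in> A \<and> coeff (f i) X \<noteq> 0. coeff (f i) X)"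
  by (simp add: psum_def)

lemma coeff_psum_superset:
  assumes "finite S" "S \<subseteq> A" "\<And>i. i \<in> A - S \<Longrightarrow> coeff (f i) X = 0"
  shows "coeff (psum f A) X = (\<Sum>i\<in>S. coeff (f i) X)"
  unfolding coeff_psum using assms by (intro sum.mono_neutral_left) auto

lemma psum_cong: "A = B \<Longrightarrow> (\<And>i. i \<in> B \<Longrightarrow> f i = g i) \<Longrightarrow> psum f A = psum g B"
  by (rule pseries_eqI) (auto simp: coeff_psum intro!: sum.cong)

lemma psummable_cong: "A = B \<Longrightarrow> (\<And>i. i \<in> B \<Longrightarrow> f i = g i) \<Longrightarrow> psummable f A = psummable g B"
  unfolding psummable_def by (metis (mono_tags, lifting) Collect_cong)

lemma psum_0 [simp]: "psum (\<lambda>i. 0) A = 0"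
  by (rule pseries_eqI) (simp add: coeff_psum)

lemma psummable_0 [simp]: "psummable (\<lambda>i. 0) A"
  by (simp add: psummable_def)

lemma psum_finite: "finite A \<Longrightarrow> psum f A = sum f A"
  by (rule pseries_eqI) (subst coeff_psum_superset[of A], auto)

lemma psummable_finite: "finite A \<Longrightarrow> psummable f A"
  by (simp add: psummable_def)

lemma psummable_subset: "psummable f B \<Longrightarrow> A \<subseteq> B \<Longrightarrow> psummable f A"
  unfolding psummable_def by (auto elim!: rev_finite_subset)

lemma psummable_add: 
  assumes "psummable f A" "psummable g A" 
  shows "psummable (\<lambda>i. f i + g i) A"
  unfolding psummable_def
proof
  fix X
  have "finite ({i\<in>A. coeff (f i) X \<noteq> 0} \<union> {i\<in>A. coeff (g i) X \<noteq> 0})"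
    using assms by (auto simp: psummable_def)
  then show "finite {i \<in> A. coeff (f i + g i) X \<noteq> 0}"
    by (rule rev_finite_subset) auto
qed

lemma psum_add:
  assumes "psummable f A" "psummable g A" 
  shows "psum (\<lambda>i. f i + g i) A = psum f A + psum g A"
proof (rule pseries_eqI)
  fix X
  let ?S = "{i\<in>A. coeff (f i) X \<noteq> 0} \<union> {i\<in>A. coeff (g i) X \<noteq> 0}"
  have *: "finite ?S"
    using assms by (auto simp: psummable_def)
  show "coeff (psum (\<lambda>i. f i + g i) A) X = coeff (psum f A + psum g A) X"
    unfolding coeff_add
    by (subst (1 2 3) coeff_psum_superset[OF *]) (auto simp: sum.distrib)
qed

lemma psummable_sum:
  "(\<And>k. k \<in> K \<Longrightarrow> psummable (f k) A) \<Longrightarrow> psummable (\<lambda>i. \<Sum>k\<in>K. f k i) A"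
  by (induction K rule: infinite_finite_induct) (auto intro: psummable_add)

lemma psum_sum:
  "(\<And>k. k \<in> K \<Longrightarrow> psummable (f k) A) \<Longrightarrow> psum (\<lambda>i. \<Sum>k\<in>K. f k i) A = (\<Sum>k\<in>K. psum (f k) A)"
  by (induction K rule: infinite_finite_induct) (auto simp: psum_add psummable_sum)

text \<open>A monomial has finitely many splittings P + Q. For each, finitely many \<open>i\<close>
  reach P, and for each of these finitely many \<open>j\<close> reach Q. The inner family may depend
  on \<open>i\<close>, as it does in nested brackets.\<close>

lemma psummable_mult_Sigma:
  assumes "psummable f A" "\<And>i. i \<in> A \<Longrightarrow> psummable (g i) (B i)"
  shows "psummable (\<lambda>(i, j). f i * g i j) (Sigma A B)"
  unfolding psummable_def
proof
  fix X
  let ?I = "\<lambda>P. {i\<in>A. coeff (f i) P \<noteq> 0}"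
  let ?J = "\<lambda>i Q. {j\<in>B i. coeff (g i j) Q \<noteq> 0}"
  have "finite (\<Union>(P, Q)\<in>{(P, Q). P + Q = X}. SIGMA i:?I P. ?J i Q)"
    by (rule finite_UN_I[OF finite_splittings])
       (use assms in \<open>auto simp: psummable_def split_def intro!: finite_SigmaI\<close>)
  then show "finite {p \<in> Sigma A B. coeff (case p of (i, j) \<Rightarrow> f i * g i j) X \<noteq> 0}"
    by (rule rev_finite_subset) (auto elim!: coeff_mult_nonzeroE)
qed

text \<open>A monomial has finitely many divisors, so summability of one factor is inherited by the
  product. The proof treats the second factor as a family over a one-element set.\<close>

lemma psummable_mult_left:
  assumes "psummable f A"
  shows "psummable (\<lambda>i. f i * g i) A"
proof -
  have "psummable (\<lambda>(i, j). f i * g i) (Sigma A (\<lambda>_. {()}))"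
    using assms by (rule psummable_mult_Sigma) (rule psummable_finite, simp)
  then have "finite (fst ` {p \<in> Sigma A (\<lambda>_. {()}). coeff (f (fst p) * g (fst p)) X \<noteq> 0})" for X
    by (auto simp: psummable_def split_def)
  then show ?thesis
    unfolding psummable_def
    by (elim allI[OF rev_finite_subset]) (auto simp: image_iff)
qed

lemma psummable_mult_right: "psummable f A \<Longrightarrow> psummable (\<lambda>i. g i * f i) A"
  using psummable_mult_left[of f A g] by (simp add: mult.commute)

lemma psum_mult_left:
  assumes "psummable f A"
  shows "psum f A * G = psum (\<lambda>i. f i * G) A"
proof (rule pseries_eqI)
  fix X
  define SX :: "(tvar multiset \<times> tvar multiset) set" where "SX = {(A, B). A + B = X}"
  define S where "S = (\<Union>P\<in>SX. {i\<in>A. coeff (f i) (fst P) \<noteq> 0})"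
  have fin: "finite S"
    unfolding S_def SX_def
    by (rule finite_UN_I[OF finite_splittings]) (use assms in \<open>simp add: psummable_def\<close>)
  have mult: "coeff (F * G) X = (\<Sum>P\<in>SX. coeff F (fst P) * coeff G (snd P))" for F
    by (simp add: coeff_mult SX_def split_def)
  have "coeff (psum f A) (fst P) = (\<Sum>i\<in>S. coeff (f i) (fst P))" if "P \<in> SX" for P
    by (rule coeff_psum_superset[OF fin]) (use that in \<open>auto simp: S_def\<close>)
  then have "coeff (psum f A * G) X = (\<Sum>P\<in>SX. (\<Sum>i\<in>S. coeff (f i) (fst P)) * coeff G (snd P))"
    by (simp add: mult)
  also have "\<dots> = (\<Sum>i\<in>S. coeff (f i * G) X)"
    unfolding mult by (subst sum.swap) (simp add: sum_distrib_right)
  also have "\<dots> = coeff (psum (\<lambda>i. f i * G) A) X"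
    by (rule coeff_psum_superset[symmetric, OF fin])
       (auto simp: mult S_def intro!: sum.neutral)
  finally show "coeff (psum f A * G) X = coeff (psum (\<lambda>i. f i * G) A) X" .
qed

lemma psum_mult_right: "psummable f A \<Longrightarrow> G * psum f A = psum (\<lambda>i. G * f i) A"
  using psum_mult_left[of f A G] by (simp add: mult.commute)

text \<open>A nonzero scalar leaves the support at every monomial unchanged, so both sides sum over
  the same index set even where that set is infinite.\<close>

lemma psum_cst_mult: "psum (\<lambda>i. cst a * f i) A = cst a * psum f A"
  by (cases "a = 0") (auto intro!: pseries_eqI simp: coeff_psum sum_distrib_left)

lemma psum_minus: "psum (\<lambda>i. - f i) A = - psum f A"
  using psum_cst_mult[of "-1" f A] by (simp add: cst_minus)

lemma psummable_minus: "psummable f A \<Longrightarrow> psummable (\<lambda>i. - f i) A"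
  by (simp add: psummable_def)

lemma psum_diff:
  "psummable f A \<Longrightarrow> psummable g A \<Longrightarrow> psum (\<lambda>i. f i - g i) A = psum f A - psum g A"
  using psum_add[of f A "\<lambda>i. - g i"] by (simp add: psummable_minus psum_minus)

lemma psum_Sigma:
  assumes "psummable (\<lambda>(i, j). f i j) (Sigma A B)"
  shows "psum (\<lambda>i. psum (f i) (B i)) A = psum (\<lambda>(i, j). f i j) (Sigma A B)"
proof (rule pseries_eqI)
  fix X
  define S where "S = {p \<in> Sigma A B. coeff (case p of (i, j) \<Rightarrow> f i j) X \<noteq> 0}"
  have fin: "finite S"
    using assms by (simp add: psummable_def S_def)
  let ?J = "\<lambda>i. {j \<in> B i. coeff (f i j) X \<noteq> 0}"
  have finJ: "finite (?J i)" if "i \<in> A" for i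
    using finite_imageI[OF fin, of snd] by (rule rev_finite_subset) (use that in \<open>force simp: S_def\<close>)
  have "coeff (psum (\<lambda>i. psum (f i) (B i)) A) X = (\<Sum>i\<in>fst ` S. coeff (psum (f i) (B i)) X)"
    by (rule coeff_psum_superset)
       (use fin in \<open>auto simp: S_def coeff_psum image_iff intro!: sum.neutral\<close>)
  also have "\<dots> = (\<Sum>p\<in>Sigma (fst ` S) ?J. coeff (f (fst p) (snd p)) X)"
    unfolding coeff_psum
    by (subst sum.Sigma) (use fin finJ in \<open>auto simp: split_def S_def\<close>)
  also have "Sigma (fst ` S) ?J = S"
    by (force simp: S_def)
  finally show "coeff (psum (\<lambda>i. psum (f i) (B i)) A) X = coeff (psum (\<lambda>(i, j). f i j) (Sigma A B)) X"
    by (simp add: coeff_psum S_def split_def)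
qed

lemma psummable_psum:
  assumes "psummable (\<lambda>(i, j). f i j) (Sigma A B)"
  shows "psummable (\<lambda>i. psum (f i) (B i)) A"
  unfolding psummable_def
proof
  fix X
  have "finite (fst ` {p \<in> Sigma A B. coeff (case p of (i, j) \<Rightarrow> f i j) X \<noteq> 0})"
    using assms by (simp add: psummable_def)
  then show "finite {i \<in> A. coeff (psum (f i) (B i)) X \<noteq> 0}"
  proof (rule rev_finite_subset, intro subsetI)
    fix i assume "i \<in> {i \<in> A. coeff (psum (f i) (B i)) X \<noteq> 0}"
    then obtain j where "i \<in> A" "j \<in> B i" "coeff (f i j) X \<noteq> 0"
      unfolding coeff_psum by (metis (mono_tags, lifting) mem_Collect_eq sum.neutral)
    then show "i \<in> fst ` {p \<in> Sigma A B. coeff (case p of (i, j) \<Rightarrow> f i j) X \<noteq> 0}"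
      by (intro image_eqI[of _ _ "(i, j)"]) auto
  qed
qed

lemma psum_reindex:
  assumes "bij_betw h A B"
  shows "psum f B = psum (\<lambda>i. f (h i)) A"
proof (rule pseries_eqI)
  fix X
  have "bij_betw h {i \<in> A. coeff (f (h i)) X \<noteq> 0} {j \<in> B. coeff (f j) X \<noteq> 0}"
    using assms unfolding bij_betw_def by (auto simp: inj_on_def)
  then show "coeff (psum f B) X = coeff (psum (\<lambda>i. f (h i)) A) X"
    unfolding coeff_psum by (rule sum.reindex_bij_betw[symmetric])
qed

lemma psum_reindex_witness:
  assumes "\<And>a. a \<in> A \<Longrightarrow> k (h a) = a" "\<And>a. a \<in> A \<Longrightarrow> h a \<in> B"
    "\<And>b. b \<in> B \<Longrightarrow> h (k b) = b" "\<And>b. b \<in> B \<Longrightarrow> k b \<in> A"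
    "\<And>a. a \<in> A \<Longrightarrow> f (h a) = g a"
  shows "psum f B = psum g A"
proof -
  have "bij_betw h A B"
    by (rule bij_betw_byWitness[of _ k]) (use assms in auto)
  from psum_reindex[OF this, of f] show ?thesis
    using assms(5) by (simp cong: psum_cong)
qed

lemma psummable_inj:
  assumes "psummable f B" "inj_on h A" "h ` A \<subseteq> B"
  shows "psummable (\<lambda>i. f (h i)) A"
  unfolding psummable_def
proof
  fix X
  have "finite {j\<in>B. coeff (f j) X \<noteq> 0}"
    using assms(1) by (simp add: psummable_def)
  then have "finite (h ` {i \<in> A. coeff (f (h i)) X \<noteq> 0})"
    by (rule rev_finite_subset) (use assms(3) in auto)
  then show "finite {i \<in> A. coeff (f (h i)) X \<noteq> 0}"
    by (rule finite_imageD) (use assms(2) in \<open>auto simp: inj_on_def\<close>)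
qed

lemma psum_mono_neutral:
  assumes "A \<subseteq> B" "\<And>i. i \<in> B - A \<Longrightarrow> f i = 0"
  shows "psum f B = psum f A"
proof -
  have "{i \<in> B. coeff (f i) X \<noteq> 0} = {i \<in> A. coeff (f i) X \<noteq> 0}" for X
    using assms by (metis (lifting) DiffI coeff_zero subsetD)
  then show ?thesis
    by (intro pseries_eqI) (simp add: coeff_psum)
qed

lemma D_psum:
  assumes "psummable f A"
  shows "D u (psum f A) = psum (\<lambda>i. D u (f i)) A"
proof (rule pseries_eqI)
  fix X
  have fin: "finite {i\<in>A. coeff (f i) (add_mset u X) \<noteq> 0}"
    using assms by (simp add: psummable_def)
  show "coeff (D u (psum f A)) X = coeff (psum (\<lambda>i. D u (f i)) A) X"
    by (subst coeff_psum_superset[OF fin]) (auto simp: coeff_D coeff_psum sum_distrib_left)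
qed

lemma psummable_D:
  assumes "psummable f A"
  shows "psummable (\<lambda>i. D u (f i)) A"
  unfolding psummable_def
proof
  fix X
  have "finite {i \<in> A. coeff (f i) (add_mset u X) \<noteq> 0}"
    using assms by (simp add: psummable_def)
  then show "finite {i \<in> A. coeff (D u (f i)) X \<noteq> 0}"
    by (rule rev_finite_subset) (auto simp: coeff_D)
qed


section \<open>Graded brackets\<close>

text \<open>The indices are nested: each factor is summable in its own index once the earlier ones
  are fixed. Double brackets converge because their four indices can be put in such an
  order.\<close>

lemma psummable_quad:
  assumes "psummable f A" "\<And>x. x \<in> A \<Longrightarrow> psummable (g x) B"
    "\<And>x y. x \<in> A \<Longrightarrow> y \<in> B \<Longrightarrow> psummable (h x y) C"
    "\<And>x y z. x \<in> A \<Longrightarrow> y \<in> B \<Longrightarrow> z \<in> C \<Longrightarrow> psummable (k x y z) E"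
  shows "psummable (\<lambda>(x, y, z, t). f x * (g x y * (h x y z * k x y z t))) (A \<times> B \<times> C \<times> E)"
proof -
  have 1: "psummable (\<lambda>(z, t). h x y z * k x y z t) (C \<times> E)" if "x \<in> A" "y \<in> B" for x y
    by (rule psummable_mult_Sigma) (use that assms in auto)
  have 2: "psummable (\<lambda>(y, p). g x y * (\<lambda>(z, t). h x y z * k x y z t) p) (B \<times> C \<times> E)"
    if "x \<in> A" for x
    by (rule psummable_mult_Sigma) (use that assms(2) 1 in auto)
  have "psummable (\<lambda>(x, p). f x * (\<lambda>(y, p). g x y * (\<lambda>(z, t). h x y z * k x y z t) p) p)
      (A \<times> B \<times> C \<times> E)"
    by (rule psummable_mult_Sigma) (use assms(1) 2 in auto)
  then show ?thesis
    by (simp add: split_def)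
qed

section \<open>Functionals of bounded weight\<close>

definition wt :: "tvar multiset \<Rightarrow> int" where
  "wt X = sum_mset (image_mset snd X)"

lemma wt_simps [simp]: "wt {#} = 0" "wt (add_mset u X) = snd u + wt X" "wt (X + Y) = wt X + wt Y"
  by (simp_all add: wt_def)

definition vars :: "nat \<Rightarrow> tvar set" where
  "vars N = {1..N} \<times> UNIV"

text \<open>This class contains the q-local functionals, is closed under products and brackets, and
  still makes the family of derivatives summable. A finite set of weights is allowed because sums of
  q-local series mix several total weights M.\<close>

definition bounded_wt :: "nat \<Rightarrow> pseries set" where
  "bounded_wt N = {F. \<exists>S. finite S \<and> (\<forall>X. coeff F X \<noteq> 0 \<longrightarrow> wt X \<in> S \<and> set_mset X \<subseteq> vars N)}"

lemma bounded_wtI: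
  "finite S \<Longrightarrow> (\<And>X. coeff F X \<noteq> 0 \<Longrightarrow> wt X \<in> S \<and> set_mset X \<subseteq> vars N) \<Longrightarrow> F \<in> bounded_wt N"
  by (auto simp: bounded_wt_def)

lemma bounded_wtE:
  assumes "F \<in> bounded_wt N"
  obtains S where "finite S" "\<And>X. coeff F X \<noteq> 0 \<Longrightarrow> wt X \<in> S"
    "\<And>X. coeff F X \<noteq> 0 \<Longrightarrow> set_mset X \<subseteq> vars N"
  using assms by (auto simp: bounded_wt_def)

lemma bounded_wt_zero [simp]: "0 \<in> bounded_wt N"
  by (rule bounded_wtI[of "{}"]) auto

lemma bounded_wt_one [simp]: "1 \<in> bounded_wt N"
  by (rule bounded_wtI[of "{0}"]) (auto simp: coeff_one split: if_splits)

lemma bounded_wt_V: "u \<in> vars N \<Longrightarrow> V u \<in> bounded_wt N"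
  by (rule bounded_wtI[of "{snd u}"]) (auto simp: coeff_V split: if_splits)

lemma bounded_wt_add [intro]:
  assumes "F \<in> bounded_wt N" "G \<in> bounded_wt N"
  shows "F + G \<in> bounded_wt N"
proof -
  from assms obtain S T where *: "finite S" "finite T"
    "\<And>X. coeff F X \<noteq> 0 \<Longrightarrow> wt X \<in> S" "\<And>X. coeff F X \<noteq> 0 \<Longrightarrow> set_mset X \<subseteq> vars N"
    "\<And>X. coeff G X \<noteq> 0 \<Longrightarrow> wt X \<in> T" "\<And>X. coeff G X \<noteq> 0 \<Longrightarrow> set_mset X \<subseteq> vars N"
    by (metis bounded_wtE)
  show ?thesis
  proof (rule bounded_wtI[of "S \<union> T"])
    fix X assume "coeff (F + G) X \<noteq> 0"
    then have "coeff F X \<noteq> 0 \<or> coeff G X \<noteq> 0" by auto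
    with *(3-6)[of X] show "wt X \<in> S \<union> T \<and> set_mset X \<subseteq> vars N" by blast
  qed (use * in simp)
qed

lemma bounded_wt_cst_mult [intro]: "F \<in> bounded_wt N \<Longrightarrow> cst a * F \<in> bounded_wt N"
  by (auto simp: bounded_wt_def)

lemma bounded_wt_mult [intro]:
  assumes "F \<in> bounded_wt N" "G \<in> bounded_wt N"
  shows "F * G \<in> bounded_wt N"
proof -
  from assms obtain S T where *: "finite S" "finite T"
    "\<And>X. coeff F X \<noteq> 0 \<Longrightarrow> wt X \<in> S" "\<And>X. coeff F X \<noteq> 0 \<Longrightarrow> set_mset X \<subseteq> vars N"
    "\<And>X. coeff G X \<noteq> 0 \<Longrightarrow> wt X \<in> T" "\<And>X. coeff G X \<noteq> 0 \<Longrightarrow> set_mset X \<subseteq> vars N"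
    by (metis bounded_wtE)
  show ?thesis
  proof (rule bounded_wtI[of "(\<lambda>(s, t). s + t) ` (S \<times> T)"])
    fix X assume "coeff (F * G) X \<noteq> 0"
    then obtain A B where "A + B = X" "coeff F A \<noteq> 0" "coeff G B \<noteq> 0"
      by (rule coeff_mult_nonzeroE)
    with *(3-6)[of A] *(3-6)[of B] 
    show "wt X \<in> (\<lambda>(s, t). s + t) ` (S \<times> T) \<and> set_mset X \<subseteq> vars N"
      by auto
  qed (use * in auto)
qed

lemma D_outside_vars:
  assumes "F \<in> bounded_wt N" "u \<notin> vars N"
  shows "D u F = 0"
proof (rule pseries_eqI)
  fix X
  have "coeff F (add_mset u X) = 0"
    using assms by (auto simp: bounded_wt_def)
  then show "coeff (D u F) X = coeff 0 X"
    by (simp add: coeff_D)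
qed

text \<open>For a fixed X, a nonzero coefficient forces the mode of \<open>u\<close> to be s -
  \<open>wt X\<close> for one of finitely many weights s, and the index of \<open>u\<close> lies in
  1..N.\<close>

lemma psummable_D_bounded_wt:
  assumes "F \<in> bounded_wt N"
  shows "psummable (\<lambda>u. D u F) A"
  unfolding psummable_def
proof
  fix X
  from assms obtain S where S: "finite S" 
    "\<And>X. coeff F X \<noteq> 0 \<Longrightarrow> wt X \<in> S" "\<And>X. coeff F X \<noteq> 0 \<Longrightarrow> set_mset X \<subseteq> vars N"
    by (metis bounded_wtE)
  show "finite {u \<in> A. coeff (D u F) X \<noteq> 0}"
  proof (rule finite_subset)
    show "{u \<in> A. coeff (D u F) X \<noteq> 0} \<subseteq> {1..N} \<times> (\<lambda>s. s - wt X) ` S"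
    proof
      fix u assume "u \<in> {u \<in> A. coeff (D u F) X \<noteq> 0}"
      then have "coeff F (add_mset u X) \<noteq> 0"
        by (auto simp: coeff_D)
      from S(2,3)[OF this] show "u \<in> {1..N} \<times> (\<lambda>s. s - wt X) ` S"
        by (cases u) (auto simp: vars_def image_iff intro!: bexI[of _ "snd u + wt X"])
    qed
  qed (use S in auto)
qed

text \<open>Homogeneity is the source of convergence: given one of \<open>u\<close>,
  \<open>v\<close> and a monomial of \<open>\<beta> u v\<close>, the mode of the other variable is
  determined.\<close>

locale graded_bracket =
  fixes N :: nat and \<beta> :: "tvar \<Rightarrow> tvar \<Rightarrow> pseries"
  assumes antisym: "u \<in> vars N \<Longrightarrow> v \<in> vars N \<Longrightarrow> \<beta> u v = - \<beta> v u"
    and graded: "u \<in> vars N \<Longrightarrow> v \<in> vars N \<Longrightarrow> coeff (\<beta> u v) X \<noteq> 0 \<Longrightarrow>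
          wt X = snd u + snd v \<and> set_mset X \<subseteq> vars N"
begin

abbreviation U where "U \<equiv> vars N"
abbreviation UU where "UU \<equiv> vars N \<times> vars N"

definition PB :: "pseries \<Rightarrow> pseries \<Rightarrow> pseries" where
  "PB F G = psum (\<lambda>(u, v). D u F * (D v G * \<beta> u v)) UU"

text \<open>The Hamiltonian derivation {t_u, F}. The bracket of two generators is a quadratic
  series, so the Jacobi identity on generators has to be stated with it.\<close>

definition ham :: "tvar \<Rightarrow> pseries \<Rightarrow> pseries" where
  "ham u F = psum (\<lambda>a. \<beta> u a * D a F) U"

lemma psummable_gen:
  assumes "u \<in> U"
  shows "psummable (\<beta> u) U"
  unfolding psummable_def
proof
  fix X
  have "{v \<in> U. coeff (\<beta> u v) X \<noteq> 0} \<subseteq> {1..N} \<times> {wt X - snd u}"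
    using graded[OF assms] by (auto simp: vars_def)
  then show "finite {v \<in> U. coeff (\<beta> u v) X \<noteq> 0}"
    by (rule finite_subset) simp
qed

lemma psummable_gen_left: 
  assumes "v \<in> U"
  shows "psummable (\<lambda>u. \<beta> u v) U"
proof -
  have "psummable (\<lambda>u. - \<beta> v u) U"
    using assms by (intro psummable_minus psummable_gen)
  then show ?thesis
    using antisym[OF _ assms] by (simp cong: psummable_cong)
qed

lemma psummable_PB:
  assumes "F \<in> bounded_wt N" "G \<in> bounded_wt N"
  shows "psummable (\<lambda>(u, v). D u F * (D v G * \<beta> u v)) UU"
  using assms by (intro psummable_mult_Sigma psummable_mult_left psummable_D_bounded_wt)

lemma bounded_wt_PB [intro]:
  assumes "F \<in> bounded_wt N" "G \<in> bounded_wt N"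
  shows "PB F G \<in> bounded_wt N"
proof -
  from assms obtain S T where *: "finite S" "finite T"
    "\<And>X. coeff F X \<noteq> 0 \<Longrightarrow> wt X \<in> S" "\<And>X. coeff F X \<noteq> 0 \<Longrightarrow> set_mset X \<subseteq> vars N"
    "\<And>X. coeff G X \<noteq> 0 \<Longrightarrow> wt X \<in> T" "\<And>X. coeff G X \<noteq> 0 \<Longrightarrow> set_mset X \<subseteq> vars N"
    by (metis bounded_wtE)
  show ?thesis
  proof (rule bounded_wtI[of "(\<lambda>(s, t). s + t) ` (S \<times> T)"])
    fix X assume "coeff (PB F G) X \<noteq> 0"
    then obtain p where "p \<in> UU" "coeff (case p of (u, v) \<Rightarrow> D u F * (D v G * \<beta> u v)) X \<noteq> 0"
      unfolding PB_def coeff_psum by (metis (mono_tags, lifting) mem_Collect_eq sum.neutral)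
    then obtain u v where uv: "u \<in> U" "v \<in> U" and "coeff (D u F * (D v G * \<beta> u v)) X \<noteq> 0"
      by (cases p) auto
    then obtain A B C where X: "X = A + (B + C)" "coeff (D u F) A \<noteq> 0" "coeff (D v G) B \<noteq> 0"
      "coeff (\<beta> u v) C \<noteq> 0"
      by (metis coeff_mult_nonzeroE)
    then have "coeff F (add_mset u A) \<noteq> 0" "coeff G (add_mset v B) \<noteq> 0"
      by (auto simp: coeff_D)
    with *(3-6)[of "add_mset u A"] *(3-6)[of "add_mset v B"] graded[OF uv X(4)]
    show "wt X \<in> (\<lambda>(s, t). s + t) ` (S \<times> T) \<and> set_mset X \<subseteq> vars N"
      by (auto simp: X(1) intro!: image_eqI[of _ _ "(wt (add_mset u A), wt (add_mset v B))"])
  qed (use * in auto)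
qed

lemma PB_antisym:
  "PB F G = - PB G F"
proof -
  have "PB F G = psum (\<lambda>(v, u). - (D v G * (D u F * \<beta> v u))) UU"
    unfolding PB_def
  proof (rule psum_reindex_witness[where h = prod.swap and k = prod.swap])
    fix p assume "p \<in> UU"
    then obtain u v where p: "p = (v, u)" "u \<in> U" "v \<in> U"
      by (cases p) auto
    show "(case prod.swap p of (u, v) \<Rightarrow> D u F * (D v G * \<beta> u v)) =
      (case p of (v, u) \<Rightarrow> - (D v G * (D u F * \<beta> v u)))"
      by (simp add: p antisym[of u v] mult_ac)
  qed auto
  then show ?thesis
    unfolding PB_def by (simp add: psum_minus[symmetric] split_def)
qed

lemma PB_add_right:
  assumes "F \<in> bounded_wt N" "G \<in> bounded_wt N" "H \<in> bounded_wt N"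
  shows "PB F (G + H) = PB F G + PB F H"
  unfolding PB_def using psum_add[OF psummable_PB[OF assms(1,2)] psummable_PB[OF assms(1,3)]]
  by (simp add: D_add split_def algebra_simps)

lemma PB_add_left:
  assumes "F \<in> bounded_wt N" "G \<in> bounded_wt N" "H \<in> bounded_wt N"
  shows "PB (F + G) H = PB F H + PB G H"
  using PB_add_right[OF assms(3,1,2)] by (simp add: PB_antisym[of _ H])

lemma PB_cst_right: "PB F (cst a * G) = cst a * PB F G"
  unfolding PB_def psum_cst_mult[symmetric] D_cst_mult by (simp add: split_def mult_ac)

lemma PB_cst_left: "PB (cst a * F) G = cst a * PB F G"
  using PB_cst_right[of G a F] by (simp add: PB_antisym[of _ G])

lemma PB_mult_right:
  assumes "F \<in> bounded_wt N" "G \<in> bounded_wt N" "H \<in> bounded_wt N"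
  shows "PB F (G * H) = PB F G * H + G * PB F H"
proof -
  have "PB F (G * H) = psum (\<lambda>p. (case p of (u, v) \<Rightarrow> D u F * (D v G * \<beta> u v)) * H
      + G * (case p of (u, v) \<Rightarrow> D u F * (D v H * \<beta> u v))) UU"
    unfolding PB_def by (simp add: D_mult split_def algebra_simps)
  also have "\<dots> = PB F G * H + G * PB F H"
    unfolding PB_def using assms
    by (subst psum_add)
       (simp_all add: psum_mult_left psum_mult_right psummable_mult_left psummable_mult_right psummable_PB)
  finally show ?thesis .
qed

text \<open>\<open>S1\<close>, \<open>S2\<close>, \<open>S3\<close> are the three Leibniz terms of
  \<open>D a\<close> applied to \<open>D v G * (D w H * \<beta> v w)\<close>. The first two contain
  second derivatives and cancel over the cyclic sum; the third involves only the brackets of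
  generators.\<close>

definition S1 where "S1 F G H =
  psum (\<lambda>((u, a), (v, w)). D u F * (D w H * (\<beta> u a * (\<beta> v w * D a (D v G))))) (UU \<times> UU)"
definition S2 where "S2 F G H =
  psum (\<lambda>((u, a), (v, w)). D u F * (D v G * (\<beta> u a * (\<beta> v w * D a (D w H))))) (UU \<times> UU)"
definition S3 where "S3 F G H =
  psum (\<lambda>((u, a), (v, w)). D u F * (D v G * (D w H * (\<beta> u a * D a (\<beta> v w))))) (UU \<times> UU)"

text \<open>The order of summation is u, w, a, v: the derivatives of F and H control
  \<open>u\<close> and \<open>w\<close>, then \<open>\<beta> u a\<close> controls \<open>a\<close>,
  and \<open>\<beta> v w\<close> with \<open>w\<close> already fixed controls \<open>v\<close>. For
  \<open>S2\<close> and \<open>S3\<close> the orders are u, v, a, w and u, v, w, a.\<close>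

lemma psummable_S1:
  assumes "F \<in> bounded_wt N" "G \<in> bounded_wt N" "H \<in> bounded_wt N"
  shows "psummable (\<lambda>((u, a), (v, w)). D u F * (D w H * (\<beta> u a * (\<beta> v w * D a (D v G))))) (UU \<times> UU)"
proof -
  have "psummable (\<lambda>(u, w, a, v). D u F * (D w H * (\<beta> u a * (\<beta> v w * D a (D v G))))) (U \<times> U \<times> U \<times> U)"
    using assms
    by (intro psummable_quad psummable_D_bounded_wt psummable_mult_left psummable_gen psummable_gen_left)
  from psummable_inj[OF this, of "\<lambda>((u, a), (v, w)). (u, w, a, v)" "UU \<times> UU"]
  show ?thesis by (simp add: split_def inj_on_def image_subset_iff)
qed

lemma psummable_S2:
  assumes "F \<in> bounded_wt N" "G \<in> bounded_wt N" "H \<in> bounded_wt N"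
  shows "psummable (\<lambda>((u, a), (v, w)). D u F * (D v G * (\<beta> u a * (\<beta> v w * D a (D w H))))) (UU \<times> UU)"
proof -
  have "psummable (\<lambda>(u, v, a, w). D u F * (D v G * (\<beta> u a * (\<beta> v w * D a (D w H))))) (U \<times> U \<times> U \<times> U)"
    using assms
    by (intro psummable_quad psummable_D_bounded_wt psummable_mult_left psummable_gen psummable_gen_left)
  from psummable_inj[OF this, of "\<lambda>((u, a), (v, w)). (u, v, a, w)" "UU \<times> UU"]
  show ?thesis by (simp add: split_def inj_on_def image_subset_iff)
qed

lemma psummable_S3:
  assumes "F \<in> bounded_wt N" "G \<in> bounded_wt N" "H \<in> bounded_wt N"
  shows "psummable (\<lambda>(u, v, w, a). D u F * (D v G * (D w H * (\<beta> u a * D a (\<beta> v w))))) (U \<times> U \<times> U \<times> U)"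
    "psummable (\<lambda>((u, a), (v, w)). D u F * (D v G * (D w H * (\<beta> u a * D a (\<beta> v w))))) (UU \<times> UU)"
proof -
  show *: "psummable (\<lambda>(u, v, w, a). D u F * (D v G * (D w H * (\<beta> u a * D a (\<beta> v w))))) (U \<times> U \<times> U \<times> U)"
    using assms
    by (intro psummable_quad psummable_D_bounded_wt psummable_mult_left psummable_gen psummable_gen_left)
  from psummable_inj[OF *, of "\<lambda>((u, a), (v, w)). (u, v, w, a)" "UU \<times> UU"]
  show "psummable (\<lambda>((u, a), (v, w)). D u F * (D v G * (D w H * (\<beta> u a * D a (\<beta> v w))))) (UU \<times> UU)"
    by (simp add: split_def inj_on_def image_subset_iff)
qed

lemma PB_PB:
  assumes "F \<in> bounded_wt N" "G \<in> bounded_wt N" "H \<in> bounded_wt N"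
  shows "PB F (PB G H) = S1 F G H + S2 F G H + S3 F G H"
proof -
  let ?f = "\<lambda>(u, a) (v, w). D u F * (D a (D v G * (D w H * \<beta> v w)) * \<beta> u a)"
  have *: "(\<lambda>(p, r). ?f p r) p =
      (\<lambda>((u, a), (v, w)). D u F * (D w H * (\<beta> u a * (\<beta> v w * D a (D v G))))) p
    + (\<lambda>((u, a), (v, w)). D u F * (D v G * (\<beta> u a * (\<beta> v w * D a (D w H))))) p
    + (\<lambda>((u, a), (v, w)). D u F * (D v G * (D w H * (\<beta> u a * D a (\<beta> v w))))) p" for p
    by (simp add: split_def D_mult algebra_simps)
  note ** = ext[of "\<lambda>(p, r). ?f p r", OF *]
  note summable = psummable_S1[OF assms] psummable_S2[OF assms] psummable_S3(2)[OF assms]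
  have "PB F (PB G H) = psum (\<lambda>p. psum (?f p) UU) UU"
    unfolding PB_def[of F]
  proof (rule psum_cong[OF refl])
    fix p assume "p \<in> UU"
    obtain u a where p: "p = (u, a)" by (cases p)
    have "D a (PB G H) = psum (\<lambda>(v, w). D a (D v G * (D w H * \<beta> v w))) UU"
      unfolding PB_def using D_psum[OF psummable_PB[OF assms(2,3)], of a] by (simp add: split_def)
    moreover have "psummable (\<lambda>(v, w). D a (D v G * (D w H * \<beta> v w))) UU"
      using psummable_D[OF psummable_PB[OF assms(2,3)], of a] by (simp add: split_def)
    ultimately show "(case p of (u, a) \<Rightarrow> D u F * (D a (PB G H) * \<beta> u a)) = psum (?f p) UU"
      by (simp add: p psum_mult_left psum_mult_right psummable_mult_left split_def)
  qed
  also have "\<dots> = psum (\<lambda>(p, r). ?f p r) (UU \<times> UU)"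
    by (rule psum_Sigma) (unfold **, intro psummable_add summable)
  also have "\<dots> = S1 F G H + S2 F G H + S3 F G H"
    unfolding ** S1_def S2_def S3_def
    by (subst psum_add psum_add, (intro psummable_add summable)+)+ simp
  finally show ?thesis .
qed

text \<open>Renaming the indices turns one factor into \<open>\<beta> a u\<close>, which supplies
  the sign, and exchanges two partial derivatives, which commute.\<close>

lemma S1_eq_minus_S2: "S1 G H F = - S2 F G H"
proof -
  have "S1 G H F = psum (\<lambda>((u, a), (v, w)). - (D u F * (D v G * (\<beta> u a * (\<beta> v w * D a (D w H)))))) (UU \<times> UU)"
    unfolding S1_def
  proof (rule psum_reindex_witness[where
        h = "\<lambda>((u, a), (v, w)). ((v, w), (a, u))" and k = "\<lambda>((v, w), (a, u)). ((u, a), (v, w))"])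
    fix p assume "p \<in> UU \<times> UU"
    then obtain u a v w where p: "p = ((u, a), (v, w))" and "u \<in> U" "a \<in> U"
      by auto
    then show "(\<lambda>((u, a), (v, w)). D u G * (D w F * (\<beta> u a * (\<beta> v w * D a (D v H)))))
        ((\<lambda>((u, a), (v, w)). ((v, w), (a, u))) p) =
      (\<lambda>((u, a), (v, w)). - (D u F * (D v G * (\<beta> u a * (\<beta> v w * D a (D w H)))))) p"
      by (simp add: antisym[of a u] D_commute[of w a] mult_ac)
  qed auto
  then show ?thesis
    unfolding S2_def by (simp add: psum_minus[symmetric] split_def)
qed

section \<open>Hamiltonian derivations and reduction of the Jacobi identity to generators\<close>

lemma psummable_ham: "u \<in> U \<Longrightarrow> psummable (\<lambda>a. \<beta> u a * D a F) U"
  by (intro psummable_mult_left psummable_gen)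

lemma ham_cst_mult: "ham u (cst a * F) = cst a * ham u F"
  unfolding ham_def D_cst_mult psum_cst_mult[symmetric] by (simp add: mult_ac)

lemma ham_mult:
  assumes "u \<in> U"
  shows "ham u (F * G) = ham u F * G + F * ham u G"
proof -
  have "ham u (F * G) = psum (\<lambda>a. \<beta> u a * D a F * G + F * (\<beta> u a * D a G)) U"
    by (simp add: ham_def D_mult algebra_simps)
  then show ?thesis
    using assms by (simp add: ham_def psum_add psum_mult_left psum_mult_right psummable_ham
        psummable_mult_left psummable_mult_right)
qed

lemma ham_psum:
  assumes u: "u \<in> U" and f: "psummable f A"
  shows "ham u (psum f A) = psum (\<lambda>i. ham u (f i)) A"
proof -
  have *: "psummable (\<lambda>(a, i). \<beta> u a * D a (f i)) (U \<times> A)"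
    using u f by (intro psummable_mult_Sigma psummable_gen psummable_D)
  from psummable_inj[OF this, of "\<lambda>(i, a). (a, i)" "A \<times> U"]
  have **: "psummable (\<lambda>(i, a). \<beta> u a * D a (f i)) (A \<times> U)"
    by (simp add: split_def inj_on_def image_subset_iff)
  have "ham u (psum f A) = psum (\<lambda>a. psum (\<lambda>i. \<beta> u a * D a (f i)) A) U"
    unfolding ham_def using f by (simp add: D_psum psum_mult_right psummable_D)
  also have "\<dots> = psum (\<lambda>(a, i). \<beta> u a * D a (f i)) (U \<times> A)"
    by (rule psum_Sigma[OF *])
  also have "\<dots> = psum (\<lambda>(i, a). \<beta> u a * D a (f i)) (A \<times> U)"
    by (rule psum_reindex_witness[where h = "\<lambda>(i, a). (a, i)" and k = "\<lambda>(a, i). (i, a)"]) auto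
  also have "\<dots> = psum (\<lambda>i. ham u (f i)) A"
    unfolding ham_def by (rule psum_Sigma[OF **, symmetric])
  finally show ?thesis .
qed

definition T3 where "T3 F G H = (\<lambda>(u, v, w). D u F * (D v G * (D w H * ham u (\<beta> v w))))"

lemma S3_eq:
  assumes "F \<in> bounded_wt N" "G \<in> bounded_wt N" "H \<in> bounded_wt N"
  shows "S3 F G H = psum (T3 F G H) (U \<times> U \<times> U)"
proof -
  let ?f = "\<lambda>(u, v, w) a. D u F * (D v G * (D w H * (\<beta> u a * D a (\<beta> v w))))"
  have "S3 F G H = psum (\<lambda>(p, a). ?f p a) ((U \<times> U \<times> U) \<times> U)"
    unfolding S3_def
    by (rule psum_reindex_witness[where
          h = "\<lambda>((u, v, w), a). ((u, a), (v, w))" and k = "\<lambda>((u, a), (v, w)). ((u, v, w), a)"]) auto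
  also have "\<dots> = psum (\<lambda>p. psum (?f p) U) (U \<times> U \<times> U)"
  proof (rule psum_Sigma[symmetric])
    from psummable_inj[OF psummable_S3(1)[OF assms], of "\<lambda>((u, v, w), a). (u, v, w, a)" "(U \<times> U \<times> U) \<times> U"]
    show "psummable (\<lambda>(p, a). ?f p a) ((U \<times> U \<times> U) \<times> U)"
      by (simp add: split_def inj_on_def image_subset_iff)
  qed
  also have "\<dots> = psum (T3 F G H) (U \<times> U \<times> U)"
    by (rule psum_cong[OF refl])
       (auto simp: T3_def ham_def psum_mult_right psummable_ham psummable_mult_right)
  finally show ?thesis .
qed

lemma psummable_T3:
  assumes "F \<in> bounded_wt N" "G \<in> bounded_wt N" "H \<in> bounded_wt N"
  shows "psummable (T3 F G H) (U \<times> U \<times> U)"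
proof -
  have "psummable (\<lambda>(u, p). D u F * (case p of (v, w) \<Rightarrow> D v G * (D w H * ham u (\<beta> v w)))) (U \<times> U \<times> U)"
    using assms by (intro psummable_mult_Sigma psummable_mult_left psummable_D_bounded_wt)
  then show ?thesis
    by (simp add: T3_def split_def)
qed

lemma T3_rotate: "psum (T3 G H F) (U \<times> U \<times> U) = psum (\<lambda>(u, v, w). T3 G H F (v, w, u)) (U \<times> U \<times> U)"
  by (rule psum_reindex_witness[where h = "\<lambda>(u, v, w). (v, w, u)" and k = "\<lambda>(v, w, u). (u, v, w)"]) auto

lemma psummable_T3_rotate:
  "psummable (T3 G H F) (U \<times> U \<times> U) \<Longrightarrow> psummable (\<lambda>(u, v, w). T3 G H F (v, w, u)) (U \<times> U \<times> U)"
  using psummable_inj[of "T3 G H F" "U \<times> U \<times> U" "\<lambda>(u, v, w). (v, w, u)" "U \<times> U \<times> U"]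
  by (simp add: split_def inj_on_def image_subset_iff)

text \<open>Once the second derivatives have cancelled and the index triples are rotated to common
  names, the summand at u, v, w is the product of the three first derivatives with the Jacobi sum of
  the generators.\<close>

lemma PB_jacobi:
  assumes gens: "\<And>u v w. u \<in> U \<Longrightarrow> v \<in> U \<Longrightarrow> w \<in> U \<Longrightarrow>
      ham u (\<beta> v w) + ham v (\<beta> w u) + ham w (\<beta> u v) = 0"
    and F: "F \<in> bounded_wt N" and G: "G \<in> bounded_wt N" and H: "H \<in> bounded_wt N"
  shows "PB F (PB G H) + PB G (PB H F) + PB H (PB F G) = 0"
proof -
  have rot: "psum (T3 H F G) (U \<times> U \<times> U) = psum (\<lambda>(u, v, w). T3 H F G (w, u, v)) (U \<times> U \<times> U)"
    by (rule psum_reindex_witness[where h = "\<lambda>(u, v, w). (w, u, v)" and k = "\<lambda>(w, u, v). (u, v, w)"]) auto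
  have rot': "psummable (\<lambda>(u, v, w). T3 H F G (w, u, v)) (U \<times> U \<times> U)"
    using psummable_inj[OF psummable_T3[OF H F G], of "\<lambda>(u, v, w). (w, u, v)" "U \<times> U \<times> U"]
    by (simp add: split_def inj_on_def image_subset_iff)
  have "S3 F G H + S3 G H F + S3 H F G = 
     psum (\<lambda>p. T3 F G H p + (case p of (u, v, w) \<Rightarrow> T3 G H F (v, w, u))
        + (case p of (u, v, w) \<Rightarrow> T3 H F G (w, u, v))) (U \<times> U \<times> U)"
    by (simp only: S3_eq F G H T3_rotate[of G H F] rot psum_add psummable_add psummable_T3
        psummable_T3_rotate rot')
  also have "\<dots> = psum (\<lambda>p. 0) (U \<times> U \<times> U)"
  proof (rule psum_cong[OF refl])
    fix p assume "p \<in> U \<times> U \<times> U"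
    then obtain u v w where p: "p = (u, v, w)" "u \<in> U" "v \<in> U" "w \<in> U"
      by (cases p) auto
    then have "D u F * D v G * D w H * (ham u (\<beta> v w) + ham v (\<beta> w u) + ham w (\<beta> u v)) = 0"
      using gens by simp
    then show "T3 F G H p + (case p of (u, v, w) \<Rightarrow> T3 G H F (v, w, u))
        + (case p of (u, v, w) \<Rightarrow> T3 H F G (w, u, v)) = 0"
      by (simp add: p T3_def algebra_simps)
  qed
  finally have "S3 F G H + S3 G H F + S3 H F G = 0"
    by simp
  then show ?thesis
    using assms by (simp add: PB_PB S1_eq_minus_S2[of G H F] S1_eq_minus_S2[of H F G] S1_eq_minus_S2[of F G H]
        algebra_simps)
qed

end


section \<open>The quadratic bracket in Sklyanin form\<close>

lemma sgn_cyclic: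
  fixes u v w :: int
  assumes "u + v + w = 0"
  shows "sgn u * sgn v + sgn v * sgn w + sgn w * sgn u = (if u = 0 \<and> v = 0 then 0 else - 1)"
  using assms by (auto simp: sgn_if)

text \<open>The mixed products of a Latin and a Greek sign cancel in pairs, and each alphabet leaves
  its own cyclic sum. The two values -1 cancel, so only the exceptional points remain. Latin letters
  will be row differences and Greek letters column differences.\<close>

lemma sgn_identity:
  fixes u v w \<alpha> \<beta> \<gamma> :: int
  assumes "u + v + w = 0" "\<alpha> + \<beta> + \<gamma> = 0"
  shows "(sgn w - sgn \<gamma>) * (sgn v + sgn \<alpha>) + (sgn u - sgn \<alpha>) * (sgn w + sgn \<beta>)
       + (sgn v - sgn \<beta>) * (sgn u + sgn \<gamma>) =
     (if u = 0 \<and> v = 0 then 1 else 0) - (if \<alpha> = 0 \<and> \<beta> = 0 then 1 else 0)"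
proof -
  have "(sgn w - sgn \<gamma>) * (sgn v + sgn \<alpha>) + (sgn u - sgn \<alpha>) * (sgn w + sgn \<beta>)
       + (sgn v - sgn \<beta>) * (sgn u + sgn \<gamma>) =
    (sgn u * sgn v + sgn v * sgn w + sgn w * sgn u) - (sgn \<alpha> * sgn \<beta> + sgn \<beta> * sgn \<gamma> + sgn \<gamma> * sgn \<alpha>)"
    by (simp add: algebra_simps)
  then show ?thesis
    using sgn_cyclic[OF assms(1)] sgn_cyclic[OF assms(2)] by simp
qed

locale qdiff =
  fixes q :: complex and N :: nat and lam :: complex
  assumes q0: "q \<noteq> 0" and q_generic: "\<And>n :: nat. n > 0 \<Longrightarrow> q ^ n \<noteq> 1" and N0: "N > 0"
begin

definition E :: "int \<Rightarrow> complex" where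
  "E p = q powi p"

lemma E_0 [simp]: "E 0 = 1" by (simp add: E_def)
lemma E_add: "E (m + n) = E m * E n" using q0 by (simp add: E_def power_int_add)
lemma E_neq_0 [simp]: "E m \<noteq> 0" using q0 by (simp add: E_def)
lemma E_minus: "E (- m) = inverse (E m)" by (simp add: E_def power_int_minus)
lemma E_diff: "E (m - n) = E m / E n" using q0 by (simp add: E_def power_int_diff)

lemma E_neq_1: 
  assumes "m \<noteq> 0" 
  shows "E m \<noteq> 1"
proof (cases "m > 0")
  case True
  then have "E m = q ^ nat m"
    by (simp add: E_def power_int_def)
  then show ?thesis using q_generic[of "nat m"] True by simp
next
  case False
  with assms have "inverse (E m) = q ^ nat (- m)"
    by (simp add: E_def power_int_def power_inverse)
  then show ?thesis using q_generic[of "nat (- m)"] False assms by auto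
qed

text \<open>
  At \<open>p = 0\<close> division by zero replaces the pole by \<open>0\<close>. In \<open>\<Theta>\<close> this gives the limiting value, because
  there \<open>cot p\<close> is multiplied by two factors that vanish at \<open>p = 0\<close>.
\<close>

definition cot :: "int \<Rightarrow> complex" where
  "cot p = (1 + E (int N * p)) / (1 - E (int N * p)) / 2"

lemma cot_0 [simp]: "cot 0 = 0"
  by (simp add: cot_def)

lemma cot_minus: "cot (- p) = - cot p"
proof (cases "p = 0")
  case False
  then have "E (int N * p) \<noteq> 1" using N0 by (intro E_neq_1) simp
  then show ?thesis by (simp add: cot_def E_minus field_simps)
qed simp

text \<open>This is the kernel of the second bracket without the diagonal part of the Sklyanin term,
  see \<open>bracket2_kernel_eq\<close>. The factors 1 - E (i * p) and 1 - E (- (j * p)) are Fourier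
  images of row charge minus column charge of the two entries.\<close>

definition \<Theta> :: "int \<Rightarrow> int \<Rightarrow> int \<Rightarrow> complex" where
  "\<Theta> i j p = (1 - E (i * p)) * (1 - E (- (j * p))) * cot p + (E (- (j * p)) - E (i * p)) / 2"

lemma \<Theta>_antisym: "\<Theta> j i (- p) = - \<Theta> i j p"
  by (simp add: \<Theta>_def cot_minus field_simps)

lemma \<Theta>_zero_right: "\<Theta> i 0 p = (1 - E (i * p)) / 2"
  by (simp add: \<Theta>_def)

text \<open>At j = N the factor 1 - E (- (N * p)) cancels the denominator of \<open>cot\<close>.
  Only exponentials remain, that is, delta functions, which the Sklyanin part can
  compensate.\<close>

lemma \<Theta>_N_right: "\<Theta> i (int N) p = (E ((i - int N) * p) - 1) / 2"
proof (cases "p = 0")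
  case False
  then have "E (int N * p) \<noteq> 1" using N0 by (intro E_neq_1) simp
  then show ?thesis
    by (simp add: \<Theta>_def cot_def left_diff_distrib E_diff E_minus) (simp add: field_simps)
qed (simp add: \<Theta>_def)

text \<open>For entries (a, b) and (c, d) with i = a - b and j = c - d, the exchanged product has x
  = a - d. Hence x - j = a - c compares rows and x - i = b - d compares columns. The exponential is
  the Fourier coefficient of the delta function supported on z = w q^(x - j).\<close>

definition S :: "int \<Rightarrow> int \<Rightarrow> int \<Rightarrow> int \<Rightarrow> complex" where
  "S i j x p = of_int (sgn (x - j) + sgn (x - i)) * E ((x - j) * p) / 2"

definition C :: "int \<Rightarrow> int \<Rightarrow> int \<Rightarrow> int \<Rightarrow> complex" where
  "C i j x p = (if x = i then \<Theta> i j p else 0) + S i j x p"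

lemma S_antisym:
  assumes "x + y = i + j"
  shows "S j i y (- p) = - S i j x p"
proof -
  have "y - i = - (x - j)"
    using assms by auto
  then have E: "(y - i) * - p = (x - j) * p"
    by (simp only: minus_mult_minus)
  have sgn: "sgn (y - i) = - sgn (x - j)" "sgn (y - j) = - sgn (x - i)"
    using assms by (auto simp: sgn_if)
  show ?thesis
    unfolding S_def E sgn by (simp add: add_divide_distrib diff_divide_distrib algebra_simps)
qed

lemma C_antisym: "x + y = i + j \<Longrightarrow> C j i y (- p) = - C i j x p"
  using S_antisym[of x y i j p] by (auto simp: C_def \<Theta>_antisym)

text \<open>Charge conservation: for fixed k and c, \<open>\<Theta> k r c\<close> is affine in E (-
  (r * c)), with A from the row of r and B from its column. The exchange of i, j into x, y keeps the
  rows and swaps the columns, so x has the column of j and y that of i.\<close>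

lemma \<Theta>_S_cancel:
  assumes "x + y = i + j" "a + b + c = 0"
  shows "\<Theta> j k (- c) * S i j x a + \<Theta> k i c * S j i y b + S i j x (- b) * \<Theta> k x c + S i j x a * \<Theta> k y c = 0"
proof -
  define A where "A = (1 - E (k * c)) * cot c - E (k * c) / 2"
  define B where "B = 1 / 2 - (1 - E (k * c)) * cot c"
  have \<Theta>: "\<Theta> k r c = A + B * E (- (r * c))" for r
    by (simp add: \<Theta>_def A_def B_def field_simps)
  have 1: "\<Theta> j k (- c) = - \<Theta> k j c" and 2: "S j i y b = - S i j x (- b)"
    using \<Theta>_antisym[of j k c] S_antisym[OF assms(1), of "- b"] by auto
  have a: "a = - b + - c" and y: "y = i + j - x"
    using assms by auto
  have "(x - j) * a - y * c = (x - j) * (- b) - i * c" "(x - j) * a - j * c = (x - j) * (- b) - x * c"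
    by (auto simp: a y algebra_simps)
  then have *: "E ((x - j) * a) * E (- (y * c)) = E ((x - j) * (- b)) * E (- (i * c))"
    "E ((x - j) * a) * E (- (j * c)) = E ((x - j) * (- b)) * E (- (x * c))"
    by (simp_all flip: E_add)
  define s where "s = of_int (sgn (x - j) + sgn (x - i)) / (2 :: complex)"
  have S: "S i j x p = s * E ((x - j) * p)" for p
    by (simp add: S_def s_def)
  have "\<Theta> j k (- c) * S i j x a + \<Theta> k i c * S j i y b + S i j x (- b) * \<Theta> k x c + S i j x a * \<Theta> k y c
     = s * B * (E ((x - j) * a) * E (- (y * c)) - E ((x - j) * a) * E (- (j * c))
        + E ((x - j) * (- b)) * E (- (x * c)) - E ((x - j) * (- b)) * E (- (i * c)))"
    unfolding 1 2 \<Theta> S by (simp add: algebra_simps)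
  also have "\<dots> = 0"
    unfolding * by simp
  finally show ?thesis .
qed

text \<open>In all three terms x, y, z keep the rows of i, j, k and receive the columns of k, i, j.
  So the exponentials agree, and the signs form \<open>sgn_identity\<close> with row differences x -
  k, y - i, z - j and column differences i - x, j - y, k - z. Coinciding rows mean x = k, y = i;
  coinciding columns mean x = i, y = j.\<close>

lemma S_S_sum:
  assumes "x + y + z = i + j + k" "a + b + c = 0"
  shows "S j k (j + k - z) (- c) * S i (j + k - z) x a + S k i (k + i - x) (- a) * S j (k + i - x) y b
       + S i j (i + j - y) (- b) * S k (i + j - y) z c =
     ((if x = k \<and> y = i then 1 else 0) - (if x = i \<and> y = j then 1 else 0)) / 4
       * E ((i - y) * a - (j - z) * c)" (is "?lhs = _")
proof -
  define \<epsilon> where "\<epsilon> = E ((i - y) * a - (j - z) * c)"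
  have *: "x = i + j + k - y - z" "c = - a - b"
    using assms by auto
  have exps: "(j + k - z - k) * - c + (x - (j + k - z)) * a = (i - y) * a - (j - z) * c"
    "(k + i - x - i) * - a + (y - (k + i - x)) * b = (i - y) * a - (j - z) * c"
    "(i + j - y - j) * - b + (z - (i + j - y)) * c = (i - y) * a - (j - z) * c"
    unfolding * by (auto simp: algebra_simps)
  have signs: "sgn (j + k - z - k) = - sgn (z - j)" "sgn (j + k - z - j) = sgn (k - z)"
     "sgn (x - (j + k - z)) = - sgn (y - i)" "sgn (x - i) = - sgn (i - x)"
     "sgn (k + i - x - i) = - sgn (x - k)" "sgn (k + i - x - k) = sgn (i - x)"
     "sgn (y - (k + i - x)) = - sgn (z - j)" "sgn (y - j) = - sgn (j - y)"
     "sgn (i + j - y - j) = - sgn (y - i)" "sgn (i + j - y - i) = sgn (j - y)"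
     "sgn (z - (i + j - y)) = - sgn (x - k)" "sgn (z - k) = - sgn (k - z)"
    using assms(1) by (auto simp: sgn_if)
  have "?lhs = of_int ((sgn (z - j) - sgn (k - z)) * (sgn (y - i) + sgn (i - x))
      + (sgn (x - k) - sgn (i - x)) * (sgn (z - j) + sgn (j - y))
      + (sgn (y - i) - sgn (j - y)) * (sgn (x - k) + sgn (k - z))) / 4 * \<epsilon>"
  proof -
    have prod: "of_int s * E e / 2 * (of_int s' * E e' / 2) = of_int (s * s') / 4 * E (e + e')" for s s' e e'
      by (simp add: E_add)
    show ?thesis
      unfolding S_def prod exps \<epsilon>_def[symmetric] signs by (simp add: algebra_simps add_divide_distrib diff_divide_distrib)
  qed
  also have "\<dots> = ((if x = k \<and> y = i then 1 else 0) - (if x = i \<and> y = j then 1 else 0)) / 4 * \<epsilon>"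
    by (subst sgn_identity) (use assms(1) in auto)
  finally show ?thesis
    by (simp add: \<epsilon>_def)
qed

text \<open>The opposite cyclic exchange, with the columns of j, k, i in x, y, z. The sign identity
  now enters with a minus, so coinciding columns count positively and coinciding rows, now x = j, y
  = k, negatively.\<close>

lemma S_S_sum':
  assumes "x + y + z = i + j + k" "a + b + c = 0"
  shows "S j k y b * S i (j + k - y) x a + S k i z c * S j (k + i - z) y b + S i j x a * S k (i + j - x) z c =
     ((if x = i \<and> y = j then 1 else 0) - (if x = j \<and> y = k then 1 else 0)) / 4
       * E ((x - j) * a + (k - y) * c)" (is "?lhs = _")
proof -
  define \<epsilon> where "\<epsilon> = E ((x - j) * a + (k - y) * c)"
  have *: "z = i + j + k - x - y" "b = - a - c"
    using assms by auto
  have exps: "(y - k) * b + (x - (j + k - y)) * a = (x - j) * a + (k - y) * c"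
    "(z - i) * c + (y - (k + i - z)) * b = (x - j) * a + (k - y) * c"
    "(x - j) * a + (z - (i + j - x)) * c = (x - j) * a + (k - y) * c"
    unfolding * by (auto simp: algebra_simps)
  have signs: "sgn (x - (j + k - y)) = - sgn (z - i)" "sgn (y - (k + i - z)) = - sgn (x - j)"
    "sgn (z - (i + j - x)) = - sgn (y - k)"
    using assms(1) by (auto simp: sgn_if)
  have "?lhs = of_int (- ((sgn (z - i) - sgn (x - i)) * (sgn (y - k) + sgn (y - j))
      + (sgn (x - j) - sgn (y - j)) * (sgn (z - i) + sgn (z - k))
      + (sgn (y - k) - sgn (z - k)) * (sgn (x - j) + sgn (x - i)))) / 4 * \<epsilon>"
  proof -
    have prod: "of_int s * E e / 2 * (of_int s' * E e' / 2) = of_int (s * s') / 4 * E (e + e')" for s s' e e'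
      by (simp add: E_add)
    show ?thesis
      unfolding S_def prod exps \<epsilon>_def[symmetric] signs by (simp add: algebra_simps add_divide_distrib diff_divide_distrib)
  qed
  also have "\<dots> = ((if x = i \<and> y = j then 1 else 0) - (if x = j \<and> y = k then 1 else 0)) / 4 * \<epsilon>"
    by (subst sgn_identity) (use assms(1) in auto)
  finally show ?thesis
    by (simp add: \<epsilon>_def)
qed

text \<open>Expand by the number of factors \<Theta>. Products of two cancel by antisymmetry. Those
  of one cancel by charge conservation, once for each factor that can stay unchanged. Those of none
  are the two cyclic exchanges, whose contributions from coinciding columns are opposite, while
  coinciding rows leave one term each.\<close>

lemma C_C_sum:
  assumes xyz: "x + y + z = i + j + k" and abc: "a + b + c = 0"
  shows "C j k (j + k - z) (- c) * C i (j + k - z) x a + C j k y b * C i (j + k - y) x a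
       + C k i (k + i - x) (- a) * C j (k + i - x) y b + C k i z c * C j (k + i - z) y b
       + C i j (i + j - y) (- b) * C k (i + j - y) z c + C i j x a * C k (i + j - x) z c =
     ((if x = k \<and> y = i then 1 else 0) - (if x = j \<and> y = k then 1 else 0)) / 4" (is "?Q = _")
proof -
  \<comment> \<open>Indicators that a factor keeps its index. As numbers they turn \<open>?Q\<close>
    into a polynomial whose terms can be sorted.\<close>
  define X Y Z :: complex where "X = (if x = i then 1 else 0)" and "Y = (if y = j then 1 else 0)"
    and "Z = (if z = k then 1 else 0)"
  have C_eqs:
    "C j k (j + k - z) (- c) = Z * \<Theta> j k (- c) + S j k (j + k - z) (- c)"
    "C i (j + k - z) x a = X * \<Theta> i y a + S i (j + k - z) x a"
    "C j k y b = Y * \<Theta> j k b + S j k y b"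
    "C i (j + k - y) x a = X * \<Theta> i z a + S i (j + k - y) x a"
    "C k i (k + i - x) (- a) = X * \<Theta> k i (- a) + S k i (k + i - x) (- a)"
    "C j (k + i - x) y b = Y * \<Theta> j z b + S j (k + i - x) y b"
    "C k i z c = Z * \<Theta> k i c + S k i z c"
    "C j (k + i - z) y b = Y * \<Theta> j x b + S j (k + i - z) y b"
    "C i j (i + j - y) (- b) = Y * \<Theta> i j (- b) + S i j (i + j - y) (- b)"
    "C k (i + j - y) z c = Z * \<Theta> k x c + S k (i + j - y) z c"
    "C i j x a = X * \<Theta> i j a + S i j x a"
    "C k (i + j - x) z c = Z * \<Theta> k y c + S k (i + j - x) z c"
    using xyz by (auto simp: C_def X_def Y_def Z_def intro!: arg_cong[of _ _ "\<lambda>r. \<Theta> _ r _"])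
  \<comment> \<open>Behind an indicator the intermediate index simplifies: under Z, for instance, z
    = k turns j + k - z into j.\<close>
  have S_eqs:
    "Z * S i (j + k - z) x a = Z * S i j x a" "X * S j k (j + k - z) (- c) = X * S j k y (- c)"
    "Y * S i (j + k - y) x a = Y * S i k x a"
    "X * S j (k + i - x) y b = X * S j k y b" "Y * S k i (k + i - x) (- a) = Y * S k i z (- a)"
    "Z * S j (k + i - z) y b = Z * S j i y b"
    "Y * S k (i + j - y) z c = Y * S k i z c" "Z * S i j (i + j - y) (- b) = Z * S i j x (- b)"
    "X * S k (i + j - x) z c = X * S k j z c"
    using xyz by (auto simp: X_def Y_def Z_def intro!: arg_cong[of _ _ "\<lambda>r. S _ _ r _"])
  have mixZ: "Z * (\<Theta> j k (- c) * S i j x a + \<Theta> k i c * S j i y b + S i j x (- b) * \<Theta> k x c + S i j x a * \<Theta> k y c) = 0"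
    using \<Theta>_S_cancel[of x y i j a b c k] xyz abc by (auto simp: Z_def)
  have mixX: "X * (\<Theta> k i (- a) * S j k y b + \<Theta> i j a * S k j z c + S j k y (- c) * \<Theta> i y a + S j k y b * \<Theta> i z a) = 0"
    using \<Theta>_S_cancel[of y z j k b c a i] xyz abc by (auto simp: X_def)
  have mixY: "Y * (\<Theta> i j (- b) * S k i z c + \<Theta> j k b * S i k x a + S k i z (- a) * \<Theta> j z b + S k i z c * \<Theta> j x b) = 0"
    using \<Theta>_S_cancel[of z x k i c a b j] xyz abc by (auto simp: Y_def)
  have \<Theta>\<Theta>: "Z * X * (\<Theta> j k (- c) * \<Theta> i y a) + Y * X * (\<Theta> j k b * \<Theta> i z a) + X * Y * (\<Theta> k i (- a) * \<Theta> j z b)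
     + Z * Y * (\<Theta> k i c * \<Theta> j x b) + Y * Z * (\<Theta> i j (- b) * \<Theta> k x c) + X * Z * (\<Theta> i j a * \<Theta> k y c) = 0"
    using xyz \<Theta>_antisym[of j k c] \<Theta>_antisym[of k i a] \<Theta>_antisym[of i j b]
    by (auto simp: X_def Y_def Z_def algebra_simps)
  have "?Q = (S j k (j + k - z) (- c) * S i (j + k - z) x a + S k i (k + i - x) (- a) * S j (k + i - x) y b
       + S i j (i + j - y) (- b) * S k (i + j - y) z c)
     + (S j k y b * S i (j + k - y) x a + S k i z c * S j (k + i - z) y b + S i j x a * S k (i + j - x) z c)"
    (is "_ = ?R")
  proof -
    have prod: "(s * t + A) * (r * v + B) = s * r * (t * v) + t * (s * B) + v * (r * A) + A * B"
      for s t A r v B :: complex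
      by (simp add: algebra_simps)
    have "?Q - ?R =
        Z * (\<Theta> j k (- c) * S i j x a + \<Theta> k i c * S j i y b + S i j x (- b) * \<Theta> k x c + S i j x a * \<Theta> k y c)
      + X * (\<Theta> k i (- a) * S j k y b + \<Theta> i j a * S k j z c + S j k y (- c) * \<Theta> i y a + S j k y b * \<Theta> i z a)
      + Y * (\<Theta> i j (- b) * S k i z c + \<Theta> j k b * S i k x a + S k i z (- a) * \<Theta> j z b + S k i z c * \<Theta> j x b)
      + (Z * X * (\<Theta> j k (- c) * \<Theta> i y a) + Y * X * (\<Theta> j k b * \<Theta> i z a) + X * Y * (\<Theta> k i (- a) * \<Theta> j z b)
        + Z * Y * (\<Theta> k i c * \<Theta> j x b) + Y * Z * (\<Theta> i j (- b) * \<Theta> k x c) + X * Z * (\<Theta> i j a * \<Theta> k y c))"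
      unfolding C_eqs prod S_eqs by (simp only: ring_distribs mult_ac add_ac diff_conv_add_uminus minus_add_distrib)
         (simp add: algebra_simps)
    then show ?thesis
      unfolding mixX mixY mixZ \<Theta>\<Theta> by simp
  qed
  also have "\<dots> = ((if x = k \<and> y = i then 1 else 0) - (if x = j \<and> y = k then 1 else 0)) / 4"
  proof -
    \<comment> \<open>At x = i, y = j the third index is z = k, both exponentials agree and the two
      quarter terms cancel. At the other two exceptional points the exponent is 0.\<close>
    have "E ((i - y) * a - (j - z) * c) = E ((x - j) * a + (k - y) * c)" if "x = i" "y = j"
      using that xyz by (simp add: algebra_simps)
    moreover have "E ((i - y) * a - (j - z) * c) = 1" if "x = k" "y = i"
      using that xyz by simp
    moreover have "E ((x - j) * a + (k - y) * c) = 1" if "x = j" "y = k"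
      using that xyz by simp
    ultimately show ?thesis
      unfolding S_S_sum[OF assms] S_S_sum'[OF assms]
      by (auto simp: diff_divide_distrib)
  qed
  finally show ?thesis .
qed


section \<open>The rescaled quadratic bracket on generators\<close>

definition t :: "nat \<Rightarrow> int \<Rightarrow> pseries" where
  "t i m = Pseries (tcoeff i m)"

lemma t_0: "t 0 m = (if m = 0 then 1 else 0)"
  by (simp add: t_def tcoeff_def pseries_defs)

lemma t_pos: "i > 0 \<Longrightarrow> t i m = V (i, m)"
  by (simp add: t_def tcoeff_def V_def)

text \<open>Extension by 0 beyond the indices 0..N lets the exchange index x run over all integers;
  the bounds on r in the second bracket then arise by themselves.\<close>

definition T :: "int \<Rightarrow> int \<Rightarrow> pseries" where
  "T x m = (if x < 0 \<or> x > int N then 0 else cst (if x = int N then lam else 1) * t (nat x) m)"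

lemma coeff_T_nonzero:
  assumes "coeff (T x m) X \<noteq> 0"
  shows "0 \<le> x" "x \<le> int N" "wt X = m" "set_mset X \<subseteq> vars N" "m \<in> insert 0 (snd ` set_mset X)"
  using assms by (auto simp: T_def t_0 t_pos coeff_one coeff_V vars_def split: if_splits)
    (cases "nat x = 0"; auto simp: t_0 t_pos coeff_one coeff_V split: if_splits)+

lemma psummable_T: "psummable (\<lambda>(x, p). T x p) UNIV"
  unfolding psummable_def
proof
  fix X
  have "{r \<in> UNIV. coeff ((\<lambda>(x, p). T x p) r) X \<noteq> 0} \<subseteq> {0..int N} \<times> insert 0 (snd ` set_mset X)"
    by (auto dest: coeff_T_nonzero)
  then show "finite {r \<in> UNIV. coeff ((\<lambda>(x, p). T x p) r) X \<noteq> 0}"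
    by (rule finite_subset) simp
qed

lemma psummable_T_mult: "psummable (\<lambda>(x, p). g x p * (T x (m - p) * h x p)) UNIV"
proof -
  have "psummable (\<lambda>r. (\<lambda>(x, p). T x p) ((\<lambda>(x, p). (x, m - p)) r)) UNIV"
    by (rule psummable_inj[OF psummable_T]) (auto simp: inj_on_def)
  from psummable_mult_left[OF this, of "\<lambda>(x, p). g x p * h x p"]
  show ?thesis by (simp add: split_def mult_ac)
qed

text \<open>
  The bracket of \<open>t\<^sub>i[m]\<close> and \<open>t\<^sub>j[n]\<close>. The term with index \<open>x\<close> has support \<open>z = w q\<^bsup>x - j\<^esup>\<close>; the factor
  \<open>lam\<close> in \<^const>\<open>T\<close> is the rescaling of \<open>t\<^sub>N\<close>.
\<close>

definition rbracket :: "int \<Rightarrow> int \<Rightarrow> int \<Rightarrow> int \<Rightarrow> pseries" where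
  "rbracket i m j n = psum (\<lambda>(x, p). cst (C i j x p) * (T x (m - p) * T (i + j - x) (n + p))) UNIV"

lemma rbracket_antisym: "rbracket j n i m = - rbracket i m j n"
proof -
  have "rbracket j n i m = psum (\<lambda>(x, p). - (cst (C i j x p) * (T x (m - p) * T (i + j - x) (n + p)))) UNIV"
    unfolding rbracket_def
  proof (rule psum_reindex_witness[where h = "\<lambda>(x, p). (i + j - x, - p)" and k = "\<lambda>(x, p). (i + j - x, - p)"])
    fix r :: "int \<times> int"
    obtain x p where r: "r = (x, p)" by (cases r)
    have "C j i (i + j - x) (- p) = - C i j x p" by (rule C_antisym) simp
    then show "(\<lambda>(x, p). cst (C j i x p) * (T x (n - p) * T (j + i - x) (m + p))) ((\<lambda>(x, p). (i + j - x, - p)) r)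
        = (\<lambda>(x, p). - (cst (C i j x p) * (T x (m - p) * T (i + j - x) (n + p)))) r"
      by (simp add: r cst_minus mult_ac)
  qed auto
  then show ?thesis
    by (simp add: rbracket_def psum_minus[symmetric] split_def)
qed

lemma double_eq_0: "F + F = (0 :: pseries) \<Longrightarrow> F = 0"
proof (rule pseries_eqI)
  fix X
  assume "F + F = 0"
  from arg_cong[OF this, of "\<lambda>F. coeff F X"] show "coeff F X = coeff 0 X"
    by (simp only: coeff_add coeff_zero) simp
qed

text \<open>The substitution of (i + j - x, m - n - p) for (x, p) only swaps the two commuting
  factors, so the sum depends on the symmetrised coefficient alone. Twice the bracket is then
  0.\<close>

lemma rbracket_eq_0I:
  assumes "\<And>x p. 0 \<le> x \<Longrightarrow> x \<le> int N \<Longrightarrow> 0 \<le> i + j - x \<Longrightarrow> i + j - x \<le> int N \<Longrightarrow>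
      C i j x p + C i j (i + j - x) (m - n - p) = 0"
  shows "rbracket i m j n = 0"
proof -
  let ?f = "\<lambda>(x, p). cst (C i j x p) * (T x (m - p) * T (i + j - x) (n + p))"
  let ?g = "\<lambda>(x, p). cst (C i j (i + j - x) (m - n - p)) * (T x (m - p) * T (i + j - x) (n + p))"
  have "rbracket i m j n = psum ?g UNIV"
    unfolding rbracket_def
    by (rule psum_reindex_witness[where h = "\<lambda>(x, p). (i + j - x, m - n - p)" and k = "\<lambda>(x, p). (i + j - x, m - n - p)"])
      (auto simp: mult_ac)
  then have "rbracket i m j n + rbracket i m j n = psum (\<lambda>r. ?f r + ?g r) UNIV"
    by (simp only: psum_add[OF psummable_T_mult psummable_T_mult]) (simp only: rbracket_def)
  also have "\<dots> = psum (\<lambda>r. 0) (UNIV :: (int \<times> int) set)"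
  proof (rule psum_cong[OF refl])
    fix r :: "int \<times> int"
    obtain x p where r: "r = (x, p)" by (cases r)
    show "?f r + ?g r = 0"
    proof (cases "0 \<le> x \<and> x \<le> int N \<and> 0 \<le> i + j - x \<and> i + j - x \<le> int N")
      case True
      then have "cst (C i j x p) + cst (C i j (i + j - x) (m - n - p)) = 0"
        using assms[of x p] by (simp flip: cst_add)
      then show ?thesis
        by (simp add: r flip: distrib_right)
    next
      case False
      then have "T x (m - p) * T (i + j - x) (n + p) = 0"
        by (auto simp: T_def)
      then show ?thesis by (simp add: r)
    qed
  qed
  finally have "rbracket i m j n + rbracket i m j n = 0"
    by (simp only: psum_0)
  then show ?thesis
    by (rule double_eq_0)
qed

text \<open>\<open>t\<^sub>N\<close> is a Casimir element, and the formula is consistent with \<open>t\<^sub>0 = 1\<close> and with the truncation.\<close>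

lemma rbracket_eq_0:
  assumes i: "0 < i" "i \<le> int N" and j: "j \<le> 0 \<or> j \<ge> int N"
  shows "rbracket i m j n = 0"
proof (rule rbracket_eq_0I)
  fix x p assume x: "0 \<le> x" "x \<le> int N" "0 \<le> i + j - x" "i + j - x \<le> int N"
  consider "j < 0 \<or> j > int N" | "j = 0" | "j = int N" "i < int N" | "j = int N" "i = int N"
    using i j by linarith
  then show "C i j x p + C i j (i + j - x) (m - n - p) = 0"
  proof cases
    case 1
    then have "C i j y p = 0" if "0 \<le> y" "y \<le> int N" "0 \<le> i + j - y" "i + j - y \<le> int N" for y p
      using i that by (auto simp: C_def S_def sgn_if)
    then show ?thesis using x by simp
  next
    case 2
    \<comment> \<open>With j = 0 the points y = i and y = 0 are exchanged by the symmetrisation, and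
      1 / 2 meets - 1 / 2.\<close>
    then have "C i j y p = (if y = i then 1 / 2 else if y = 0 then - 1 / 2 else 0)"
      if "0 \<le> y" "y \<le> int N" "0 \<le> i + j - y" "i + j - y \<le> int N" for y p
      using i that by (auto simp: C_def S_def sgn_if \<Theta>_zero_right field_simps)
    then show ?thesis using x i 2 by auto
  next
    case 3
    \<comment> \<open>With j = N the symmetrisation exchanges y = i and y = N. The exponential in
      \<Theta> has cancelled against the Sklyanin coefficient at y = i.\<close>
    then have "C i j y p = (if y = i then - 1 / 2 else if y = int N then 1 / 2 else 0)"
      if "0 \<le> y" "y \<le> int N" "0 \<le> i + j - y" "i + j - y \<le> int N" for y p
      using i that by (auto simp: C_def S_def sgn_if \<Theta>_N_right field_simps)
    then show ?thesis using x i 3 by auto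
  next
    case 4
    then have "C i j y p = 0" if "0 \<le> y" "y \<le> int N" "0 \<le> i + j - y" "i + j - y \<le> int N" for y p
      using i that by (auto simp: C_def S_def sgn_if \<Theta>_N_right)
    then show ?thesis using x by simp
  qed
qed

definition gen :: "tvar \<Rightarrow> tvar \<Rightarrow> pseries" where
  "gen u v = rbracket (int (fst u)) (snd u) (int (fst v)) (snd v)"

lemma coeff_rbracket_nonzero:
  assumes "coeff (rbracket i m j n) X \<noteq> 0"
  shows "wt X = m + n \<and> set_mset X \<subseteq> vars N"
proof -
  obtain r where "coeff ((\<lambda>(x, p). cst (C i j x p) * (T x (m - p) * T (i + j - x) (n + p))) r) X \<noteq> 0"
    using assms unfolding rbracket_def coeff_psum by (metis (mono_tags, lifting) mem_Collect_eq sum.neutral)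
  then obtain x p where "coeff (T x (m - p) * T (i + j - x) (n + p)) X \<noteq> 0"
    by (cases r) auto
  then obtain A B where "A + B = X" "coeff (T x (m - p)) A \<noteq> 0" "coeff (T (i + j - x) (n + p)) B \<noteq> 0"
    by (rule coeff_mult_nonzeroE)
  with coeff_T_nonzero(3,4)[of x "m - p" A] coeff_T_nonzero(3,4)[of "i + j - x" "n + p" B] show ?thesis
    by auto
qed

sublocale graded_bracket N gen
proof
  show "gen u v = - gen v u" for u v
    unfolding gen_def by (rule rbracket_antisym)
  show "wt X = snd u + snd v \<and> set_mset X \<subseteq> vars N" if "coeff (gen u v) X \<noteq> 0" for u v X
    using that unfolding gen_def by (rule coeff_rbracket_nonzero)
qed

lemma D_T: "D u (T x n) =
  (if 1 \<le> x \<and> x \<le> int N \<and> u = (nat x, n) then cst (if x = int N then lam else 1) else 0)"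
proof -
  consider "x < 0 \<or> x > int N" | "x = 0" | "1 \<le> x" "x \<le> int N" by linarith
  then show ?thesis
  proof cases
    case 2
    then show ?thesis using N0 by (auto simp: T_def t_0)
  next
    case 3
    then show ?thesis by (auto simp: T_def t_pos D_cst_mult D_V)
  qed (auto simp: T_def)
qed

text \<open>For 1 \<le> x < N this is the value on a variable. At x = N the derivative contributes
  \<open>lam\<close>, and for other x it is 0; both agree with the right side because the bracket
  formula vanishes there. This is where the Casimir property makes the rescaling harmless.\<close>

lemma ham_T:
  assumes "u \<in> vars N"
  shows "ham u (T x n) = rbracket (int (fst u)) (snd u) x n"
proof -
  have u: "0 < int (fst u)" "int (fst u) \<le> int N"
    using assms by (auto simp: vars_def)
  show ?thesis
  proof (cases "1 \<le> x \<and> x \<le> int N")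
    case True
    then have "ham u (T x n) = gen u (nat x, n) * D (nat x, n) (T x n)"
      unfolding ham_def
      by (subst psum_mono_neutral[of "{(nat x, n)}"]) (auto simp: D_T vars_def psum_finite)
    then show ?thesis
      using True rbracket_eq_0[OF u, of x "snd u" n] by (auto simp: D_T gen_def)
  next
    case False
    then have "ham u (T x n) = 0"
      unfolding ham_def by (auto simp: D_T)
    then show ?thesis
      using False rbracket_eq_0[OF u, of x "snd u" n] by auto
  qed
qed

end


section \<open>The Jacobi identity on generators\<close>

context qdiff
begin

definition cubic :: "int \<Rightarrow> int \<Rightarrow> int \<Rightarrow> int \<Rightarrow> int \<Rightarrow> int \<Rightarrow> int \<Rightarrow> int \<Rightarrow> pseries" where
  "cubic m n l s x a y b = T x (m - a) * (T y (n - b) * T (s - x - y) (l + a + b))"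

lemma psummable_cubic: "psummable (\<lambda>(x, a, y, b). cst (g x a y b) * cubic m n l s x a y b) UNIV"
proof -
  have "psummable (\<lambda>(p, r). (\<lambda>(x, a). 1 * (T x (m - a) * 1)) p * 
      (\<lambda>(y, b). (cst (g (fst p) (snd p) y b)) * (T y (n - b) * T (s - fst p - y) (l + snd p + b))) r) 
      ((UNIV :: (int \<times> int) set) \<times> (UNIV :: (int \<times> int) set))"
    by (intro psummable_mult_Sigma psummable_T_mult)
  from psummable_inj[OF this, of "\<lambda>(x, a, y, b). ((x, a), (y, b))" UNIV]
  show ?thesis
    by (simp add: cubic_def split_def inj_on_def mult_ac)
qed

text \<open>The derivation acts on either factor of the quadratic series. Acting on the first one,
  it replaces index y and shift p by the pairs x, a and i + y - x, p - a; solving for the old values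
  gives x + y - i and a + b. Acting on the second one, it leaves y and its shift in place.\<close>

lemma ham_rbracket:
  assumes u: "u \<in> vars N" and i: "i = int (fst u)" and m: "m = snd u"
  shows "ham u (rbracket j n k l) = psum (\<lambda>(x, a, y, b).
      cst (C j k (x + y - i) (a + b) * C i (x + y - i) x a + C j k y b * C i (j + k - y) x a)
        * cubic m n l (i + j + k) x a y b) UNIV"
proof -
  let ?s = "i + j + k"
  let ?G1 = "\<lambda>(x, a, y, b). cst (C j k (x + y - i) (a + b) * C i (x + y - i) x a) * cubic m n l ?s x a y b"
  let ?G2 = "\<lambda>(x, a, y, b). cst (C j k y b * C i (j + k - y) x a) * cubic m n l ?s x a y b"
  let ?P1 = "\<lambda>(y, p) (x, a). cst (C j k y p) * (cst (C i y x a) * 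
      (T x (m - a) * T (i + y - x) (n - p + a)) * T (j + k - y) (l + p))"
  let ?P2 = "\<lambda>(y, p) (x, a). cst (C j k y p) * (T y (n - p) * (cst (C i (j + k - y) x a) * 
      (T x (m - a) * T (i + (j + k - y) - x) (l + p + a))))"
  let ?h1 = "\<lambda>((y, p), (x, a)). (x, a, i + y - x, p - a)"
  let ?k1 = "\<lambda>(x, a, y, b). ((x + y - i, a + b), (x, a))"
  let ?h2 = "\<lambda>((y, p), (x, a)). (x, a, y, p)"
  let ?k2 = "\<lambda>(x, a, y, b). ((y, b), (x, a))"
  have h1: "?G1 (?h1 r) = (\<lambda>(p, r). ?P1 p r) r" for r
    by (auto simp: cubic_def cst_mult algebra_simps split: prod.splits)
  have h2: "?G2 (?h2 r) = (\<lambda>(p, r). ?P2 p r) r" for r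
    by (auto simp: cubic_def cst_mult algebra_simps split: prod.splits)
  have "psummable (\<lambda>r. ?G1 (?h1 r)) UNIV"
    by (rule psummable_inj[OF psummable_cubic]) (auto simp: inj_on_def)
  then have s1: "psummable (\<lambda>(p, r). ?P1 p r) (UNIV \<times> UNIV)"
    unfolding h1 by simp
  have "psummable (\<lambda>r. ?G2 (?h2 r)) UNIV"
    by (rule psummable_inj[OF psummable_cubic]) (auto simp: inj_on_def)
  then have s2: "psummable (\<lambda>(p, r). ?P2 p r) (UNIV \<times> UNIV)"
    unfolding h2 by simp
  have "ham u (rbracket j n k l) = psum (\<lambda>p. ham u ((\<lambda>(y, p). cst (C j k y p) * (T y (n - p) * T (j + k - y) (l + p))) p)) UNIV"
    unfolding rbracket_def by (rule ham_psum[OF u psummable_T_mult])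
  also have "\<dots> = psum (\<lambda>p. psum (?P1 p) UNIV + psum (?P2 p) UNIV) UNIV"
  proof (rule psum_cong[OF refl])
    fix r :: "int \<times> int"
    obtain y p where r: "r = (y, p)" by (cases r)
    have "rbracket i m y (n - p) * T (j + k - y) (l + p) = 
      psum (\<lambda>(x, a). cst (C i y x a) * (T x (m - a) * T (i + y - x) (n - p + a)) * T (j + k - y) (l + p)) UNIV"
      unfolding rbracket_def psum_mult_left[OF psummable_T_mult] by (simp add: split_def)
    moreover have "T y (n - p) * rbracket i m (j + k - y) (l + p) = 
      psum (\<lambda>(x, a). T y (n - p) * (cst (C i (j + k - y) x a) * (T x (m - a) * T (i + (j + k - y) - x) (l + p + a)))) UNIV"
      unfolding rbracket_def psum_mult_right[OF psummable_T_mult] by (simp add: split_def)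
    ultimately show "ham u ((\<lambda>(y, p). cst (C j k y p) * (T y (n - p) * T (j + k - y) (l + p))) r)
        = psum (?P1 r) UNIV + psum (?P2 r) UNIV"
      by (simp add: r ham_cst_mult ham_mult[OF u] ham_T[OF u] i[symmetric] m[symmetric] distrib_left
          psum_cst_mult[symmetric] split_def)
  qed
  also have "\<dots> = psum (\<lambda>(p, r). ?P1 p r) (UNIV \<times> UNIV) + psum (\<lambda>(p, r). ?P2 p r) (UNIV \<times> UNIV)"
    by (simp only: psum_add[OF psummable_psum[OF s1] psummable_psum[OF s2]] psum_Sigma[OF s1] psum_Sigma[OF s2])
  also have "psum (\<lambda>(p, r). ?P1 p r) (UNIV \<times> UNIV) = psum ?G1 UNIV"
    unfolding h1[symmetric]
    by (rule psum_reindex_witness[where h = ?k1 and k = ?h1]) (auto simp: algebra_simps)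
  also have "psum (\<lambda>(p, r). ?P2 p r) (UNIV \<times> UNIV) = psum ?G2 UNIV"
    unfolding h2[symmetric]
    by (rule psum_reindex_witness[where h = ?k2 and k = ?h2]) (auto simp: algebra_simps)
  also have "psum ?G1 UNIV + psum ?G2 UNIV = psum (\<lambda>r. ?G1 r + ?G2 r) UNIV"
    by (rule psum_add[OF psummable_cubic psummable_cubic, symmetric])
  finally show ?thesis
    by (simp add: split_def cst_add distrib_right)
qed

text \<open>The three shifts a, b, - a - b and the three indices x, y, s - x - y have fixed sums, so
  rotating the factors is a change of variables. It brings the three double brackets to common
  monomials.\<close>

lemma cubic_rotate:
  "psum (\<lambda>(x, a, y, b). cst (g x a y b) * cubic n l m s x a y b) UNIV =
   psum (\<lambda>(x, a, y, b). cst (g y b (s - x - y) (- a - b)) * cubic m n l s x a y b) UNIV"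
proof -
  have eq: "l - (- a - b) = l + a + b" for a b
    by simp
  show ?thesis
    by (rule psum_reindex_witness[where h = "\<lambda>(x, a, y, b). (y, b, s - x - y, - a - b)"
          and k = "\<lambda>(y, b, z, c). (s - y - z, - b - c, y, b)"])
       (auto simp: cubic_def eq mult_ac)
qed

lemma jacobi_gen:
  assumes "u \<in> vars N" "v \<in> vars N" "w \<in> vars N"
  shows "ham u (gen v w) + ham v (gen w u) + ham w (gen u v) = 0"
proof -
  define i j k where ijk: "i = int (fst u)" "j = int (fst v)" "k = int (fst w)"
  define m n l where mnl: "m = snd u" "n = snd v" "l = snd w"
  define s where "s = i + j + k"
  let ?M = "cubic m n l s"
  define c1 where "c1 x a y b = C j k (x + y - i) (a + b) * C i (x + y - i) x a + C j k y b * C i (j + k - y) x a" for x a y b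
  define c2 where "c2 x a y b = C k i (x + y - j) (a + b) * C j (x + y - j) x a + C k i y b * C j (k + i - y) x a" for x a y b
  define c3 where "c3 x a y b = C i j (x + y - k) (a + b) * C k (x + y - k) x a + C i j y b * C k (i + j - y) x a" for x a y b
  have gens: "gen v w = rbracket j n k l" "gen w u = rbracket k l i m" "gen u v = rbracket i m j n"
    by (simp_all add: gen_def ijk mnl)
  have ham1: "ham u (gen v w) = psum (\<lambda>(x, a, y, b). cst (c1 x a y b) * ?M x a y b) UNIV"
    unfolding gens using ham_rbracket[OF assms(1) ijk(1) mnl(1), of j n k l]
    by (simp add: c1_def s_def)
  have ham2: "ham v (gen w u) = psum (\<lambda>(x, a, y, b). cst (c2 y b (s - x - y) (- a - b)) * ?M x a y b) UNIV"
  proof -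
    have "ham v (gen w u) = psum (\<lambda>(x, a, y, b). cst (c2 x a y b) * cubic n l m s x a y b) UNIV"
      unfolding gens using ham_rbracket[OF assms(2) ijk(2) mnl(2), of k l i m]
      by (simp add: c2_def s_def add_ac)
    also have "\<dots> = psum (\<lambda>(x, a, y, b). cst (c2 y b (s - x - y) (- a - b)) * ?M x a y b) UNIV"
      by (rule cubic_rotate)
    finally show ?thesis .
  qed
  have ham3: "ham w (gen u v) = psum (\<lambda>(x, a, y, b). cst (c3 (s - x - y) (- a - b) x a) * ?M x a y b) UNIV"
  proof -
    have "ham w (gen u v) = psum (\<lambda>(x, a, y, b). cst (c3 x a y b) * cubic l m n s x a y b) UNIV"
      unfolding gens using ham_rbracket[OF assms(3) ijk(3) mnl(3), of i m j n]
      by (simp add: c3_def s_def add_ac)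
    also have "\<dots> = psum (\<lambda>(x, a, y, b). cst (c3 y b (s - x - y) (- a - b)) * cubic n l m s x a y b) UNIV"
      by (rule cubic_rotate)
    also have "\<dots> = psum (\<lambda>(x, a, y, b).
        cst (c3 (s - x - y) (- a - b) (s - y - (s - x - y)) (- b - (- a - b))) * ?M x a y b) UNIV"
      by (rule cubic_rotate)
    finally show ?thesis by simp
  qed
  have Q: "c1 x a y b + c2 y b (s - x - y) (- a - b) + c3 (s - x - y) (- a - b) x a =
      (if x = k \<and> y = i then 1 / 4 else 0) - (if x = j \<and> y = k then 1 / 4 else 0)" for x a y b
  proof -
    define z c where "z = s - x - y" and "c = - a - b"
    have eqs: "x + y - i = j + k - z" "a + b = - c" "y + z - j = k + i - x" "b + c = - a"
        "z + x - k = i + j - y" "c + a = - b"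
      and sums: "x + y + z = i + j + k" "a + b + c = 0"
      by (auto simp: z_def c_def s_def)
    have "c1 x a y b + c2 y b (s - x - y) (- a - b) + c3 (s - x - y) (- a - b) x a =
        ((if x = k \<and> y = i then 1 else 0) - (if x = j \<and> y = k then 1 else 0)) / 4"
      unfolding z_def[symmetric] c_def[symmetric] c1_def c2_def c3_def eqs
      using C_C_sum[OF sums] by (simp only: add.assoc)
    then show ?thesis
      by (simp only: diff_divide_distrib) simp
  qed
  let ?g1 = "\<lambda>x a y b. if x = k \<and> y = i then 1 / 4 else (0 :: complex)"
  let ?g2 = "\<lambda>x a y b. if x = j \<and> y = k then 1 / 4 else (0 :: complex)"
  have "ham u (gen v w) + ham v (gen w u) + ham w (gen u v) =
    psum (\<lambda>r. (\<lambda>(x, a, y, b). cst (c1 x a y b) * ?M x a y b) r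
        + (\<lambda>(x, a, y, b). cst (c2 y b (s - x - y) (- a - b)) * ?M x a y b) r
        + (\<lambda>(x, a, y, b). cst (c3 (s - x - y) (- a - b) x a) * ?M x a y b) r) UNIV"
    unfolding ham1 ham2 ham3
    by (simp only: psum_add[OF psummable_add[OF psummable_cubic psummable_cubic] psummable_cubic] psum_add[OF psummable_cubic psummable_cubic])
  also have "\<dots> = psum (\<lambda>r. (\<lambda>(x, a, y, b). cst (?g1 x a y b) * ?M x a y b) r
        - (\<lambda>(x, a, y, b). cst (?g2 x a y b) * ?M x a y b) r) UNIV"
  proof (rule psum_cong[OF refl])
    fix r :: "int \<times> int \<times> int \<times> int"
    obtain x a y b where r: "r = (x, a, y, b)" by (cases r)
    have "(cst (c1 x a y b) + cst (c2 y b (s - x - y) (- a - b)) + cst (c3 (s - x - y) (- a - b) x a)) * ?M x a y b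
      = (cst (?g1 x a y b) - cst (?g2 x a y b)) * ?M x a y b"
      by (simp only: cst_add[symmetric] cst_diff[symmetric] Q)
    then show "(\<lambda>(x, a, y, b). cst (c1 x a y b) * ?M x a y b) r
        + (\<lambda>(x, a, y, b). cst (c2 y b (s - x - y) (- a - b)) * ?M x a y b) r
        + (\<lambda>(x, a, y, b). cst (c3 (s - x - y) (- a - b) x a) * ?M x a y b) r =
      (\<lambda>(x, a, y, b). cst (?g1 x a y b) * ?M x a y b) r - (\<lambda>(x, a, y, b). cst (?g2 x a y b) * ?M x a y b) r"
      by (simp only: r split distrib_right left_diff_distrib)
  qed
  also have "\<dots> = psum (\<lambda>(x, a, y, b). cst (?g1 x a y b) * ?M x a y b) UNIV
      - psum (\<lambda>(x, a, y, b). cst (?g2 x a y b) * ?M x a y b) UNIV"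
    by (rule psum_diff[OF psummable_cubic psummable_cubic])
  \<comment> \<open>Both sides run over all products of modes of \<open>T k\<close>,
    \<open>T i\<close>, \<open>T j\<close> of total weight m + n + l with the constant coefficient 1
    / 4. The shifts in the witness match each mode with the same mode in its other position.\<close>
  also have "psum (\<lambda>(x, a, y, b). cst (?g1 x a y b) * ?M x a y b) UNIV =
      psum (\<lambda>(x, a, y, b). cst (?g2 x a y b) * ?M x a y b) UNIV"
    by (rule psum_reindex_witness[where h = "\<lambda>(x, a, y, b). (y, m - n + b, s - x - y, n - l - a - b)"
          and k = "\<lambda>(x, a, y, b). (s - x - y, m - l - a - b, x, a - m + n)"])
       (auto simp: cubic_def mult_ac s_def add.assoc)
  finally show ?thesis by simp
qed

lemma jacobi_PB:
  assumes "F \<in> bounded_wt N" "G \<in> bounded_wt N" "H \<in> bounded_wt N"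
  shows "PB F (PB G H) + PB G (PB H F) + PB H (PB F G) = 0"
  using jacobi_gen assms by (rule PB_jacobi)

end


section \<open>Comparison with the two brackets\<close>

lemma Pseries_fourier_coeff:
  "Pseries (fourier_coeff K f g m n) = psum (\<lambda>p. cst (K p) * (Pseries (f (m - p)) * Pseries (g (n + p)))) UNIV"
proof (rule pseries_eqI)
  fix X
  have "coeff (Pseries F * Pseries G) X = fmul F G X" for F G
    by (simp add: times_pseries_def)
  then show "coeff (Pseries (fourier_coeff K f g m n)) X =
      coeff (psum (\<lambda>p. cst (K p) * (Pseries (f (m - p)) * Pseries (g (n + p)))) UNIV) X"
    by (simp add: coeff_psum fourier_coeff_def Sum_any.expand_set)
qed

lemma psum_pair_finite:
  assumes "psummable (\<lambda>(x, p). f x p) UNIV" "finite A" "\<And>x p. x \<notin> A \<Longrightarrow> f x p = 0"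
  shows "psum (\<lambda>(x, p). f x p) UNIV = (\<Sum>x\<in>A. psum (f x) UNIV)"
proof -
  have "psum (\<lambda>(x, p). f x p) UNIV = psum (\<lambda>x. psum (f x) UNIV) UNIV"
    using psum_Sigma[of f UNIV "\<lambda>_. UNIV"] assms(1) by simp
  also have "\<dots> = psum (\<lambda>x. psum (f x) UNIV) A"
  proof (rule psum_mono_neutral)
    fix x assume "x \<in> UNIV - A"
    then show "psum (f x) UNIV = 0"
      using assms(3)[of x] by (simp cong: psum_cong)
  qed simp
  also have "\<dots> = (\<Sum>x\<in>A. psum (f x) UNIV)"
    by (rule psum_finite[OF assms(2)])
  finally show ?thesis .
qed

context qdiff
begin

definition FC :: "(int \<Rightarrow> complex) \<Rightarrow> nat \<Rightarrow> nat \<Rightarrow> int \<Rightarrow> int \<Rightarrow> pseries" where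
  "FC K x y m n = psum (\<lambda>p. cst (K p) * (t x (m - p) * t y (n + p))) UNIV"

lemma Pseries_fourier_tcoeff: "Pseries (fourier_coeff K (tcoeff x) (tcoeff y) m n) = FC K x y m n"
  by (simp add: Pseries_fourier_coeff FC_def t_def)

lemma FC_swap: "FC K x y n m = FC (\<lambda>p. K (- p)) y x m n"
  unfolding FC_def by (rule psum_reindex_witness[where h = uminus and k = uminus]) (auto simp: mult_ac)

lemma delta_power: "delta (q ^ r) p = E (int r * p)" 
  by (simp add: delta_def E_def power_int_mult)

lemma delta_inverse_power: "delta (1 / q ^ r) p = E (- (int r * p))"
  by (simp add: delta_def E_def power_int_mult power_int_minus power_int_divide_distrib inverse_eq_divide)

text \<open>With Q = E (N * p), use 1 / (1 - Q) = cot p + 1 / 2 and Q / (1 - Q) = cot p - 1 / 2. The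
  two exponentials split off are the Sklyanin coefficients at x = i and x = j. At p = 0 both sides
  are 0.\<close>

lemma bracket2_kernel_eq:
  assumes "j \<le> N"
  shows "bracket2_kernel q N i j p = \<Theta> (int i) (int j) p - E ((int i - int j) * p) / 2 + 1 / 2"
proof (cases "p = 0")
  case False
  then have "E (int N * p) \<noteq> 1" using N0 by (intro E_neq_1) simp
  moreover have "bracket2_kernel q N i j p =
      (1 - E (int i * p)) * (1 - E (int N * p) / E (int j * p)) / (1 - E (int N * p))"
    using False assms
    by (simp add: bracket2_kernel_def E_def of_nat_diff power_int_diff[OF disjI1[OF q0], symmetric] algebra_simps)
  ultimately show ?thesis
    by (simp add: \<Theta>_def cot_def left_diff_distrib E_diff E_minus) (simp add: field_simps)
qed (simp add: bracket2_kernel_def \<Theta>_def)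

text \<open>Strictly between i and j the two signs are opposite, and outside they add up to 2 or -
  2. At i = j the two halves cancel.\<close>

lemma C_eq:
  assumes "i \<le> j"
  shows "C i j x p = (if x = i then \<Theta> i j p - E ((i - j) * p) / 2 else 0) + (if x = j then 1 / 2 else 0)
    + (if x > j then E ((x - j) * p) else 0) - (if x < i then E ((x - j) * p) else 0)"
  using assms by (auto simp: C_def S_def sgn_if)

text \<open>The terms x = i and x = j combine to the kernel, x = j + r gives the first delta sum and
  x = i - r the second. The bounds r \<le> i and r \<le> N - j say that both factors
  \<open>T\<close> have an index in 0..N.\<close>

lemma rbracket_upper:
  fixes i j :: nat
  assumes ij: "i \<le> j" "j < N"
  shows "rbracket (int i) m (int j) n = FC (bracket2_kernel q N i j) i j m n
    + (\<Sum>r = 1..min i (N - j). psum (\<lambda>p. cst (delta (q ^ r) p) * (T (int (j + r)) (m - p) * T (int (i - r)) (n + p))) UNIV)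
    - (\<Sum>r = 1..min i (N - j). psum (\<lambda>p. cst (delta (1 / q ^ (j - i + r)) p) * (T (int (i - r)) (m - p) * T (int (j + r)) (n + p))) UNIV)"
proof -
  let ?R = "{1..min i (N - j)}"
  define W where "W x p = T x (m - p) * T (int i + int j - x) (n + p)" for x p
  have summable: "psummable (\<lambda>(x, p). cst (g x p) * W x p) UNIV" for g
    unfolding W_def by (rule psummable_T_mult)
  define cA where "cA x p = (if x = int i then \<Theta> (int i) (int j) p - E ((int i - int j) * p) / 2 else 0)" for x p
  define cB where "cB x p = (if x = int j then 1 / 2 else 0 :: complex)" for x p :: int
  define cC where "cC x p = (if x > int j then E ((x - int j) * p) else 0)" for x p
  define cD where "cD x p = (if x < int i then E ((x - int j) * p) else 0)" for x p
  have "rbracket (int i) m (int j) n = psum (\<lambda>r. (\<lambda>(x, p). cst (cA x p) * W x p) r + (\<lambda>(x, p). cst (cB x p) * W x p) r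
      + (\<lambda>(x, p). cst (cC x p) * W x p) r - (\<lambda>(x, p). cst (cD x p) * W x p) r) UNIV"
    unfolding rbracket_def
    by (rule psum_cong) (use ij in \<open>auto simp: C_eq W_def cst_add cst_diff cA_def cB_def cC_def cD_def algebra_simps\<close>)
  also have "\<dots> = psum (\<lambda>(x, p). cst (cA x p) * W x p) UNIV + psum (\<lambda>(x, p). cst (cB x p) * W x p) UNIV
      + psum (\<lambda>(x, p). cst (cC x p) * W x p) UNIV - psum (\<lambda>(x, p). cst (cD x p) * W x p) UNIV"
    by (simp only: psum_diff psum_add psummable_add summable)
  also have "psum (\<lambda>(x, p). cst (cA x p) * W x p) UNIV = (\<Sum>x\<in>{int i}. psum (\<lambda>p. cst (cA x p) * W x p) UNIV)"
    by (rule psum_pair_finite[OF summable]) (auto simp: cA_def)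
  also have "psum (\<lambda>(x, p). cst (cB x p) * W x p) UNIV = (\<Sum>x\<in>{int j}. psum (\<lambda>p. cst (cB x p) * W x p) UNIV)"
    by (rule psum_pair_finite[OF summable]) (auto simp: cB_def)
  \<comment> \<open>At x = j the factors are those of x = i in the other order. Replacing p by m - n
    - p restores the order, and the constant coefficient 1 / 2 is unaffected.\<close>
  also have "(\<Sum>x\<in>{int j}. psum (\<lambda>p. cst (cB x p) * W x p) UNIV) = psum (\<lambda>p. cst (1 / 2) * W (int i) p) UNIV"
    by (simp, rule psum_reindex_witness[where h = "\<lambda>p. m - n - p" and k = "\<lambda>p. m - n - p"])
       (auto simp: W_def cB_def mult_ac)
  also have "(\<Sum>x\<in>{int i}. psum (\<lambda>p. cst (cA x p) * W x p) UNIV) + psum (\<lambda>p. cst (1 / 2) * W (int i) p) UNIV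
     = FC (bracket2_kernel q N i j) i j m n"
  proof -
    have *: "psummable (\<lambda>p. cst (g p) * W (int i) p) UNIV" for g
      using psummable_inj[OF summable[of "\<lambda>_. g"], of "\<lambda>p. (int i, p)" UNIV] by (simp add: inj_on_def)
    have "(\<Sum>x\<in>{int i}. psum (\<lambda>p. cst (cA x p) * W x p) UNIV) + psum (\<lambda>p. cst (1 / 2) * W (int i) p) UNIV
      = psum (\<lambda>p. cst (cA (int i) p) * W (int i) p + cst (1 / 2) * W (int i) p) UNIV"
      by (simp add: psum_add[OF * *])
    also have "\<dots> = FC (bracket2_kernel q N i j) i j m n"
      unfolding FC_def
      by (rule psum_cong)
         (use ij in \<open>auto simp: cA_def W_def bracket2_kernel_eq cst_add[symmetric] distrib_right[symmetric] T_def\<close>)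
    finally show ?thesis .
  qed
  also have "psum (\<lambda>(x, p). cst (cC x p) * W x p) UNIV
      = (\<Sum>x\<in>(\<lambda>r. int (j + r)) ` ?R. psum (\<lambda>p. cst (cC x p) * W x p) UNIV)"
  proof (rule psum_pair_finite[OF summable])
    fix x p assume x: "x \<notin> (\<lambda>r. int (j + r)) ` ?R"
    show "cst (cC x p) * W x p = 0"
    proof (cases "x > int j \<and> x \<le> int N \<and> x \<le> int i + int j")
      case True
      then have "x = int (j + nat (x - int j))" "nat (x - int j) \<in> ?R"
        by auto
      with x show ?thesis by blast
    qed (auto simp: cC_def W_def T_def)
  qed simp
  also have "\<dots> = (\<Sum>r\<in>?R. psum (\<lambda>p. cst (delta (q ^ r) p) * (T (int (j + r)) (m - p) * T (int (i - r)) (n + p))) UNIV)"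
    by (subst sum.reindex) 
       (auto simp: inj_on_def cC_def W_def delta_power of_nat_diff intro!: sum.cong psum_cong)
  also have "psum (\<lambda>(x, p). cst (cD x p) * W x p) UNIV
      = (\<Sum>x\<in>(\<lambda>r. int (i - r)) ` ?R. psum (\<lambda>p. cst (cD x p) * W x p) UNIV)"
  proof (rule psum_pair_finite[OF summable])
    fix x p assume x: "x \<notin> (\<lambda>r. int (i - r)) ` ?R"
    show "cst (cD x p) * W x p = 0"
    proof (cases "x < int i \<and> x \<ge> 0 \<and> int i + int j - x \<le> int N")
      case True
      then have "x = int (i - nat (int i - x))" "nat (int i - x) \<in> ?R"
        using ij by auto
      with x show ?thesis by blast
    qed (auto simp: cD_def W_def T_def)
  qed simp
  also have "\<dots> = (\<Sum>r\<in>?R. psum (\<lambda>p. cst (delta (1 / q ^ (j - i + r)) p) * (T (int (i - r)) (m - p) * T (int (j + r)) (n + p))) UNIV)"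
    using ij
    by (subst sum.reindex)
       (auto simp: inj_on_def cD_def W_def delta_inverse_power of_nat_diff algebra_simps intro!: sum.cong psum_cong)
  finally show ?thesis .
qed

text \<open>Since r \<ge> 1, the index i - r stays below N, and j + r = N holds exactly for r = N -
  j, which is in range iff N \<le> i + j. That one term of each sum carries \<open>lam\<close>, and
  it is the corresponding term of the first bracket.\<close>

lemma gen_upper:
  fixes i j :: nat
  assumes ij: "0 < i" "i \<le> j" "j < N"
  shows "rbracket (int i) m (int j) n = Pseries (bracket2_gen q N i m j n) + cst (lam - 1) * Pseries (bracket1_gen q N i m j n)"
proof -
  let ?R = "{1..min i (N - j)}"
  have T: "T (int (i - r)) p = t (i - r) p" "T (int (j + r)) p = cst (if r = N - j then lam else 1) * t (j + r) p"
    if "r \<in> ?R" for r p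
    using that ij by (auto simp: T_def simp del: of_nat_diff of_nat_add)
  have scale: "(\<Sum>r\<in>?R. cst (if r = N - j then lam else 1) * F r) =
      (\<Sum>r\<in>?R. F r) + (if N \<le> i + j then cst (lam - 1) * F (N - j) else 0)" for F
  proof -
    have "(\<Sum>r\<in>?R. cst (if r = N - j then lam else 1) * F r) =
        (\<Sum>r\<in>?R. F r + (if r = N - j then cst (lam - 1) * F (N - j) else 0))"
      by (rule sum.cong) (auto simp: cst_diff algebra_simps)
    also have "\<dots> = (\<Sum>r\<in>?R. F r) + (if N - j \<in> ?R then cst (lam - 1) * F (N - j) else 0)"
      by (simp add: sum.distrib)
    also have "N - j \<in> ?R \<longleftrightarrow> N \<le> i + j"
      using ij by auto
    finally show ?thesis .
  qed
  have sC: "(\<Sum>r\<in>?R. psum (\<lambda>p. cst (delta (q ^ r) p) * (T (int (j + r)) (m - p) * T (int (i - r)) (n + p))) UNIV) =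
    (\<Sum>r\<in>?R. cst (if r = N - j then lam else 1) * FC (delta (q ^ r)) (j + r) (i - r) m n)"
    by (rule sum.cong[OF refl]) (simp only: T FC_def psum_cst_mult[symmetric] mult_ac)
  have sD: "(\<Sum>r\<in>?R. psum (\<lambda>p. cst (delta (1 / q ^ (j - i + r)) p) * (T (int (i - r)) (m - p) * T (int (j + r)) (n + p))) UNIV) =
    (\<Sum>r\<in>?R. cst (if r = N - j then lam else 1) * FC (delta (1 / q ^ (j - i + r))) (i - r) (j + r) m n)"
    by (rule sum.cong[OF refl]) (simp only: T FC_def psum_cst_mult[symmetric] mult_ac)
  have b2: "Pseries (bracket2_gen q N i m j n) = FC (bracket2_kernel q N i j) i j m n
    + (\<Sum>r\<in>?R. FC (delta (q ^ r)) (j + r) (i - r) m n) - (\<Sum>r\<in>?R. FC (delta (1 / q ^ (j - i + r))) (i - r) (j + r) m n)"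
    using ij by (intro pseries_eqI) (simp add: bracket2_gen_def bracket2_upper_def Pseries_fourier_tcoeff[symmetric])
  have b1: "Pseries (bracket1_gen q N i m j n) = (if N \<le> i + j then FC (delta (q ^ (N - j))) N (i + j - N) m n
      - FC (delta (1 / q ^ (N - i))) (i + j - N) N m n else 0)"
    using ij by (intro pseries_eqI) (auto simp: bracket1_gen_def Pseries_fourier_tcoeff[symmetric])
  have arith: "i - (N - j) = i + j - N" "j - i + (N - j) = N - i" if "N \<le> i + j"
    using ij that by auto
  show ?thesis
    unfolding rbracket_upper[OF ij(2,3)] sC sD scale b2 b1
    by (cases "N \<le> i + j") (use ij in \<open>simp_all add: arith right_diff_distrib\<close>)
qed

text \<open>At upper index N the factor 1 - q powi (m * (N - j)) of the kernel vanishes and both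
  sums over r are empty.\<close>

lemma bracket2_gen_N:
  assumes "0 < i" "i \<le> N" "0 < j" "j \<le> N" "i = N \<or> j = N"
  shows "Pseries (bracket2_gen q N i m j n) = 0"
proof -
  have *: "bracket2_upper q N k m' N n' X = 0" for k m' n' X
    by (simp add: bracket2_upper_def bracket2_kernel_def fourier_coeff_def cong: if_cong)
  show ?thesis
    using assms by (intro pseries_eqI) (auto simp: bracket2_gen_def fscale_def *)
qed

text \<open>One formula defines the first bracket for all i and j, so antisymmetry is a property to
  be checked: exchanging the arguments reverses the sign of p and swaps the two delta terms.\<close>

lemma bracket1_gen_antisym: "Pseries (bracket1_gen q N j n i m) = - Pseries (bracket1_gen q N i m j n)"
proof -
  have b1: "Pseries (bracket1_gen q N i m j n) = (if i \<noteq> N \<and> j \<noteq> N \<and> N \<le> i + j 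
      then FC (delta (q ^ (N - j))) N (i + j - N) m n - FC (delta (1 / q ^ (N - i))) (i + j - N) N m n else 0)" for i m j n
    by (rule pseries_eqI) (auto simp: bracket1_gen_def Pseries_fourier_tcoeff[symmetric])
  have "(\<lambda>p. delta (q ^ r) (- p)) = delta (1 / q ^ r)" "(\<lambda>p. delta (1 / q ^ r) (- p)) = delta (q ^ r)" for r
    by (auto simp: delta_power delta_inverse_power)
  then show ?thesis
    unfolding b1 by (subst (1 2) FC_swap[of _ _ _ n m]) (auto simp: add.commute)
qed

lemma gen_eq:
  assumes "u \<in> vars N" "v \<in> vars N"
  shows "gen u v = Pseries (bracket2_gen q N (fst u) (snd u) (fst v) (snd v))
    + cst (lam - 1) * Pseries (bracket1_gen q N (fst u) (snd u) (fst v) (snd v))"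
proof -
  obtain i m j n where uv: "u = (i, m)" "v = (j, n)" by (cases u, cases v)
  have ij: "0 < i" "i \<le> N" "0 < j" "j \<le> N"
    using assms by (auto simp: uv vars_def)
  consider "i = N \<or> j = N" | "i \<le> j" "j < N" | "j < i" "i < N"
    using ij by linarith
  then have "rbracket (int i) m (int j) n = Pseries (bracket2_gen q N i m j n) + cst (lam - 1) * Pseries (bracket1_gen q N i m j n)"
  proof cases
    case 1
    then have "Pseries (bracket1_gen q N i m j n) = 0"
      by (intro pseries_eqI) (auto simp: bracket1_gen_def)
    moreover have "rbracket (int i) m (int j) n = 0"
      using 1 ij rbracket_eq_0[of "int i" "int j" m n] rbracket_eq_0[of "int j" "int i" n m] rbracket_antisym[of "int i" m "int j" n]
      by auto
    ultimately show ?thesis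
      using bracket2_gen_N[OF ij 1, of m n] by simp
  next
    case 2
    then show ?thesis using ij gen_upper by blast
  next
    case 3
    have "Pseries (bracket2_gen q N i m j n) = - Pseries (bracket2_gen q N j n i m)"
      using 3 by (intro pseries_eqI) (simp add: bracket2_gen_def fscale_def)
    then show ?thesis
      using gen_upper[of j i n m] 3 ij rbracket_antisym[of "int i" m "int j" n] bracket1_gen_antisym[of i m j n]
      by (simp add: algebra_simps)
  qed
  then show ?thesis by (simp add: gen_def uv)
qed

end

section \<open>Extension from generators to functionals\<close>

definition ext_bracket :: "(nat \<Rightarrow> int \<Rightarrow> nat \<Rightarrow> int \<Rightarrow> functional) \<Rightarrow> pseries \<Rightarrow> pseries \<Rightarrow> pseries" where
  "ext_bracket \<beta> F G = Pseries (extend_bracket \<beta> (coeff F) (coeff G))"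

lemma ext_bracket_eq:
  assumes "F \<in> bounded_wt N" "G \<in> bounded_wt N"
  shows "ext_bracket \<beta> F G = psum (\<lambda>(u, v). D u F * (D v G * Pseries (\<beta> (fst u) (snd u) (fst v) (snd v)))) (vars N \<times> vars N)"
proof -
  have "ext_bracket \<beta> F G = psum (\<lambda>(u, v). D u F * (D v G * Pseries (\<beta> (fst u) (snd u) (fst v) (snd v)))) UNIV"
    by (rule pseries_eqI)
       (simp add: ext_bracket_def extend_bracket_def Sum_any.expand_set coeff_psum split_def D_def
         times_pseries_def fmul_assoc)
  also have "\<dots> = psum (\<lambda>(u, v). D u F * (D v G * Pseries (\<beta> (fst u) (snd u) (fst v) (snd v)))) (vars N \<times> vars N)"
  proof (rule psum_mono_neutral)
    fix p assume p: "p \<in> UNIV - vars N \<times> vars N"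
    obtain u v where "p = (u, v)" by (cases p)
    with p have "p = (u, v)" "D u F = 0 \<or> D v G = 0"
      using assms[THEN D_outside_vars] by blast+
    then show "(\<lambda>(u, v). D u F * (D v G * Pseries (\<beta> (fst u) (snd u) (fst v) (snd v)))) p = 0"
      by auto
  qed simp
  finally show ?thesis .
qed

context qdiff
begin

lemma PB_eq:
  assumes "F \<in> bounded_wt N" "G \<in> bounded_wt N"
  shows "PB F G = ext_bracket (bracket2_gen q N) F G + cst (lam - 1) * ext_bracket (bracket1_gen q N) F G"
proof -
  have summable: "psummable (\<lambda>(u, v). D u F * (D v G * \<beta> u v)) (vars N \<times> vars N)" for \<beta>
    using assms by (intro psummable_mult_Sigma psummable_mult_left psummable_D_bounded_wt)
  show ?thesis
    unfolding ext_bracket_eq[OF assms] psum_cst_mult[symmetric]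
    by (subst psum_add[symmetric])
       (auto simp: PB_def gen_eq algebra_simps split_def intro!: psum_cong
         psummable_mult_right summable[unfolded split_def])
qed

end


section \<open>Series with regular coefficients\<close>

lemma regular_rational_cong:
  "(\<And>ms. length ms = k \<Longrightarrow> c ms = d ms) \<Longrightarrow> regular_rational q k c \<longleftrightarrow> regular_rational q k d"
  unfolding regular_rational_def by (metis (no_types, lifting))

lemma regular_const: "regular_rational q k (\<lambda>_. a)"
  unfolding regular_rational_def
  by (intro bexI[of _ "\<lambda>_. a"] bexI[of _ "\<lambda>_. 1"]) (auto intro: poly_funs.intros)

lemma regular_coord: "l < k \<Longrightarrow> regular_rational q k (\<lambda>ms. q powi (ms ! l))"
  unfolding regular_rational_def
  by (intro bexI[of _ "\<lambda>x. x ! l"] bexI[of _ "\<lambda>_. 1"]) (auto intro: poly_funs.intros)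

lemma regular_mult:
  assumes "regular_rational q k c" "regular_rational q k d"
  shows "regular_rational q k (\<lambda>ms. c ms * d ms)"
proof -
  from assms obtain P Q P' Q' where
    "P \<in> poly_funs k" "Q \<in> poly_funs k" "P' \<in> poly_funs k" "Q' \<in> poly_funs k"
    "\<And>ms. length ms = k \<Longrightarrow> Q (map (\<lambda>m. q powi m) ms) \<noteq> 0 \<and> c ms = P (map (\<lambda>m. q powi m) ms) / Q (map (\<lambda>m. q powi m) ms)"
    "\<And>ms. length ms = k \<Longrightarrow> Q' (map (\<lambda>m. q powi m) ms) \<noteq> 0 \<and> d ms = P' (map (\<lambda>m. q powi m) ms) / Q' (map (\<lambda>m. q powi m) ms)"
    unfolding regular_rational_def by metis
  then show ?thesis
    unfolding regular_rational_def
    by (intro bexI[of _ "\<lambda>x. P x * P' x"] bexI[of _ "\<lambda>x. Q x * Q' x"]) (auto intro: poly_funs.intros)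
qed

lemma regular_add:
  assumes "regular_rational q k c" "regular_rational q k d"
  shows "regular_rational q k (\<lambda>ms. c ms + d ms)"
proof -
  from assms obtain P Q P' Q' where
    "P \<in> poly_funs k" "Q \<in> poly_funs k" "P' \<in> poly_funs k" "Q' \<in> poly_funs k"
    "\<And>ms. length ms = k \<Longrightarrow> Q (map (\<lambda>m. q powi m) ms) \<noteq> 0 \<and> c ms = P (map (\<lambda>m. q powi m) ms) / Q (map (\<lambda>m. q powi m) ms)"
    "\<And>ms. length ms = k \<Longrightarrow> Q' (map (\<lambda>m. q powi m) ms) \<noteq> 0 \<and> d ms = P' (map (\<lambda>m. q powi m) ms) / Q' (map (\<lambda>m. q powi m) ms)"
    unfolding regular_rational_def by metis
  then show ?thesis
    unfolding regular_rational_def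
    by (intro bexI[of _ "\<lambda>x. P x * Q' x + P' x * Q x"] bexI[of _ "\<lambda>x. Q x * Q' x"])
       (auto intro!: poly_funs.intros simp: add_frac_eq)
qed

lemma regular_inverse:
  assumes "regular_rational q k c" "\<And>ms. length ms = k \<Longrightarrow> c ms \<noteq> 0"
  shows "regular_rational q k (\<lambda>ms. inverse (c ms))"
proof -
  from assms obtain P Q where "P \<in> poly_funs k" "Q \<in> poly_funs k"
    "\<And>ms. length ms = k \<Longrightarrow> Q (map (\<lambda>m. q powi m) ms) \<noteq> 0 \<and> c ms = P (map (\<lambda>m. q powi m) ms) / Q (map (\<lambda>m. q powi m) ms)"
    unfolding regular_rational_def by metis
  with assms(2) show ?thesis
    unfolding regular_rational_def by (intro bexI[of _ Q] bexI[of _ P]) auto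
qed

lemma regular_minus: "regular_rational q k c \<Longrightarrow> regular_rational q k (\<lambda>ms. - c ms)"
  using regular_mult[OF regular_const[of q k "- 1"], of c] by simp

lemma regular_diff:
  "regular_rational q k c \<Longrightarrow> regular_rational q k d \<Longrightarrow> regular_rational q k (\<lambda>ms. c ms - d ms)"
  using regular_add[OF _ regular_minus, of q k c d] by simp

lemma regular_sum:
  "(\<And>i. i \<in> I \<Longrightarrow> regular_rational q k (c i)) \<Longrightarrow> regular_rational q k (\<lambda>ms. \<Sum>i\<in>I. c i ms)"
  by (induction I rule: infinite_finite_induct) (auto intro: regular_add regular_const)

lemma regular_poly_subst:
  assumes "P \<in> poly_funs k" "\<And>l. l < k \<Longrightarrow> regular_rational q n (\<phi> l)"
  shows "regular_rational q n (\<lambda>ms. P (map (\<lambda>l. \<phi> l ms) [0..<k]))"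
  using assms(1)
proof induction
  case (coord l)
  then show ?case using assms(2)[of l] by simp
qed (auto intro: regular_const regular_add regular_mult)

text \<open>Substituting integer forms for the modes keeps a coefficient regular as soon as q to
  each form is itself regular. This property is stable under the sums and integer multiples that
  occur.\<close>

definition regular_exponent :: "complex \<Rightarrow> nat \<Rightarrow> (int list \<Rightarrow> int) \<Rightarrow> bool" where
  "regular_exponent q n \<psi> \<longleftrightarrow> regular_rational q n (\<lambda>ms. q powi \<psi> ms)"

lemma regular_subst:
  assumes "regular_rational q k c" "\<And>l. l < k \<Longrightarrow> regular_exponent q n (\<psi> l)"
  shows "regular_rational q n (\<lambda>ms. c (map (\<lambda>l. \<psi> l ms) [0..<k]))"
proof -
  from assms(1) obtain P Q where PQ: "P \<in> poly_funs k" "Q \<in> poly_funs k"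
    "\<And>ms. length ms = k \<Longrightarrow> Q (map (\<lambda>m. q powi m) ms) \<noteq> 0 \<and> c ms = P (map (\<lambda>m. q powi m) ms) / Q (map (\<lambda>m. q powi m) ms)"
    unfolding regular_rational_def by metis
  have eq: "c (map (\<lambda>l. \<psi> l ms) [0..<k]) =
      P (map (\<lambda>l. q powi \<psi> l ms) [0..<k]) * inverse (Q (map (\<lambda>l. q powi \<psi> l ms) [0..<k]))"
    and nz: "Q (map (\<lambda>l. q powi \<psi> l ms) [0..<k]) \<noteq> 0" for ms
    using PQ(3)[of "map (\<lambda>l. \<psi> l ms) [0..<k]"] by (simp_all add: comp_def divide_inverse)
  show ?thesis
    unfolding eq using nz assms(2)
    by (intro regular_mult regular_inverse regular_poly_subst PQ) (auto simp: regular_exponent_def)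
qed

lemma regular_exponent_coord: "l < n \<Longrightarrow> regular_exponent q n (\<lambda>ms. ms ! l)"
  by (simp add: regular_exponent_def regular_coord)

lemma regular_exponent_const: "regular_exponent q n (\<lambda>_. M)"
  by (simp add: regular_exponent_def regular_const)

lemma regular_exponent_add:
  "q \<noteq> 0 \<Longrightarrow> regular_exponent q n \<phi> \<Longrightarrow> regular_exponent q n \<psi> \<Longrightarrow> regular_exponent q n (\<lambda>ms. \<phi> ms + \<psi> ms)"
  by (simp add: regular_exponent_def power_int_add regular_mult)

lemma regular_exponent_minus:
  "q \<noteq> 0 \<Longrightarrow> regular_exponent q n \<psi> \<Longrightarrow> regular_exponent q n (\<lambda>ms. - \<psi> ms)"
  by (simp add: regular_exponent_def power_int_minus regular_inverse)

lemma regular_exponent_diff: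
  "q \<noteq> 0 \<Longrightarrow> regular_exponent q n \<phi> \<Longrightarrow> regular_exponent q n \<psi> \<Longrightarrow> regular_exponent q n (\<lambda>ms. \<phi> ms - \<psi> ms)"
  using regular_exponent_add[OF _ _ regular_exponent_minus, of q n \<phi> \<psi>] by simp

lemma regular_exponent_sum:
  "q \<noteq> 0 \<Longrightarrow> (\<And>i. i \<in> I \<Longrightarrow> regular_exponent q n (\<psi> i)) \<Longrightarrow> regular_exponent q n (\<lambda>ms. \<Sum>i\<in>I. \<psi> i ms)"
  by (induction I rule: infinite_finite_induct) (auto intro: regular_exponent_add regular_exponent_const)

lemma regular_exponent_mult:
  assumes "q \<noteq> 0" "regular_exponent q n \<psi>"
  shows "regular_exponent q n (\<lambda>ms. z * \<psi> ms)"
proof -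
  have *: "regular_exponent q n (\<lambda>ms. int k * \<psi> ms)" for k
    using regular_exponent_sum[of q "{..<k}" n "\<lambda>_. \<psi>"] assms by simp
  show ?thesis
  proof (cases "z \<ge> 0")
    case True
    then show ?thesis using *[of "nat z"] by simp
  next
    case False
    then show ?thesis using regular_exponent_minus[OF assms(1) *[of "nat (- z)"]] by simp
  qed
qed

section \<open>Monomials and series with index 0 allowed\<close>

definition slice :: "nat list \<Rightarrow> int \<Rightarrow> int list set" where
  "slice is M = {ms. length ms = length is \<and> sum_list ms = M}"

text \<open>Brackets produce factors with index i - r = 0, which \<open>local_series\<close> with
  indices in 1..N cannot contain. Here such a factor is the constant 1 in mode 0 and is removed
  later.\<close>

definition tmon :: "nat list \<Rightarrow> int list \<Rightarrow> pseries" where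
  "tmon is ms = prod_list (map2 (\<lambda>i m. Pseries (tcoeff i m)) is ms)"

definition tseries :: "nat list \<Rightarrow> int \<Rightarrow> (int list \<Rightarrow> complex) \<Rightarrow> pseries" where
  "tseries is M c = psum (\<lambda>ms. cst (c ms) * tmon is ms) (slice is M)"

lemma Pseries_tcoeff_0: "Pseries (tcoeff 0 m) = (if m = 0 then 1 else 0)"
  by (simp add: tcoeff_def pseries_defs)

lemma Pseries_tcoeff_pos: "i > 0 \<Longrightarrow> Pseries (tcoeff i m) = V (i, m)"
  by (simp add: tcoeff_def V_def)

lemma tmon_Nil [simp]: "tmon [] ms = 1"
  and tmon_Cons: "tmon (i # is) (m # ms) = Pseries (tcoeff i m) * tmon is ms"
  by (simp_all add: tmon_def)

lemma tmon_append:
  "length is = length ms \<Longrightarrow> tmon (is @ js) (ms @ ns) = tmon is ms * tmon js ns"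
  by (simp add: tmon_def)

lemma coeff_tmon_nonzero:
  assumes "length is = length ms" "coeff (tmon is ms) X \<noteq> 0"
  shows "wt X = sum_list ms \<and> set ms \<subseteq> insert 0 (snd ` set_mset X) \<and> (set is \<subseteq> {0..N} \<longrightarrow> set_mset X \<subseteq> vars N)"
  using assms
proof (induction "is" ms arbitrary: X rule: list_induct2)
  case Nil
  then show ?case by (auto simp: coeff_one split: if_splits)
next
  case (Cons i "is" m ms)
  from Cons.prems obtain A B where AB: "A + B = X" "coeff (Pseries (tcoeff i m)) A \<noteq> 0" "coeff (tmon is ms) B \<noteq> 0"
    unfolding tmon_Cons by (rule coeff_mult_nonzeroE)
  have "(i = 0 \<and> m = 0 \<and> A = {#}) \<or> (i > 0 \<and> A = {#(i, m)#})"
    using AB(2) by (auto simp: tcoeff_def fzero_def fone_def split: if_splits)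
  moreover have "0 < i \<Longrightarrow> i \<le> N \<Longrightarrow> (i, m) \<in> vars N"
    by (simp add: vars_def)
  ultimately show ?case
    using Cons.IH[OF AB(3)] AB(1) by auto
qed

lemma coeff_V_mult: "coeff (V u * F) X = (if u \<in># X then coeff F (X - {#u#}) else 0)"
proof (cases "u \<in># X")
  case True
  have "coeff (V u * F) X = (\<Sum>(A, B)\<in>{({#u#}, X - {#u#})}. coeff (V u) A * coeff F B)"
    unfolding coeff_mult
    by (rule sum.mono_neutral_right[OF finite_splittings]) (use True in \<open>auto simp: coeff_V split: if_splits\<close>)
  then show ?thesis using True by (simp add: coeff_V)
next
  case False
  then have "coeff (V u * F) X = 0"
    unfolding coeff_mult by (intro sum.neutral) (auto simp: coeff_V)
  then show ?thesis using False by simp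
qed

lemma coeff_tmon:
  assumes "length is = length ms" "0 \<notin> set is"
  shows "coeff (tmon is ms) X = (if mset (zip is ms) = X then 1 else 0)"
  using assms
proof (induction "is" ms arbitrary: X rule: list_induct2)
  case Nil
  then show ?case by (auto simp: coeff_one)
next
  case (Cons i "is" m ms)
  then show ?case
    by (auto simp: tmon_Cons Pseries_tcoeff_pos coeff_V_mult)
qed

lemma psummable_tmon: "psummable (\<lambda>ms. cst (c ms) * tmon is ms) {ms. length ms = length is}"
  unfolding psummable_def
proof
  fix X
  have "set ms \<subseteq> insert 0 (snd ` set_mset X)" if "length ms = length is" "coeff (tmon is ms) X \<noteq> 0" for ms
    using coeff_tmon_nonzero[of "is" ms X] that by simp
  then have "{ms \<in> {ms. length ms = length is}. coeff (cst (c ms) * tmon is ms) X \<noteq> 0}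
     \<subseteq> {ms. set ms \<subseteq> insert 0 (snd ` set_mset X) \<and> length ms = length is}"
    by (intro Collect_mono) (metis (mono_tags, lifting) coeff_cst_mult mem_Collect_eq mult_zero_right)
  then show "finite {ms \<in> {ms. length ms = length is}. coeff (cst (c ms) * tmon is ms) X \<noteq> 0}"
    by (rule finite_subset) (rule finite_lists_length_eq, simp)
qed

lemma Pseries_local_series:
  assumes "0 \<notin> set is"
  shows "Pseries (local_series is M c) = tseries is M c"
proof (rule pseries_eqI)
  fix X :: "tvar multiset"
  have "finite {ms. set ms \<subseteq> snd ` set_mset X \<and> length ms = length is}"
    by (rule finite_lists_length_eq) simp
  moreover have "set ms \<subseteq> snd ` set_mset X" if "length ms = length is" "mset (zip is ms) = X" for ms
    using that by (metis map_snd_zip set_map set_mset_mset subset_refl)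
  ultimately have fin: "finite {ms. length ms = length is \<and> sum_list ms = M \<and> mset (zip is ms) = X}"
    by (auto elim!: rev_finite_subset)
  have "coeff (tseries is M c) X = (\<Sum>ms | length ms = length is \<and> sum_list ms = M \<and> mset (zip is ms) = X. 
      coeff (cst (c ms) * tmon is ms) X)"
    unfolding tseries_def
    by (rule coeff_psum_superset[OF fin]) (auto simp: slice_def coeff_tmon assms)
  then show "coeff (Pseries (local_series is M c)) X = coeff (tseries is M c) X"
    using assms by (simp add: local_series_def coeff_tmon)
qed

lemma tmon_insert_0:
  assumes "k \<le> length ms" "length ms = k + length is2" "length is1 = k"
  shows "tmon (is1 @ 0 # is2) (take k ms @ 0 # drop k ms) = tmon (is1 @ is2) ms"
proof -
  have "tmon (is1 @ is2) (take k ms @ drop k ms) = tmon is1 (take k ms) * tmon is2 (drop k ms)"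
    using assms by (intro tmon_append) simp
  then show ?thesis
    using assms by (simp add: tmon_append tmon_Cons Pseries_tcoeff_0)
qed

text \<open>A slot of index 0 contributes 1 in mode 0 and 0 in all other modes, so the sum collapses
  to the lists with a 0 in that position, and the total weight is unchanged.\<close>

lemma tseries_remove_0:
  assumes k: "length is1 = k"
  shows "tseries (is1 @ 0 # is2) M c = tseries (is1 @ is2) M (\<lambda>ms. c (take k ms @ 0 # drop k ms))"
proof -
  let ?A = "{ms \<in> slice (is1 @ 0 # is2) M. ms ! k = 0}"
  have "tseries (is1 @ 0 # is2) M c = psum (\<lambda>ms. cst (c ms) * tmon (is1 @ 0 # is2) ms) ?A"
    unfolding tseries_def
  proof (rule psum_mono_neutral)
    fix ms assume ms: "ms \<in> slice (is1 @ 0 # is2) M - ?A"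
    then have len: "length ms = k + Suc (length is2)" and nz: "ms ! k \<noteq> 0"
      by (auto simp: slice_def k)
    have "ms = take k ms @ ms ! k # drop (Suc k) ms"
      using len by (simp add: id_take_nth_drop)
    then have "tmon (is1 @ 0 # is2) ms = tmon is1 (take k ms) * (Pseries (tcoeff 0 (ms ! k)) * tmon is2 (drop (Suc k) ms))"
      using len by (metis k length_take min.absorb2 le_add1 tmon_append tmon_Cons)
    then show "cst (c ms) * tmon (is1 @ 0 # is2) ms = 0"
      using nz by (simp add: Pseries_tcoeff_0)
  qed auto
  also have "\<dots> = tseries (is1 @ is2) M (\<lambda>ms. c (take k ms @ 0 # drop k ms))"
    unfolding tseries_def
  proof (rule psum_reindex_witness[where h = "\<lambda>ms. take k ms @ 0 # drop k ms" and k = "\<lambda>ms. take k ms @ drop (Suc k) ms"])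
    fix ms assume "ms \<in> slice (is1 @ is2) M"
    then have len: "length ms = k + length is2" and sum: "sum_list ms = M"
      by (auto simp: slice_def k)
    show "take k (take k ms @ 0 # drop k ms) @ drop (Suc k) (take k ms @ 0 # drop k ms) = ms"
      using len by simp
    have "sum_list (take k ms) + sum_list (drop k ms) = M"
      using sum by (metis append_take_drop_id sum_list_append)
    then show "take k ms @ 0 # drop k ms \<in> ?A"
      using len by (auto simp: slice_def k nth_append)
    show "cst (c (take k ms @ 0 # drop k ms)) * tmon (is1 @ 0 # is2) (take k ms @ 0 # drop k ms) =
      cst (c (take k ms @ 0 # drop k ms)) * tmon (is1 @ is2) ms"
      using len by (simp add: tmon_insert_0 k)
  next
    fix ms assume "ms \<in> ?A"
    then have len: "length ms = k + Suc (length is2)" and nz: "ms ! k = 0" and sum: "sum_list ms = M"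
      by (auto simp: slice_def k)
    have ms: "ms = take k ms @ 0 # drop (Suc k) ms"
      using len nz by (metis id_take_nth_drop less_add_Suc1 add_Suc_right)
    then have "sum_list (take k ms) + sum_list (drop (Suc k) ms) = M"
      using sum by (metis add.left_neutral sum_list.Cons sum_list_append)
    then show "take k ms @ drop (Suc k) ms \<in> slice (is1 @ is2) M"
      using len by (simp add: slice_def k)
    show "take k (take k ms @ drop (Suc k) ms) @ 0 # drop k (take k ms @ drop (Suc k) ms) = ms"
      using len ms by simp
  qed
  finally show ?thesis .
qed

text \<open>Slots of index 0 are removed one at a time. Each removal substitutes the constant 0 for
  one mode of c, which keeps c regular.\<close>

lemma tseries_q_local:
  assumes "set is \<subseteq> {0..N}" "regular_rational q (length is) c"
  shows "coeff (tseries is M c) \<in> q_local q N"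
  using assms
proof (induction "length is" arbitrary: "is" c rule: less_induct)
  case less
  show ?case
  proof (cases "0 \<in> set is")
    case False
    have "{0..N} - {0} = {1..N}"
      by auto
    then have "set is \<subseteq> {1..N}"
      using False less.prems(1) by blast
    then have "local_series is M c \<in> q_local q N"
      using less.prems(2) by (rule q_local.series)
    then show ?thesis
      using Pseries_local_series[OF False, of M c] by (metis coeff_Pseries)
  next
    case True
    then obtain is1 is2 where is_eq: "is = is1 @ 0 # is2"
      by (meson split_list)
    define k where "k = length is1"
    \<comment> \<open>The l-th entry after a 0 is inserted at position k, as a form in the shorter
      list of modes.\<close>
    let ?\<psi> = "\<lambda>l ms. if l < k then ms ! l else if l = k then 0 else ms ! (l - 1)"
    have reg: "regular_rational q (length (is1 @ is2)) (\<lambda>ms. c (map (\<lambda>l. ?\<psi> l ms) [0..<length is]))"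
    proof (rule regular_subst[OF less.prems(2)])
      fix l assume "l < length is"
      then consider "l < k" | "l = k" | "l > k" "l - 1 < length (is1 @ is2)"
        by (auto simp: is_eq k_def) linarith
      then show "regular_exponent q (length (is1 @ is2)) (?\<psi> l)"
        by cases (auto simp: k_def regular_exponent_const regular_exponent_coord)
    qed
    have eq: "map (\<lambda>l. ?\<psi> l ms) [0..<length is] = take k ms @ 0 # drop k ms"
      if "length ms = length (is1 @ is2)" for ms
    proof (rule nth_equalityI)
      fix i assume "i < length (map (\<lambda>l. ?\<psi> l ms) [0..<length is])"
      then have i: "i < length is" by simp
      consider "i < k" | "i = k" | r where "i = k + Suc r"
        by (metis add_Suc_right less_iff_Suc_add linorder_neqE_nat)
      then show "map (\<lambda>l. ?\<psi> l ms) [0..<length is] ! i = (take k ms @ 0 # drop k ms) ! i"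
        by cases (use that i in \<open>auto simp: is_eq k_def nth_append simp del: upt_Suc\<close>)
    qed (use that in \<open>simp add: is_eq k_def\<close>)
    have "regular_rational q (length (is1 @ is2)) (\<lambda>ms. c (take k ms @ 0 # drop k ms))"
      by (rule regular_rational_cong[THEN iffD1, OF _ reg]) (simp only: eq)
    then have "coeff (tseries (is1 @ is2) M (\<lambda>ms. c (take k ms @ 0 # drop k ms))) \<in> q_local q N"
      using less.prems(1) by (intro less.hyps) (auto simp: is_eq)
    then show ?thesis
      unfolding is_eq by (simp add: tseries_remove_0 k_def)
  qed
qed


section \<open>The bracket of two series\<close>

lemma sum_list_int_update: "l < length xs \<Longrightarrow> sum_list (xs[l := v]) = sum_list xs + v - (xs ! l :: int)"
  by (induction xs arbitrary: l) (auto split: nat.splits)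

lemma prod_list_update: 
  "l < length xs \<Longrightarrow> prod_list (xs[l := a]) = (a :: 'a :: comm_monoid_mult) * prod_list (xs[l := 1])"
  by (induction xs arbitrary: l) (auto split: nat.splits simp: mult_ac)

context graded_bracket
begin

lemma PB_one: "PB F 1 = 0"
  by (simp add: PB_def split_def)

lemma PB_V_V: 
  assumes "u \<in> U" "v \<in> U" 
  shows "PB (V u) (V v) = \<beta> u v"
proof -
  have "PB (V u) (V v) = psum (\<lambda>(u', v'). D u' (V u) * (D v' (V v) * \<beta> u' v')) {(u, v)}"
    unfolding PB_def
  proof (rule psum_mono_neutral)
    fix p assume p: "p \<in> UU - {(u, v)}"
    obtain u' v' where "p = (u', v')" by (cases p)
    with p have "p = (u', v')" "u' \<noteq> u \<or> v' \<noteq> v" by auto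
    then show "(\<lambda>(u', v'). D u' (V u) * (D v' (V v) * \<beta> u' v')) p = 0"
      by (auto simp: D_V)
  qed (use assms in simp)
  then show ?thesis by (simp add: psum_finite D_V)
qed

lemma prod_list_bounded_wt: "(\<And>y. y \<in> set ys \<Longrightarrow> y \<in> bounded_wt N) \<Longrightarrow> prod_list ys \<in> bounded_wt N"
  by (induction ys) (auto intro: bounded_wt_mult)

lemma PB_prod_list_right:
  assumes "F \<in> bounded_wt N" "\<And>y. y \<in> set ys \<Longrightarrow> y \<in> bounded_wt N"
  shows "PB F (prod_list ys) = (\<Sum>l<length ys. PB F (ys ! l) * prod_list (ys[l := 1]))"
  using assms(2)
proof (induction ys)
  case (Cons y ys)
  then show ?case
    using assms(1)
    by (simp add: PB_mult_right prod_list_bounded_wt sum.lessThan_Suc_shift sum_distrib_left mult_ac del: sum.lessThan_Suc)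
qed (simp add: PB_one)

lemma PB_prod_list_left:
  assumes "F \<in> bounded_wt N" "\<And>y. y \<in> set ys \<Longrightarrow> y \<in> bounded_wt N"
  shows "PB (prod_list ys) F = (\<Sum>l<length ys. PB (ys ! l) F * prod_list (ys[l := 1]))"
  using PB_prod_list_right[OF assms] by (simp add: PB_antisym[of _ F] sum_negf)

text \<open>Infinite bilinearity. Joint summability of the derivatives in variable and family index
  makes the fourfold sum convergent, so the variables and the family indices may be
  exchanged.\<close>

lemma PB_psum:
  assumes f: "psummable (\<lambda>(u, i). D u (f i)) (U \<times> A)" "psummable f A"
    and g: "psummable (\<lambda>(v, j). D v (g j)) (U \<times> B)" "psummable g B"
  shows "PB (psum f A) (psum g B) = psum (\<lambda>(i, j). PB (f i) (g j)) (A \<times> B)"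
proof -
  let ?h = "\<lambda>(u, v) (i, j). D u (f i) * (D v (g j) * \<beta> u v)"
  let ?h' = "\<lambda>(i, j) (u, v). D u (f i) * (D v (g j) * \<beta> u v)"
  have "psummable (\<lambda>(p, r). (\<lambda>(u, i). D u (f i)) p * ((\<lambda>(v, j). D v (g j)) r * \<beta> (fst p) (fst r)))
      ((U \<times> A) \<times> (U \<times> B))"
    using f g by (intro psummable_mult_Sigma psummable_mult_left)
  note * = psummable_inj[OF this]
  have s: "psummable (\<lambda>(p, r). ?h p r) (UU \<times> (A \<times> B))"
    using *[of "\<lambda>((u, v), (i, j)). ((u, i), (v, j))" "UU \<times> (A \<times> B)"]
    by (simp add: split_def inj_on_def image_subset_iff)
  have s': "psummable (\<lambda>(p, r). ?h' p r) ((A \<times> B) \<times> UU)"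
    using *[of "\<lambda>((i, j), (u, v)). ((u, i), (v, j))" "(A \<times> B) \<times> UU"]
    by (simp add: split_def inj_on_def image_subset_iff)
  have "PB (psum f A) (psum g B) = psum (\<lambda>p. psum (?h p) (A \<times> B)) UU"
    unfolding PB_def
  proof (rule psum_cong[OF refl])
    fix p assume "p \<in> UU"
    obtain u v where p: "p = (u, v)" by (cases p)
    have "psummable (\<lambda>(i, j). D u (f i) * (D v (g j) * \<beta> u v)) (A \<times> B)"
      using f(2) g(2) by (intro psummable_mult_Sigma psummable_mult_left psummable_D)
    note sigma = psum_Sigma[OF this]
    have inner: "psum (\<lambda>j. D u (f i) * (D v (g j) * \<beta> u v)) B = D u (f i) * (D v (psum g B) * \<beta> u v)" for i
      using g(2) by (simp add: D_psum psum_mult_left[symmetric] psum_mult_right[symmetric] psummable_D psummable_mult_left)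
    have "psum (\<lambda>(i, j). D u (f i) * (D v (g j) * \<beta> u v)) (A \<times> B)
        = D u (psum f A) * (D v (psum g B) * \<beta> u v)"
      unfolding sigma[symmetric] inner using f(2) by (simp add: D_psum[of f] psum_mult_left[symmetric] psummable_D)
    then show "(case p of (u, v) \<Rightarrow> D u (psum f A) * (D v (psum g B) * \<beta> u v)) = psum (?h p) (A \<times> B)"
      by (simp add: p)
  qed
  also have "\<dots> = psum (\<lambda>(p, r). ?h p r) (UU \<times> (A \<times> B))"
    by (rule psum_Sigma[OF s])
  also have "\<dots> = psum (\<lambda>(p, r). ?h' p r) ((A \<times> B) \<times> UU)"
    by (rule psum_reindex_witness[where h = prod.swap and k = prod.swap]) (auto simp: split_def)
  also have "\<dots> = psum (\<lambda>p. psum (?h' p) UU) (A \<times> B)"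
    by (rule psum_Sigma[OF s', symmetric])
  also have "\<dots> = psum (\<lambda>(i, j). PB (f i) (g j)) (A \<times> B)"
    by (simp add: PB_def split_def)
  finally show ?thesis .
qed

end

lemma psummable_tmon_slice: "psummable (\<lambda>ms. cst (c ms) * tmon is ms) (slice is M)"
  by (rule psummable_subset[OF psummable_tmon]) (auto simp: slice_def)

text \<open>A monomial X of the derivative determines the mode of \<open>u\<close> as M -
  \<open>wt X\<close>. All modes in \<open>ms\<close> are then this one, modes of X, or 0 in a slot
  of index 0.\<close>

lemma psummable_D_tmon:
  assumes "set is \<subseteq> {0..N}"
  shows "psummable (\<lambda>(u, ms). D u (cst (c ms) * tmon is ms)) (vars N \<times> slice is M)"
  unfolding psummable_def
proof
  fix X
  let ?W = "{1..N} \<times> {M - wt X}"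
  let ?L = "{ms. set ms \<subseteq> insert 0 (insert (M - wt X) (snd ` set_mset X)) \<and> length ms = length is}"
  have "p \<in> ?W \<times> ?L" if p: "p \<in> vars N \<times> slice is M"
      and nz: "coeff (case p of (u, ms) \<Rightarrow> D u (cst (c ms) * tmon is ms)) X \<noteq> 0" for p
  proof -
    obtain u ms where ums: "p = (u, ms)" by (cases p)
    have len: "length is = length ms" "sum_list ms = M" and u: "u \<in> vars N"
      using p by (auto simp: ums slice_def)
    have "coeff (tmon is ms) (add_mset u X) \<noteq> 0"
      using nz by (auto simp: ums coeff_D)
    from coeff_tmon_nonzero[OF len(1) this, of N] len
    have "snd u = M - wt X" "set ms \<subseteq> insert 0 (insert (snd u) (snd ` set_mset X))"
      by auto
    then show ?thesis
      using u len by (auto simp: ums vars_def)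
  qed
  then have "{p \<in> vars N \<times> slice is M. coeff (case p of (u, ms) \<Rightarrow> D u (cst (c ms) * tmon is ms)) X \<noteq> 0} \<subseteq> ?W \<times> ?L"
    by blast
  then show "finite {p \<in> vars N \<times> slice is M. coeff (case p of (u, ms) \<Rightarrow> D u (cst (c ms) * tmon is ms)) X \<noteq> 0}"
    by (rule finite_subset) (intro finite_cartesian_product finite_lists_length_eq; simp)
qed

lemma tmon_update:
  assumes "length is = length ms" "l < length is"
  shows "tmon (is[l := x]) (ms[l := m]) = Pseries (tcoeff x m) * prod_list ((map2 (\<lambda>i m. Pseries (tcoeff i m)) is ms)[l := 1])"
proof -
  have "tmon (is[l := x]) (ms[l := m]) = prod_list ((map2 (\<lambda>i m. Pseries (tcoeff i m)) is ms)[l := Pseries (tcoeff x m)])"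
    by (simp add: tmon_def zip_update map_update)
  then show ?thesis
    using assms prod_list_update[of l "map2 (\<lambda>i m. Pseries (tcoeff i m)) is ms" "Pseries (tcoeff x m)"] by simp
qed

text \<open>The shift p is free, and it can be recovered as M minus the sum of the first block of
  the concatenated list. So two weight constraints together with p become the single constraint M +
  M'. This is why brackets of q-local functionals are q-local although products need not be.\<close>

lemma tseries_shift:
  fixes c d :: "int list \<Rightarrow> complex" and K :: "int \<Rightarrow> complex" and x y :: nat and M :: int
  assumes l: "l < length is" "l' < length js"
  defines "fam \<equiv> \<lambda>((ms, ns), p). cst (c ms * (d ns * K p)) *
      (tmon (is[l := x]) (ms[l := ms ! l - p]) * tmon (js[l' := y]) (ns[l' := ns ! l' + p]))"
    and "e \<equiv> \<lambda>rs. let ms = take (length is) rs; ns = drop (length is) rs; p = M - sum_list ms in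
      c (ms[l := ms ! l + p]) * (d (ns[l' := ns ! l' - p]) * K p)"
  shows "psummable fam ((slice is M \<times> slice js M') \<times> UNIV)"
    and "psum fam ((slice is M \<times> slice js M') \<times> UNIV) = tseries (is[l := x] @ js[l' := y]) (M + M') e"
proof -
  define k where "k = length is"
  define h where "h = (\<lambda>((ms, ns), p). ms[l := ms ! l - p] @ ns[l' := ns ! l' + p] :: int list)"
  define h' where "h' = (\<lambda>rs. let ms = take k rs; ns = drop k rs; p = M - sum_list ms in
      ((ms[l := ms ! l + p], ns[l' := ns ! l' - p]), p))"
  let ?A = "(slice is M \<times> slice js M') \<times> (UNIV :: int set)"
  let ?B = "slice (is[l := x] @ js[l' := y]) (M + M')"
  have l_k: "l < k" using l by (simp add: k_def)
  have h: "h r \<in> ?B" "h' (h r) = r" "cst (e (h r)) * tmon (is[l := x] @ js[l' := y]) (h r) = fam r"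
    if "r \<in> ?A" for r
  proof -
    obtain ms ns p where r: "r = ((ms, ns), p)" by (metis prod.exhaust)
    have len: "length ms = k" "length ns = length js" and sum: "sum_list ms = M" "sum_list ns = M'"
      using that by (auto simp: r slice_def k_def)
    show "h r \<in> ?B"
      using l len sum by (simp add: r h_def slice_def sum_list_int_update k_def)
    show "h' (h r) = r"
      using l len sum by (simp add: r h_def h'_def nth_append sum_list_int_update k_def)
    have "tmon (is[l := x] @ js[l' := y]) (h r) = tmon (is[l := x]) (ms[l := ms ! l - p]) * tmon (js[l' := y]) (ns[l' := ns ! l' + p])"
      unfolding h_def r using len by (simp add: tmon_append k_def)
    moreover have "e (h r) = c ms * (d ns * K p)"
      using l len sum by (simp add: r h_def e_def nth_append sum_list_int_update k_def)
    ultimately show "cst (e (h r)) * tmon (is[l := x] @ js[l' := y]) (h r) = fam r"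
      by (simp add: r fam_def)
  qed
  have h': "h' rs \<in> ?A" "h (h' rs) = rs" if "rs \<in> ?B" for rs
  proof -
    have len: "length rs = k + length js" and sum: "sum_list rs = M + M'"
      using that by (auto simp: slice_def k_def)
    have "sum_list (take k rs) + sum_list (drop k rs) = M + M'"
      using sum by (metis append_take_drop_id sum_list_append)
    then show "h' rs \<in> ?A"
      using l l_k len by (simp add: h'_def Let_def slice_def sum_list_int_update k_def[symmetric])
    show "h (h' rs) = rs"
      using l l_k len by (simp add: h_def h'_def Let_def del: nth_take nth_drop)
  qed
  have inj: "inj_on h ?A"
    by (rule inj_on_inverseI[of _ h']) (rule h(2))
  have "psummable (\<lambda>r. cst (e (h r)) * tmon (is[l := x] @ js[l' := y]) (h r)) ?A"
    by (rule psummable_inj[OF psummable_tmon_slice inj]) (use h(1) in blast)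
  then show "psummable fam ?A"
    by (subst (asm) psummable_cong[OF refl h(3)])
  show "psum fam ?A = tseries (is[l := x] @ js[l' := y]) (M + M') e"
    unfolding tseries_def
  proof (rule psum_reindex_witness[where h = h' and k = h])
    fix rs assume rs: "rs \<in> ?B"
    show "fam (h' rs) = cst (e rs) * tmon (is[l := x] @ js[l' := y]) rs"
      using h(3)[OF h'(1)[OF rs]] h'(2)[OF rs] by simp
  qed (use h(1,2) h' in blast)+
qed

text \<open>The recovered shift is an integer affine form in the modes, so inserting it into c, d
  and K is a substitution that preserves regularity.\<close>

lemma regular_shift:
  assumes "q \<noteq> 0" "regular_rational q k c" "regular_rational q k' d" "l < k" "l' < k'"
    and K: "\<And>n \<psi>. regular_exponent q n \<psi> \<Longrightarrow> regular_rational q n (\<lambda>ms. K (\<psi> ms))"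
  shows "regular_rational q (k + k') (\<lambda>rs. let ms = take k rs; ns = drop k rs; p = M - sum_list ms in
      c (ms[l := ms ! l + p]) * (d (ns[l' := ns ! l' - p]) * K p))"
proof -
  let ?n = "k + k'"
  define p where "p rs = M - (\<Sum>i<k. rs ! i)" for rs
  have p: "regular_exponent q ?n p"
    unfolding p_def using assms(1)
    by (intro regular_exponent_diff regular_exponent_const regular_exponent_sum regular_exponent_coord) auto
  have "regular_rational q ?n (\<lambda>rs. c (map (\<lambda>i. rs ! i + (if i = l then p rs else 0)) [0..<k]))"
  proof (rule regular_subst[OF assms(2)])
    fix i assume "i < k"
    then show "regular_exponent q ?n (\<lambda>rs. rs ! i + (if i = l then p rs else 0))"
      using assms(1) p by (cases "i = l") (auto intro!: regular_exponent_add regular_exponent_coord)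
  qed
  moreover have "regular_rational q ?n (\<lambda>rs. d (map (\<lambda>i. rs ! (k + i) - (if i = l' then p rs else 0)) [0..<k']))"
  proof (rule regular_subst[OF assms(3)])
    fix i assume "i < k'"
    then show "regular_exponent q ?n (\<lambda>rs. rs ! (k + i) - (if i = l' then p rs else 0))"
      using assms(1) p by (cases "i = l'") (auto intro!: regular_exponent_diff regular_exponent_coord)
  qed
  ultimately have reg: "regular_rational q ?n (\<lambda>rs. c (map (\<lambda>i. rs ! i + (if i = l then p rs else 0)) [0..<k]) *
      (d (map (\<lambda>i. rs ! (k + i) - (if i = l' then p rs else 0)) [0..<k']) * K (p rs)))"
    using K[OF p] by (intro regular_mult)
  have eqs: "sum_list (take k rs) = (\<Sum>i<k. rs ! i)"
      "(take k rs)[l := take k rs ! l + v] = map (\<lambda>i. rs ! i + (if i = l then v else 0)) [0..<k]"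
      "(drop k rs)[l' := drop k rs ! l' - v] = map (\<lambda>i. rs ! (k + i) - (if i = l' then v else 0)) [0..<k']"
    if "length rs = k + k'" for rs :: "int list" and v
  proof -
    show "sum_list (take k rs) = (\<Sum>i<k. rs ! i)"
      using that by (simp add: sum_list_sum_nth lessThan_atLeast0)
    show "(take k rs)[l := take k rs ! l + v] = map (\<lambda>i. rs ! i + (if i = l then v else 0)) [0..<k]"
      by (rule nth_equalityI) (use that in \<open>auto simp: nth_list_update\<close>)
    show "(drop k rs)[l' := drop k rs ! l' - v] = map (\<lambda>i. rs ! (k + i) - (if i = l' then v else 0)) [0..<k']"
      by (rule nth_equalityI) (use that in \<open>auto simp: nth_list_update\<close>)
  qed
  show ?thesis
    by (rule regular_rational_cong[THEN iffD1, OF _ reg]) (simp only: Let_def eqs p_def)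
qed

context qdiff
begin

section \<open>Regularity of the structure coefficients\<close>

lemma E_mult_nat: "E (int s * p) = E p ^ s"
  by (simp add: E_def mult.commute[of "int s"] power_int_mult)

lemma geometric_sum: "(1 - E p) * (\<Sum>s<n. E (int s * p)) = 1 - E (int n * p)"
  by (simp add: E_mult_nat one_diff_power_eq)

lemma geometric_sum_nonzero: "(\<Sum>s<N. E (int s * p)) \<noteq> 0"
proof (cases "p = 0")
  case False
  then have "E (int N * p) \<noteq> 1" using N0 by (intro E_neq_1) simp
  then show ?thesis using geometric_sum[of p N] by auto
qed (use N0 in simp)

text \<open>Writing 1 - E (j * p) and 1 - E (N * p) as 1 - E p times geometric sums cancels the
  apparent pole at p = 0. The remaining denominator is nonzero at every integer p because q is not a
  root of unity; at p = 0 it equals N.\<close>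

lemma \<Theta>_eq:
  "\<Theta> (int i) (int j) p = - ((1 - E (int i * p)) * E (- int j * p) * (\<Sum>s<j. E (int s * p)) * (1 + E (int N * p))
      * inverse (\<Sum>s<N. E (int s * p)) * (1 / 2)) + (E (- int j * p) - E (int i * p)) * (1 / 2)"
proof (cases "p = 0")
  case False
  then have E1: "E p \<noteq> 1" by (rule E_neq_1)
  have eq: "1 - E (- (int j * p)) = - (E (- int j * p) * ((1 - E p) * (\<Sum>s<j. E (int s * p))))"
    unfolding geometric_sum by (simp add: E_minus field_simps)
  show ?thesis
    unfolding \<Theta>_def cot_def geometric_sum[of p N, symmetric] eq
    using E1 geometric_sum_nonzero[of p] by (simp add: field_simps)
qed (simp add: \<Theta>_def)

lemma regular_C:
  assumes "regular_exponent q n \<psi>"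
  shows "regular_rational q n (\<lambda>ms. C (int i) (int j) x (\<psi> ms))"
proof -
  have E: "regular_rational q n (\<lambda>ms. E (z * \<psi> ms))" for z
    using regular_exponent_mult[OF q0 assms] by (simp add: regular_exponent_def E_def)
  have "regular_rational q n (\<lambda>ms. \<Theta> (int i) (int j) (\<psi> ms))"
    unfolding \<Theta>_eq
    by (intro regular_mult regular_add regular_minus regular_diff regular_inverse regular_sum regular_const E
        geometric_sum_nonzero)
  moreover have "regular_rational q n (\<lambda>ms. S (int i) (int j) x (\<psi> ms))"
    unfolding S_def divide_inverse by (intro regular_mult regular_const E)
  ultimately show ?thesis
    unfolding C_def by (cases "x = int i") (auto intro: regular_add)
qed

definition \<kappa> :: "nat \<Rightarrow> complex" where
  "\<kappa> x = (if x = N then lam else 1)"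

text \<open>The finitely many x for which both exchanged indices lie in 0..N; x \<le> i + j keeps
  the natural subtraction exact.\<close>

definition targets :: "nat \<Rightarrow> nat \<Rightarrow> nat set" where
  "targets i j = {x. x \<le> N \<and> x \<le> i + j \<and> i + j - x \<le> N}"

lemma finite_targets [simp]: "finite (targets i j)"
  by (rule finite_subset[of _ "{..N}"]) (auto simp: targets_def)

definition K :: "nat \<Rightarrow> nat \<Rightarrow> nat \<Rightarrow> int \<Rightarrow> complex" where
  "K i j x p = C (int i) (int j) (int x) p * (\<kappa> x * \<kappa> (i + j - x))"

lemma gen_sum:
  "gen (i, m) (j, n) = (\<Sum>x\<in>targets i j. psum (\<lambda>p. cst (K i j x p) * (t x (m - p) * t (i + j - x) (n + p))) UNIV)"
proof -
  have "gen (i, m) (j, n) = (\<Sum>x\<in>int ` targets i j. psum (\<lambda>p. cst (C (int i) (int j) x p) *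
      (T x (m - p) * T (int i + int j - x) (n + p))) UNIV)"
    unfolding gen_def rbracket_def fst_conv snd_conv
  proof (rule psum_pair_finite[OF psummable_T_mult])
    fix x p assume x: "x \<notin> int ` targets i j"
    have "\<not> (0 \<le> x \<and> x \<le> int N \<and> x \<le> int i + int j \<and> int i + int j - x \<le> int N)"
    proof
      assume "0 \<le> x \<and> x \<le> int N \<and> x \<le> int i + int j \<and> int i + int j - x \<le> int N"
      then have "x = int (nat x)" "nat x \<in> targets i j"
        by (auto simp: targets_def)
      with x show False by blast
    qed
    then show "cst (C (int i) (int j) x p) * (T x (m - p) * T (int i + int j - x) (n + p)) = 0"
      by (auto simp: T_def)
  qed simp
  also have "\<dots> = (\<Sum>x\<in>targets i j. psum (\<lambda>p. cst (K i j x p) * (t x (m - p) * t (i + j - x) (n + p))) UNIV)"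
  proof (subst sum.reindex, simp add: inj_on_def, rule sum.cong[OF refl])
    fix x assume x: "x \<in> targets i j"
    have T: "T (int x) r = cst (\<kappa> x) * t x r" if "x \<le> N" for x r
      using that by (simp add: T_def \<kappa>_def)
    have eq: "int i + int j - int x = int (i + j - x)" and le: "x \<le> N" "i + j - x \<le> N"
      using x by (auto simp: targets_def of_nat_diff)
    show "((\<lambda>x. psum (\<lambda>p. cst (C (int i) (int j) x p) * (T x (m - p) * T (int i + int j - x) (n + p))) UNIV) \<circ> int) x =
      psum (\<lambda>p. cst (K i j x p) * (t x (m - p) * t (i + j - x) (n + p))) UNIV"
      by (simp only: o_def eq T[OF le(1)] T[OF le(2)] K_def cst_mult mult_ac)
  qed
  finally show ?thesis .
qed

lemma psummable_t: "psummable (\<lambda>p. cst (g p) * (t x (m - p) * t y (n + p))) UNIV"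
proof -
  have "psummable (\<lambda>p. t x p) UNIV"
    unfolding psummable_def
  proof
    fix X
    have "{p \<in> UNIV. coeff (t x p) X \<noteq> 0} \<subseteq> insert 0 (snd ` set_mset X)"
      by (cases "x = 0") (auto simp: t_0 t_pos coeff_one coeff_V split: if_splits)
    then show "finite {p \<in> UNIV. coeff (t x p) X \<noteq> 0}"
      by (rule finite_subset) simp
  qed
  then have "psummable (\<lambda>p. t x (m - p)) UNIV"
    by (rule psummable_inj) (auto simp: inj_on_def)
  then show ?thesis
    by (intro psummable_mult_right psummable_mult_left)
qed

section \<open>Brackets of monomials and of series\<close>

lemma PB_tmon:
  assumes len: "length is = length ms" "length js = length ns"
    and idx: "set is \<subseteq> {1..N}" "set js \<subseteq> {1..N}"
  shows "PB (tmon is ms) (tmon js ns) = (\<Sum>l'<length js. \<Sum>l<length is. \<Sum>x\<in>targets (is ! l) (js ! l').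
    psum (\<lambda>p. cst (K (is ! l) (js ! l') x p) *
      (tmon (is[l := x]) (ms[l := ms ! l - p]) * tmon (js[l' := is ! l + js ! l' - x]) (ns[l' := ns ! l' + p]))) UNIV)"
proof -
  let ?xs = "map2 (\<lambda>i m. Pseries (tcoeff i m)) is ms" and ?ys = "map2 (\<lambda>i m. Pseries (tcoeff i m)) js ns"
  have V: "?xs ! l = V (is ! l, ms ! l)" "(is ! l, ms ! l) \<in> vars N" if "l < length is" for l
    using that len idx(1) nth_mem[OF that] by (auto simp: vars_def Pseries_tcoeff_pos subset_iff Suc_le_eq)
  have V': "?ys ! l = V (js ! l, ns ! l)" "(js ! l, ns ! l) \<in> vars N" if "l < length js" for l
    using that len idx(2) nth_mem[OF that] by (auto simp: vars_def Pseries_tcoeff_pos subset_iff Suc_le_eq)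
  have bounded: "y \<in> bounded_wt N" if "y \<in> set ?xs" for y
    using that V len by (auto simp: in_set_conv_nth bounded_wt_V)
  have bounded': "y \<in> bounded_wt N" if "y \<in> set ?ys" for y
    using that V' len by (auto simp: in_set_conv_nth bounded_wt_V)
  have "PB (tmon is ms) (tmon js ns) = (\<Sum>l'<length js. \<Sum>l<length is.
      PB (?xs ! l) (?ys ! l') * prod_list (?xs[l := 1]) * prod_list (?ys[l' := 1]))"
  proof -
    have "PB (tmon is ms) (tmon js ns) = (\<Sum>l'<length ?ys. PB (prod_list ?xs) (?ys ! l') * prod_list (?ys[l' := 1]))"
      unfolding tmon_def by (rule PB_prod_list_right[OF prod_list_bounded_wt[OF bounded] bounded'])
    also have "\<dots> = (\<Sum>l'<length js. (\<Sum>l<length is. PB (?xs ! l) (?ys ! l') * prod_list (?xs[l := 1])) * prod_list (?ys[l' := 1]))"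
    proof (rule sum.cong)
      fix l' assume "l' \<in> {..<length js}"
      then have "?ys ! l' \<in> bounded_wt N"
        using V'[of l'] by (simp only: bounded_wt_V lessThan_iff)
      from PB_prod_list_left[where ys = ?xs, OF this bounded]
      show "PB (prod_list ?xs) (?ys ! l') * prod_list (?ys[l' := 1]) =
        (\<Sum>l<length is. PB (?xs ! l) (?ys ! l') * prod_list (?xs[l := 1])) * prod_list (?ys[l' := 1])"
        using len(1) by (simp only: length_map length_zip min.idem)
    qed (use len in simp)
    finally show ?thesis
      by (simp only: sum_distrib_right)
  qed
  also have "\<dots> = (\<Sum>l'<length js. \<Sum>l<length is. \<Sum>x\<in>targets (is ! l) (js ! l').
    psum (\<lambda>p. cst (K (is ! l) (js ! l') x p) *
      (tmon (is[l := x]) (ms[l := ms ! l - p]) * tmon (js[l' := is ! l + js ! l' - x]) (ns[l' := ns ! l' + p]))) UNIV)"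
  proof (intro sum.cong refl)
    fix l' l assume "l' \<in> {..<length js}" "l \<in> {..<length is}"
    then have l: "l' < length js" "l < length is" by auto
    have "PB (?xs ! l) (?ys ! l') = gen (is ! l, ms ! l) (js ! l', ns ! l')"
      using V[OF l(2)] V'[OF l(1)] by (simp add: PB_V_V)
    then show "PB (?xs ! l) (?ys ! l') * prod_list (?xs[l := 1]) * prod_list (?ys[l' := 1]) =
      (\<Sum>x\<in>targets (is ! l) (js ! l'). psum (\<lambda>p. cst (K (is ! l) (js ! l') x p) *
      (tmon (is[l := x]) (ms[l := ms ! l - p]) * tmon (js[l' := is ! l + js ! l' - x]) (ns[l' := ns ! l' + p]))) UNIV)"
      by (simp only: gen_sum sum_distrib_right psum_mult_left psummable_t psummable_mult_left
          tmon_update[OF len(1) l(2)] tmon_update[OF len(2) l(1)])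
         (simp only: t_def mult_ac)
  qed
  finally show ?thesis .
qed

lemma PB_tseries:
  assumes idx: "set is \<subseteq> {1..N}" "set js \<subseteq> {1..N}"
  shows "PB (tseries is M c) (tseries js M' d) = (\<Sum>l'<length js. \<Sum>l<length is. \<Sum>x\<in>targets (is ! l) (js ! l').
    tseries (is[l := x] @ js[l' := is ! l + js ! l' - x]) (M + M')
      (\<lambda>rs. let ms = take (length is) rs; ns = drop (length is) rs; p = M - sum_list ms in
      c (ms[l := ms ! l + p]) * (d (ns[l' := ns ! l' - p]) * K (is ! l) (js ! l') x p)))"
proof -
  define fam where "fam l l' x = (\<lambda>((ms, ns), p). cst (c ms * (d ns * K (is ! l) (js ! l') x p)) *
      (tmon (is[l := x]) (ms[l := ms ! l - p]) * tmon (js[l' := is ! l + js ! l' - x]) (ns[l' := ns ! l' + p])))"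
    for l l' x
  let ?A = "slice is M \<times> slice js M'"
  have idx0: "set is \<subseteq> {0..N}" "set js \<subseteq> {0..N}"
    using idx by auto
  have fam: "psummable (\<lambda>(r, p). fam l l' x (r, p)) (?A \<times> UNIV)"
      "psum (\<lambda>(r, p). fam l l' x (r, p)) (?A \<times> UNIV) = tseries (is[l := x] @ js[l' := is ! l + js ! l' - x]) (M + M')
        (\<lambda>rs. let ms = take (length is) rs; ns = drop (length is) rs; p = M - sum_list ms in
        c (ms[l := ms ! l + p]) * (d (ns[l' := ns ! l' - p]) * K (is ! l) (js ! l') x p))"
    if "l < length is" "l' < length js" for l l' x
    using tseries_shift[OF that, of c d "K (is ! l) (js ! l') x" x "is ! l + js ! l' - x" M M']
    by (simp_all add: fam_def)
  note summable = psummable_psum[OF fam(1)]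
  have "PB (tseries is M c) (tseries js M' d) = psum (\<lambda>(ms, ns). PB (cst (c ms) * tmon is ms) (cst (d ns) * tmon js ns)) ?A"
    unfolding tseries_def by (rule PB_psum) (intro psummable_D_tmon psummable_tmon_slice idx0)+
  also have "\<dots> = psum (\<lambda>r. \<Sum>l'<length js. \<Sum>l<length is. \<Sum>x\<in>targets (is ! l) (js ! l').
      psum (\<lambda>p. fam l l' x (r, p)) UNIV) ?A"
  proof (rule psum_cong[OF refl])
    fix r assume "r \<in> ?A"
    then obtain ms ns where r: "r = (ms, ns)" "length is = length ms" "length js = length ns"
      by (auto simp: slice_def)
    have "(case r of (ms, ns) \<Rightarrow> PB (cst (c ms) * tmon is ms) (cst (d ns) * tmon js ns))
      = cst (c ms) * (cst (d ns) * PB (tmon is ms) (tmon js ns))"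
      by (simp add: r PB_cst_left PB_cst_right)
    also have "\<dots> = (\<Sum>l'<length js. \<Sum>l<length is. \<Sum>x\<in>targets (is ! l) (js ! l').
      psum (\<lambda>p. fam l l' x (r, p)) UNIV)"
      unfolding PB_tmon[OF r(2,3) idx] sum_distrib_left psum_cst_mult[symmetric]
      by (intro sum.cong psum_cong refl) (simp add: fam_def r(1) cst_mult mult_ac)
    finally show "(case r of (ms, ns) \<Rightarrow> PB (cst (c ms) * tmon is ms) (cst (d ns) * tmon js ns)) = \<dots>" .
  qed
  also have "\<dots> = (\<Sum>l'<length js. psum (\<lambda>r. \<Sum>l<length is. \<Sum>x\<in>targets (is ! l) (js ! l').
      psum (\<lambda>p. fam l l' x (r, p)) UNIV) ?A)"
    by (intro psum_sum psummable_sum summable) auto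
  also have "\<dots> = (\<Sum>l'<length js. \<Sum>l<length is. psum (\<lambda>r. \<Sum>x\<in>targets (is ! l) (js ! l').
      psum (\<lambda>p. fam l l' x (r, p)) UNIV) ?A)"
    by (intro sum.cong refl psum_sum psummable_sum summable) auto
  also have "\<dots> = (\<Sum>l'<length js. \<Sum>l<length is. \<Sum>x\<in>targets (is ! l) (js ! l').
      psum (\<lambda>r. psum (\<lambda>p. fam l l' x (r, p)) UNIV) ?A)"
    by (intro sum.cong refl psum_sum summable) auto
  also have "\<dots> = (\<Sum>l'<length js. \<Sum>l<length is. \<Sum>x\<in>targets (is ! l) (js ! l').
      tseries (is[l := x] @ js[l' := is ! l + js ! l' - x]) (M + M')
        (\<lambda>rs. let ms = take (length is) rs; ns = drop (length is) rs; p = M - sum_list ms in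
        c (ms[l := ms ! l + p]) * (d (ns[l' := ns ! l' - p]) * K (is ! l) (js ! l') x p)))"
    by (intro sum.cong refl) (simp only: psum_Sigma[OF fam(1)] fam(2) lessThan_iff)
  finally show ?thesis .
qed

end


section \<open>Poisson structures\<close>

lemma q_local_bounded_wt: 
  assumes "F \<in> q_local q N" 
  shows "Pseries F \<in> bounded_wt N"
  using assms
proof induction
  case (series "is" c M)
  then have is0: "0 \<notin> set is" "set is \<subseteq> {0..N}" by auto
  show ?case
    unfolding Pseries_local_series[OF is0(1)]
  proof (rule bounded_wtI[of "{M}"])
    fix X assume "coeff (tseries is M c) X \<noteq> 0"
    then obtain ms where "ms \<in> slice is M" "coeff (cst (c ms) * tmon is ms) X \<noteq> 0"
      unfolding tseries_def coeff_psum by (metis (mono_tags, lifting) mem_Collect_eq sum.neutral)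
    then have "length is = length ms" "sum_list ms = M" "coeff (tmon is ms) X \<noteq> 0"
      by (auto simp: slice_def)
    then show "wt X \<in> {M} \<and> set_mset X \<subseteq> vars N"
      using coeff_tmon_nonzero[of "is" ms X N] is0(2) by simp
  qed simp
qed (auto simp: Pseries_fadd Pseries_fscale simp flip: zero_pseries_def)

lemma q_local_sum:
  "(\<And>i. i \<in> I \<Longrightarrow> coeff (F i) \<in> q_local q N) \<Longrightarrow> coeff (\<Sum>i\<in>I. F i) \<in> q_local q N"
  by (induction I rule: infinite_finite_induct)
     (auto simp: zero_pseries_def plus_pseries_def intro: q_local.zero q_local.add)

lemma coeff_cst_mult_eq: "coeff (cst a * F) = fscale a (coeff F)"
  by (simp add: fscale_def fun_eq_iff)

lemma coeff_plus_eq: "coeff (F + G) = fadd (coeff F) (coeff G)"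
  by (simp add: fadd_def fun_eq_iff)

lemma coeff_times_eq: "coeff (F * G) = fmul (coeff F) (coeff G)"
  by (simp add: times_pseries_def)

lemma coeff_zero_eq: "coeff 0 = fzero"
  by (simp add: zero_pseries_def)

context qdiff
begin

lemma PB_tseries_q_local:
  assumes idx: "set is \<subseteq> {1..N}" "set js \<subseteq> {1..N}"
    and reg: "regular_rational q (length is) c" "regular_rational q (length js) d"
  shows "coeff (PB (tseries is M c) (tseries js M' d)) \<in> q_local q N"
  unfolding PB_tseries[OF idx]
proof (intro q_local_sum tseries_q_local)
  fix l l' x assume *: "l' \<in> {..<length js}" "l \<in> {..<length is}" "x \<in> targets (is ! l) (js ! l')"
  have "set (is[l := x]) \<subseteq> {0..N}" 
    by (rule order_trans[OF set_update_subset_insert]) (use idx(1) *(3) in \<open>auto simp: targets_def\<close>)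
  moreover have "set (js[l' := is ! l + js ! l' - x]) \<subseteq> {0..N}" 
    by (rule order_trans[OF set_update_subset_insert]) (use idx(2) *(3) in \<open>auto simp: targets_def\<close>)
  ultimately show "set (is[l := x] @ js[l' := is ! l + js ! l' - x]) \<subseteq> {0..N}"
    by simp
  have "regular_rational q n (\<lambda>ms. K (is ! l) (js ! l') x (\<psi> ms))" if "regular_exponent q n \<psi>" for n \<psi>
    unfolding K_def by (intro regular_mult regular_const regular_C that)
  then show "regular_rational q (length (is[l := x] @ js[l' := is ! l + js ! l' - x]))
      (\<lambda>rs. let ms = take (length is) rs; ns = drop (length is) rs; p = M - sum_list ms in
      c (ms[l := ms ! l + p]) * (d (ns[l' := ns ! l' - p]) * K (is ! l) (js ! l') x p))"
    using regular_shift[OF q0 reg, of l l' "K (is ! l) (js ! l') x" M] * by simp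
qed

lemma PB_q_local:
  assumes "F \<in> q_local q N" "G \<in> q_local q N"
  shows "coeff (PB (Pseries F) (Pseries G)) \<in> q_local q N"
  using assms(1)
proof induction
  case (series "is" c M)
  note 1 = series
  from assms(2) show ?case
  proof induction
    case (series js d M')
    then have "0 \<notin> set is" "0 \<notin> set js" using 1 by auto
    then show ?case
      using PB_tseries_q_local[OF 1(1) series(1) 1(2) series(2)] by (simp add: Pseries_local_series)
  next
    case zero
    have "PB F 0 = 0" for F using PB_cst_right[of F 0 0] by simp
    then show ?case by (simp add: coeff_zero_eq q_local.zero flip: zero_pseries_def)
  next
    case (add G H)
    have "Pseries (local_series is M c) \<in> bounded_wt N"
      using 1 by (intro q_local_bounded_wt q_local.series)
    then show ?case
      using add by (simp add: Pseries_fadd PB_add_right q_local_bounded_wt coeff_plus_eq q_local.add)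
  next
    case (scale G a)
    then show ?case by (simp add: Pseries_fscale PB_cst_right coeff_cst_mult_eq q_local.scale)
  qed
next
  case zero
  have "PB 0 F = 0" for F using PB_cst_left[of 0 0 F] by simp
  then show ?case by (simp add: coeff_zero_eq q_local.zero flip: zero_pseries_def)
next
  case (add F H)
  then show ?case
    using q_local_bounded_wt[OF assms(2)]
    by (simp add: Pseries_fadd PB_add_left q_local_bounded_wt coeff_plus_eq q_local.add)
next
  case (scale F a)
  then show ?case by (simp add: Pseries_fscale PB_cst_left coeff_cst_mult_eq q_local.scale)
qed

end

text \<open>Rules in the left argument follow from those in the right one by antisymmetry. Closure
  of the generated algebra takes two inductions, the right argument first, through the Leibniz rule;
  a constant needs B F 1 = 0. The Jacobi identity is inherited from the larger class of functionals
  of bounded weight.\<close>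

lemma poisson_structureI:
  fixes B :: "pseries \<Rightarrow> pseries \<Rightarrow> pseries"
  assumes V_bounded: "\<And>F. F \<in> \<A> \<Longrightarrow> Pseries F \<in> bounded_wt N"
    and br: "\<And>F G. Pseries F \<in> bounded_wt N \<Longrightarrow> Pseries G \<in> bounded_wt N \<Longrightarrow> Pseries (br F G) = B (Pseries F) (Pseries G)"
    and closed: "\<And>F G. F \<in> \<A> \<Longrightarrow> G \<in> \<A> \<Longrightarrow> coeff (B (Pseries F) (Pseries G)) \<in> \<A>"
    and one: "\<And>F. B F 1 = 0"
    and antisym: "\<And>F G. B F G = - B G F"
    and scale: "\<And>F G a. B F (cst a * G) = cst a * B F G"
    and add: "\<And>F G H. F \<in> bounded_wt N \<Longrightarrow> G \<in> bounded_wt N \<Longrightarrow> H \<in> bounded_wt N \<Longrightarrow>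
        B F (G + H) = B F G + B F H"
    and mult: "\<And>F G H. F \<in> bounded_wt N \<Longrightarrow> G \<in> bounded_wt N \<Longrightarrow> H \<in> bounded_wt N \<Longrightarrow>
        B F (G * H) = B F G * H + G * B F H"
    and bounded: "\<And>F G. F \<in> bounded_wt N \<Longrightarrow> G \<in> bounded_wt N \<Longrightarrow> B F G \<in> bounded_wt N"
    and jacobi: "\<And>F G H. F \<in> bounded_wt N \<Longrightarrow> G \<in> bounded_wt N \<Longrightarrow> H \<in> bounded_wt N \<Longrightarrow>
        B F (B G H) + B G (B H F) + B H (B F G) = 0"
  shows "poisson_structure \<A> br"
proof -
  let ?A = "generated_algebra \<A>"
  let ?W = "bounded_wt N"
  have gen: "Pseries F \<in> ?W" if "F \<in> ?A" for F
    using that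
    by induction (auto simp: V_bounded Pseries_fadd Pseries_fscale Pseries_fmul simp flip: one_pseries_def)
  have fzero: "Pseries fzero = 0" and fone: "Pseries fone = 1"
    by (simp_all add: pseries_defs)
  note P = Pseries_fadd Pseries_fscale Pseries_fmul fzero fone
  have eqI: "F = G" if "Pseries F = Pseries G" for F G
    using that by (metis coeff_Pseries)
  have br_eq: "br F G = coeff (B (Pseries F) (Pseries G))" if "Pseries F \<in> ?W" "Pseries G \<in> ?W" for F G
    using br[OF that] by (metis coeff_Pseries)
  have fzero_A: "fzero \<in> ?A"
    using generated_algebra.scale[OF generated_algebra.one, of 0] by (simp add: fscale_def fzero_def)
  have scale_left: "B (cst a * F) G = cst a * B F G" for a F G
    using scale[of G a F] by (simp add: antisym[of _ G])
  have add_left: "B (F + G) H = B F H + B G H" if "F \<in> ?W" "G \<in> ?W" "H \<in> ?W" for F G H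
    using add[OF that(3,1,2)] by (simp add: antisym[of _ H])
  have mult_left: "B (G * H) F = B G F * H + G * B H F" if "F \<in> ?W" "G \<in> ?W" "H \<in> ?W" for F G H
    using mult[OF that] by (simp add: antisym[of _ F])
  have closed_right: "coeff (B (Pseries F) (Pseries G)) \<in> ?A" if F: "F \<in> \<A>" and "G \<in> ?A" for F G
    using that(2)
  proof induction
    case (base G)
    then show ?case using closed[OF F] by (blast intro: generated_algebra.base)
  next
    case one
    then show ?case using fzero_A by (simp add: fone assms(4) coeff_zero_eq)
  next
    case (add G H)
    then show ?case using F by (simp add: P assms(7) gen V_bounded coeff_plus_eq generated_algebra.add)
  next
    case (scale G a)
    then show ?case by (simp add: P assms(6) coeff_cst_mult_eq generated_algebra.scale)
  next
    case (mult G H)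
    then show ?case using F
      by (simp add: P assms(8) gen V_bounded coeff_plus_eq coeff_times_eq generated_algebra.add generated_algebra.mult)
  qed
  have closed_A: "coeff (B (Pseries F) (Pseries G)) \<in> ?A" if "F \<in> ?A" and G: "G \<in> ?A" for F G
    using that(1)
  proof induction
    case (base F)
    then show ?case using closed_right G by blast
  next
    case one
    then show ?case using fzero_A antisym[of 1 "Pseries G"] by (simp add: fone assms(4) coeff_zero_eq)
  next
    case (add F H)
    then show ?case using G by (simp add: P add_left gen coeff_plus_eq generated_algebra.add)
  next
    case (scale F a)
    then show ?case by (simp add: P scale_left coeff_cst_mult_eq generated_algebra.scale)
  next
    case (mult F H)
    then show ?case using G
      by (simp add: P mult_left gen coeff_plus_eq coeff_times_eq generated_algebra.add generated_algebra.mult)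
  qed
  show ?thesis
    unfolding poisson_structure_def
  proof (intro conjI ballI)
    fix F G assume "F \<in> \<A>" "G \<in> \<A>"
    then show "br F G \<in> \<A>" by (simp add: br_eq V_bounded closed)
  next
    fix F G assume "F \<in> ?A" "G \<in> ?A"
    then show "br F G \<in> ?A" by (simp add: br_eq gen closed_A)
  next
    show "bilinear_on ?A br"
      unfolding bilinear_on_def
      by (intro conjI ballI allI; rule eqI)
         (simp_all add: P br gen bounded_wt_add bounded_wt_cst_mult add add_left scale scale_left)
  next
    show "antisymmetric_on ?A br"
      unfolding antisymmetric_on_def
    proof (intro ballI eqI)
      fix F G assume "F \<in> ?A" "G \<in> ?A"
      then show "Pseries (br F G) = Pseries (fscale (- 1) (br G F))"
        using antisym[of "Pseries F" "Pseries G"] by (simp add: P br gen cst_minus)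
    qed
  next
    show "leibniz_on ?A br"
      unfolding leibniz_on_def
      by (intro conjI ballI allI; rule eqI) (simp_all add: P br gen bounded_wt_mult bounded mult mult_left)
  next
    show "jacobi_on ?A br"
      unfolding jacobi_on_def
    proof (intro ballI eqI)
      fix F G H assume "F \<in> ?A" "G \<in> ?A" "H \<in> ?A"
      then show "Pseries (fadd (br F (br G H)) (fadd (br G (br H F)) (br H (br F G)))) = Pseries fzero"
        using jacobi[of "Pseries F" "Pseries G" "Pseries H"]
        by (simp add: P br gen bounded add.assoc)
    qed
  qed
qed

theorem proposition2:
  fixes q :: complex and N :: nat and a b :: complex
  assumes "q \<noteq> 0"
    and "\<And>n :: nat. n > 0 \<Longrightarrow> q ^ n \<noteq> 1"
    and "N \<ge> 2"
  shows "poisson_structure (q_local q N)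
           (\<lambda>F G. fadd (fscale a (bracket1 q N F G)) (fscale b (bracket2 q N F G)))"
proof -
  \<comment> \<open>The values 0, 1, 2 of \<open>lam\<close> give the second bracket minus the
    first, the second bracket, and their sum.\<close>
  interpret P0: qdiff q N 0 by unfold_locales (use assms in auto)
  interpret P1: qdiff q N 1 by unfold_locales (use assms in auto)
  interpret P2: qdiff q N 2 by unfold_locales (use assms in auto)
  \<comment> \<open>On functionals of bounded weight \<open>P2.PB F G - P1.PB F G\<close> is the
    first bracket. As a difference it inherits its formal rules from brackets of the form
    \<open>rbracket\<close>.\<close>
  define B where "B F G = cst a * (P2.PB F G - P1.PB F G) + cst b * P1.PB F G" for F G
  let ?W = "bounded_wt N"
  show ?thesis
  proof (rule poisson_structureI[where B = B and N = N])
    fix F assume "F \<in> q_local q N"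
    then show "Pseries F \<in> ?W" by (rule q_local_bounded_wt)
  next
    fix F G assume "Pseries F \<in> ?W" "Pseries G \<in> ?W"
    from P1.PB_eq[OF this] P2.PB_eq[OF this]
    show "Pseries (fadd (fscale a (bracket1 q N F G)) (fscale b (bracket2 q N F G))) = B (Pseries F) (Pseries G)"
      by (simp add: B_def Pseries_fadd Pseries_fscale ext_bracket_def bracket1_def bracket2_def)
  next
    fix F G assume "F \<in> q_local q N" "G \<in> q_local q N"
    note * = P1.PB_q_local[OF this] P2.PB_q_local[OF this]
    have "coeff (cst a * (P2.PB (Pseries F) (Pseries G) + cst (- 1) * P1.PB (Pseries F) (Pseries G))
        + cst b * P1.PB (Pseries F) (Pseries G)) \<in> q_local q N"
      unfolding coeff_plus_eq coeff_cst_mult_eq by (intro q_local.add q_local.scale *)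
    then show "coeff (B (Pseries F) (Pseries G)) \<in> q_local q N"
      by (simp add: B_def cst_minus)
  next
    fix F G
    show "B F G = - B G F"
      using P1.PB_antisym[of F G] P2.PB_antisym[of F G] by (simp add: B_def algebra_simps)
  next
    fix F G c
    show "B F (cst c * G) = cst c * B F G"
      unfolding B_def P1.PB_cst_right P2.PB_cst_right by (simp add: algebra_simps)
  next
    fix F G assume W: "F \<in> ?W" "G \<in> ?W"
    have "cst a * (P2.PB F G + cst (- 1) * P1.PB F G) + cst b * P1.PB F G \<in> ?W"
      using P1.bounded_wt_PB[OF W] P2.bounded_wt_PB[OF W] by blast
    then show "B F G \<in> ?W"
      by (simp add: B_def cst_minus)
  next
    fix F G H assume W: "F \<in> ?W" "G \<in> ?W" "H \<in> ?W"
    define b1 where "b1 F G = P2.PB F G - P1.PB F G" for F G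
    \<comment> \<open>The cross term of a double bracket. Its vanishing cyclic sum is the
      compatibility condition.\<close>
    define mix where "mix F G H = b1 F (P1.PB G H) + P1.PB F (b1 G H)" for F G H
    have P2: "P2.PB F G = P1.PB F G + b1 F G" for F G
      by (simp add: b1_def)
    have P0: "P0.PB F G = P1.PB F G + cst (- 1) * b1 F G" if "F \<in> ?W" "G \<in> ?W" for F G
      using that by (simp add: b1_def P0.PB_eq P1.PB_eq P2.PB_eq cst_minus)
    have B: "B F G = cst b * P1.PB F G + cst a * b1 F G" for F G
      by (simp add: B_def b1_def)
    have b1_W: "b1 F G \<in> ?W" if "F \<in> ?W" "G \<in> ?W" for F G
      using bounded_wt_add[OF P2.bounded_wt_PB[OF that] bounded_wt_cst_mult[OF P1.bounded_wt_PB[OF that], of "- 1"]]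
      by (simp add: b1_def cst_minus)
    have expand: "cst c * P1.PB F (cst c * P1.PB G H + cst d * b1 G H) + cst d * b1 F (cst c * P1.PB G H + cst d * b1 G H)
      = cst (c * c) * P1.PB F (P1.PB G H) + cst (c * d) * mix F G H + cst (d * d) * b1 F (b1 G H)"
      if "F \<in> ?W" "G \<in> ?W" "H \<in> ?W" for F G H c d
    proof -
      have W: "cst c * P1.PB G H \<in> ?W" "cst d * b1 G H \<in> ?W"
        using that by (auto intro: b1_W)
      show ?thesis
        unfolding mix_def b1_def[of F]
        by (simp add: P1.PB_add_right P2.PB_add_right that W P1.PB_cst_right P2.PB_cst_right cst_mult)
           (simp add: algebra_simps)
    qed
    have B_B: "B F (B G H) = cst (b * b) * P1.PB F (P1.PB G H) + cst (b * a) * mix F G H + cst (a * a) * b1 F (b1 G H)"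
      if "F \<in> ?W" "G \<in> ?W" "H \<in> ?W" for F G H
      unfolding B by (rule expand[OF that])
    have P2_P2: "P2.PB F (P2.PB G H) = P1.PB F (P1.PB G H) + mix F G H + b1 F (b1 G H)"
      if "F \<in> ?W" "G \<in> ?W" "H \<in> ?W" for F G H
      unfolding P2 using expand[OF that, of 1 1] by simp
    have P0_P0: "P0.PB F (P0.PB G H) = P1.PB F (P1.PB G H) - mix F G H + b1 F (b1 G H)"
      if "F \<in> ?W" "G \<in> ?W" "H \<in> ?W" for F G H
      using expand[OF that, of 1 "- 1"] P0[OF that(2,3)] P0[OF that(1) P0.bounded_wt_PB[OF that(2,3)]]
      by (simp add: cst_minus)
    define jP jm jb where "jP = P1.PB F (P1.PB G H) + P1.PB G (P1.PB H F) + P1.PB H (P1.PB F G)"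
      and "jm = mix F G H + mix G H F + mix H F G"
      and "jb = b1 F (b1 G H) + b1 G (b1 H F) + b1 H (b1 F G)"
    have 1: "jP = 0"
      unfolding jP_def using W by (rule P1.jacobi_PB)
    \<comment> \<open>The Jacobi sum at parameter \<open>lam\<close> is jP + (lam - 1) jm + (lam -
      1)^2 jb, evaluated at 2 and at 0. With jP = 0 the two values separate jm from jb.\<close>
    have "jP + jm + jb = 0" "jP - jm + jb = 0"
      using P2.jacobi_PB[OF W] P0.jacobi_PB[OF W] W
      by (simp_all add: P2_P2 P0_P0 jP_def jm_def jb_def algebra_simps)
    then have 2: "jm + jb = 0" "jb - jm = 0"
      using 1 by simp_all
    then have "jb + jb = 0"
      by (simp add: algebra_simps)
    then have 3: "jb = 0"
      by (rule P1.double_eq_0)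
    have "B F (B G H) + B G (B H F) + B H (B F G) = cst (b * b) * jP + cst (b * a) * jm + cst (a * a) * jb"
      using W by (simp add: B_B jP_def jm_def jb_def algebra_simps)
    then show "B F (B G H) + B G (B H F) + B H (B F G) = 0"
      using 1 2 3 by simp
  qed (auto simp: B_def P1.PB_one P2.PB_one P1.PB_add_right P2.PB_add_right
      P1.PB_mult_right P2.PB_mult_right algebra_simps)
qed

end
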